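(* Let $H$ be a Hopf $\pi$-coalgebra, let $(C,\sigma)$ be a left $\pi$-coisotropic quantum subgroup of $H$, and let $(V,\rho)$ and $(W,\psi)$ be two right $\pi$-comodules over $C$. Then $$Ind(\rho\oplus\psi)\cong Ind(\rho)\oplus Ind(\psi)$$ as right $\pi$-comodules over $H$.
   Context: Everything is over a field $K$: spaces, linear maps, tensor products; algebras are associative and unital. $I$ denotes identity maps. $\pi$ is a group with neutral element $1$. A $\pi$-coalgebra is a family $C=\{C_\alpha\}_{\alpha\in\pi}$ of $K$-spaces with linear maps $\Delta_{\alpha,\beta}:C_{\alpha\beta}\to C_\alpha\otimes C_\beta$ and $\epsilon:C_1\to K$ such that $(\Delta_{\alpha,\beta}\otimes I)\Delta_{\alpha\beta,\gamma}=(I\otimes\Delta_{\beta,\gamma})\Delta_{\alpha,\beta\gamma}$ and $(\epsilon\otimes I)\Delta_{1,\alpha}=I=(I\otimes\epsilon)\Delta_{\alpha,1}$ (identifying $K\otimes C_\alpha\cong C_\alpha\cong C_\alpha\otimes K$). A Hopf $\pi$-coalgebra is a $\pi$-coalgebra $H=\{H_\alpha\}$ with linear maps $S_\alpha:H_\alpha\to H_{\alpha^{-1}}$ such that each $H_\alpha$ is an algebra (multiplication $\mu_\alpha$, unit $1_\alpha$), all $\Delta_{\alpha,\beta}$ and $\epsilon$ are algebra maps, and $\mu_\alpha(S_{\alpha^{-1}}\otimes I)\Delta_{\alpha^{-1},\alpha}=1_\alpha\epsilon=\mu_\alpha(I\otimes S_{\alpha^{-1}})\Delta_{\alpha,\alpha^{-1}}$.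 A right $\pi$-comodule $(M,\theta)$ over a $\pi$-coalgebra $C$ is a family $M=\{M_\alpha\}$ of spaces with linear maps $\theta_{\alpha,\beta}:M_{\alpha\beta}\to M_\alpha\otimes C_\beta$ such that $(\theta_{\alpha,\beta}\otimes I)\theta_{\alpha\beta,\gamma}=(I\otimes\Delta_{\beta,\gamma})\theta_{\alpha,\beta\gamma}$ and $(I\otimes\epsilon)\theta_{\alpha,1}=I$ (up to $M_\alpha\otimes K\cong M_\alpha$). Right $\pi$-comodules $(M,\theta)$, $(N,\theta')$ are equivalent (isomorphic, $\cong$) if there is a family of vector space isomorphisms $F_\alpha:M_\alpha\to N_\alpha$ with $\theta'_{\alpha,\beta}F_{\alpha\beta}=(F_\alpha\otimes I)\theta_{\alpha,\beta}$ for all $\alpha,\beta\in\pi$. The direct sum of $(M,\theta)$ and $(N,\theta')$ is $\{M_\alpha\oplus N_\alpha\}_{\alpha\in\pi}$ with coaction $(\theta\oplus\theta')_{\alpha,\beta}=(l^M_\alpha\otimes I)\theta_{\alpha,\beta}P^M_{\alpha\beta}+(l^N_\alpha\otimes I)\theta'_{\alpha,\beta}P^N_{\alpha\beta}$, where $P^M_\alpha,P^N_\alpha$ are the natural projections of $M_\alpha\oplus N_\alpha$ onto $M_\alpha,N_\alpha$ and $l^M_\alpha,l^N_\alpha$ the natural inclusions. A left $\pi$-coisotropic quantum subgroup of $H$ is a pair $(C,\sigma)$ where $C$ is a $\pi$-coalgebra, each $C_\alpha$ carries a left $H_\alpha$-module structure, and $\sigma=\{\sigma_\alpha:H_\alpha\to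 C_\alpha\}$ is a family of surjective linear maps such that each $\sigma_\alpha$ is left $H_\alpha$-linear, $\Delta^C_{\alpha,\beta}\sigma_{\alpha\beta}=(\sigma_\alpha\otimes\sigma_\beta)\Delta^H_{\alpha,\beta}$, and $\epsilon^C\sigma_1=\epsilon^H$. For a right $\pi$-comodule $(V,\rho)$ over $C$, the induced representation $Ind(\rho)$ is the right $\pi$-comodule over $H$ with $Ind(\rho)_\alpha=\{x\in V_1\otimes H_\alpha:(I_{V_1}\otimes L_{1,\alpha})(x)=(\rho_{1,1}\otimes I_{H_\alpha})(x)\}$, where $L_{1,\alpha}=(\sigma_1\otimes I_{H_\alpha})\Delta^H_{1,\alpha}$, and with coaction $I_{V_1}\otimes\Delta^H_{\alpha,\beta}:Ind(\rho)_{\alpha\beta}\to Ind(\rho)_\alpha\otimes H_\beta$. *)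

theory Defs
  imports "HOL-Algebra.Module" "HOL-Algebra.AbelCoset"
begin

section \<open>Linear algebra over a field\<close>

text \<open>
  A \<open>K\<close>-space is a \<^locale>\<open>module\<close> over the field \<open>K\<close>.  The record type \<^typ>\<open>('k, 'm) module\<close>
  also has the fields \<^const>\<open>mult\<close> and \<^const>\<open>one\<close>; they carry meaning only where the space is
  assumed to be an algebra, and are never used otherwise.
\<close>

definition linear_maps ::
  "'k ring \<Rightarrow> ('k, 'm) module \<Rightarrow> ('k, 'n) module \<Rightarrow> ('m \<Rightarrow> 'n) set"
  where "linear_maps K M N =
    {f. f \<in> carrier M \<rightarrow> carrier N \<and>
        (\<forall>x\<in>carrier M. \<forall>y\<in>carrier M. f (x \<oplus>\<^bsub>M\<^esub> y) = f x \<oplus>\<^bsub>N\<^esub> f y) \<and>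
        (\<forall>a\<in>carrier K. \<forall>x\<in>carrier M. f (a \<odot>\<^bsub>M\<^esub> x) = a \<odot>\<^bsub>N\<^esub> f x)}"

text \<open>The locale \<^locale>\<open>algebra\<close> of the library is restricted to commutative algebras.\<close>

locale assoc_algebra = module K A + ring A for K :: "'k ring" and A :: "('k, 'a) module" +
  assumes smult_mult_left:
      "\<lbrakk>a \<in> carrier K; x \<in> carrier A; y \<in> carrier A\<rbrakk> \<Longrightarrow>
        (a \<odot>\<^bsub>A\<^esub> x) \<otimes>\<^bsub>A\<^esub> y = a \<odot>\<^bsub>A\<^esub> (x \<otimes>\<^bsub>A\<^esub> y)"
    and smult_mult_right:
      "\<lbrakk>a \<in> carrier K; x \<in> carrier A; y \<in> carrier A\<rbrakk> \<Longrightarrow>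
        x \<otimes>\<^bsub>A\<^esub> (a \<odot>\<^bsub>A\<^esub> y) = a \<odot>\<^bsub>A\<^esub> (x \<otimes>\<^bsub>A\<^esub> y)"

locale left_algebra_module = A: assoc_algebra K A + M: module K M
  for K :: "'k ring" and A :: "('k, 'a) module" and M :: "('k, 'm) module" +
  fixes act :: "'a \<Rightarrow> 'm \<Rightarrow> 'm"
  assumes act_linear_left: "x \<in> carrier M \<Longrightarrow> (\<lambda>a. act a x) \<in> linear_maps K A M"
    and act_linear_right: "a \<in> carrier A \<Longrightarrow> act a \<in> linear_maps K M M"
    and act_mult: "\<lbrakk>a \<in> carrier A; b \<in> carrier A; x \<in> carrier M\<rbrakk> \<Longrightarrow>
      act (a \<otimes>\<^bsub>A\<^esub> b) x = act a (act b x)"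
    and act_one: "x \<in> carrier M \<Longrightarrow> act \<one>\<^bsub>A\<^esub> x = x"

definition ground :: "'k ring \<Rightarrow> ('k, 'k) module"
  where "ground K = \<lparr>carrier = carrier K, mult = mult K, one = one K,
    zero = zero K, add = add K, smult = mult K\<rparr>"

definition direct_sum :: "('k, 'm) module \<Rightarrow> ('k, 'n) module \<Rightarrow> ('k, 'm \<times> 'n) module"
  where "direct_sum M N =
    \<lparr>carrier = carrier M \<times> carrier N,
     mult = (\<lambda>(x, y) (x', y'). (x \<otimes>\<^bsub>M\<^esub> x', y \<otimes>\<^bsub>N\<^esub> y')),
     one = (\<one>\<^bsub>M\<^esub>, \<one>\<^bsub>N\<^esub>),
     zero = (\<zero>\<^bsub>M\<^esub>, \<zero>\<^bsub>N\<^esub>),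
     add = (\<lambda>(x, y) (x', y'). (x \<oplus>\<^bsub>M\<^esub> x', y \<oplus>\<^bsub>N\<^esub> y')),
     smult = (\<lambda>a (x, y). (a \<odot>\<^bsub>M\<^esub> x, a \<odot>\<^bsub>N\<^esub> y))\<rparr>"


section \<open>Tensor products\<close>

text \<open>
  \<open>M \<otimes> N\<close> is the free space on \<open>carrier M \<times> carrier N\<close> modulo the subspace generated by the
  bilinearity relations; its elements are cosets.
\<close>

type_synonym ('k, 'm, 'n) tensor = "('m \<times> 'n \<Rightarrow> 'k) set"

definition free_space :: "'k ring \<Rightarrow> 'x set \<Rightarrow> ('k, 'x \<Rightarrow> 'k) module"
  where "free_space K X =
    \<lparr>carrier = {f. (\<forall>x\<in>X. f x \<in> carrier K) \<and> (\<forall>x. x \<notin> X \<longrightarrow> f x = \<zero>\<^bsub>K\<^esub>) \<and>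
                   finite {x. f x \<noteq> \<zero>\<^bsub>K\<^esub>}},
     mult = undefined,
     one = undefined,
     zero = (\<lambda>x. \<zero>\<^bsub>K\<^esub>),
     add = (\<lambda>f g x. f x \<oplus>\<^bsub>K\<^esub> g x),
     smult = (\<lambda>a f x. a \<otimes>\<^bsub>K\<^esub> f x)\<rparr>"

definition free_gen :: "'k ring \<Rightarrow> 'x \<Rightarrow> 'x \<Rightarrow> 'k"
  where "free_gen K x = (\<lambda>y. if y = x then \<one>\<^bsub>K\<^esub> else \<zero>\<^bsub>K\<^esub>)"

definition bilinear_relations ::
  "'k ring \<Rightarrow> ('k, 'm) module \<Rightarrow> ('k, 'n) module \<Rightarrow> ('m \<times> 'n \<Rightarrow> 'k) set"
  where "bilinear_relations K M N =
    (let F = free_space K (carrier M \<times> carrier N); e = (\<lambda>m n. free_gen K (m, n)) in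
      {e (m \<oplus>\<^bsub>M\<^esub> m') n \<ominus>\<^bsub>F\<^esub> (e m n \<oplus>\<^bsub>F\<^esub> e m' n) | m m' n.
        m \<in> carrier M \<and> m' \<in> carrier M \<and> n \<in> carrier N} \<union>
      {e m (n \<oplus>\<^bsub>N\<^esub> n') \<ominus>\<^bsub>F\<^esub> (e m n \<oplus>\<^bsub>F\<^esub> e m n') | m n n'.
        m \<in> carrier M \<and> n \<in> carrier N \<and> n' \<in> carrier N} \<union>
      {e (a \<odot>\<^bsub>M\<^esub> m) n \<ominus>\<^bsub>F\<^esub> a \<odot>\<^bsub>F\<^esub> e m n | a m n.
        a \<in> carrier K \<and> m \<in> carrier M \<and> n \<in> carrier N} \<union>
      {e m (a \<odot>\<^bsub>N\<^esub> n) \<ominus>\<^bsub>F\<^esub> a \<odot>\<^bsub>F\<^esub> e m n | a m n.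
        a \<in> carrier K \<and> m \<in> carrier M \<and> n \<in> carrier N})"

definition tensor_kernel ::
  "'k ring \<Rightarrow> ('k, 'm) module \<Rightarrow> ('k, 'n) module \<Rightarrow> ('m \<times> 'n \<Rightarrow> 'k) set"
  where "tensor_kernel K M N =
    \<Inter>{S. submodule S K (free_space K (carrier M \<times> carrier N)) \<and>
       bilinear_relations K M N \<subseteq> S}"

definition quotient_space :: "('k, 'm) module \<Rightarrow> 'm set \<Rightarrow> ('k, 'm set) module"
  where "quotient_space M S =
    \<lparr>carrier = a_rcosets\<^bsub>M\<^esub> S,
     mult = undefined,
     one = undefined,
     zero = S,
     add = set_add M,
     smult = (\<lambda>a U. \<Union>u\<in>U. S +>\<^bsub>M\<^esub> (a \<odot>\<^bsub>M\<^esub> u))\<rparr>"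

definition tensor_space ::
  "'k ring \<Rightarrow> ('k, 'm) module \<Rightarrow> ('k, 'n) module \<Rightarrow> ('k, ('k, 'm, 'n) tensor) module"
  where "tensor_space K M N =
    quotient_space (free_space K (carrier M \<times> carrier N)) (tensor_kernel K M N)"

definition pure_tensor ::
  "'k ring \<Rightarrow> ('k, 'm) module \<Rightarrow> ('k, 'n) module \<Rightarrow> 'm \<Rightarrow> 'n \<Rightarrow> ('k, 'm, 'n) tensor"
  where "pure_tensor K M N m n =
    tensor_kernel K M N +>\<^bsub>free_space K (carrier M \<times> carrier N)\<^esub> free_gen K (m, n)"

text \<open>
  The linear map \<open>M \<otimes> N \<rightarrow> P\<close> with \<open>m \<otimes> n \<mapsto> b m n\<close>, for \<open>b : M \<times> N \<rightarrow> P\<close> bilinear: the linear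
  extension of \<open>b\<close> is evaluated on a representative, the choice of which is irrelevant.
\<close>

definition tensor_lift ::
  "'k ring \<Rightarrow> ('k, 'p) module \<Rightarrow> ('m \<Rightarrow> 'n \<Rightarrow> 'p) \<Rightarrow> ('k, 'm, 'n) tensor \<Rightarrow> 'p"
  where "tensor_lift K P b U =
    (let f = (SOME f. f \<in> U) in
      finsum P (\<lambda>(m, n). f (m, n) \<odot>\<^bsub>P\<^esub> b m n) {x. f x \<noteq> \<zero>\<^bsub>K\<^esub>})"

text \<open>
  The tensor product with the multiplication \<open>(a \<otimes> b) (c \<otimes> d) = a c \<otimes> b d\<close>, which is meaningful if
  both factors are algebras.
\<close>

definition tensor ::
  "'k ring \<Rightarrow> ('k, 'm) module \<Rightarrow> ('k, 'n) module \<Rightarrow> ('k, ('k, 'm, 'n) tensor) module"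
  where "tensor K M N = (tensor_space K M N)
    \<lparr>mult := (\<lambda>s t.
        tensor_lift K (tensor_space K M N) (\<lambda>a b.
          tensor_lift K (tensor_space K M N) (\<lambda>c d.
            pure_tensor K M N (a \<otimes>\<^bsub>M\<^esub> c) (b \<otimes>\<^bsub>N\<^esub> d)) t) s),
     one := pure_tensor K M N \<one>\<^bsub>M\<^esub> \<one>\<^bsub>N\<^esub>\<rparr>"

text \<open>\<open>tensor_map K P Q f g\<close> is \<open>f \<otimes> g : M \<otimes> N \<rightarrow> P \<otimes> Q\<close>.\<close>

definition tensor_map ::
  "'k ring \<Rightarrow> ('k, 'p) module \<Rightarrow> ('k, 'q) module \<Rightarrow> ('m \<Rightarrow> 'p) \<Rightarrow> ('n \<Rightarrow> 'q) \<Rightarrow>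
    ('k, 'm, 'n) tensor \<Rightarrow> ('k, 'p, 'q) tensor"
  where "tensor_map K P Q f g =
    tensor_lift K (tensor K P Q) (\<lambda>m n. pure_tensor K P Q (f m) (g n))"

text \<open>\<open>tensor_assoc K L M N\<close> is the canonical map \<open>(L \<otimes> M) \<otimes> N \<rightarrow> L \<otimes> (M \<otimes> N)\<close>.\<close>

definition tensor_assoc ::
  "'k ring \<Rightarrow> ('k, 'l) module \<Rightarrow> ('k, 'm) module \<Rightarrow> ('k, 'n) module \<Rightarrow>
    ('k, ('k, 'l, 'm) tensor, 'n) tensor \<Rightarrow> ('k, 'l, ('k, 'm, 'n) tensor) tensor"
  where "tensor_assoc K L M N =
    tensor_lift K (tensor K L (tensor K M N)) (\<lambda>t n.
      tensor_lift K (tensor K L (tensor K M N)) (\<lambda>l m.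
        pure_tensor K L (tensor K M N) l (pure_tensor K M N m n)) t)"

text \<open>The canonical maps \<open>K \<otimes> M \<rightarrow> M\<close> and \<open>M \<otimes> K \<rightarrow> M\<close>.\<close>

definition tensor_unit_left :: "'k ring \<Rightarrow> ('k, 'm) module \<Rightarrow> ('k, 'k, 'm) tensor \<Rightarrow> 'm"
  where "tensor_unit_left K M = tensor_lift K M (\<lambda>a x. a \<odot>\<^bsub>M\<^esub> x)"

definition tensor_unit_right :: "'k ring \<Rightarrow> ('k, 'm) module \<Rightarrow> ('k, 'm, 'k) tensor \<Rightarrow> 'm"
  where "tensor_unit_right K M = tensor_lift K M (\<lambda>x a. a \<odot>\<^bsub>M\<^esub> x)"


section \<open>Hopf group-coalgebras\<close>

text \<open>
  Families are indexed by the carrier of a group \<open>G\<close> (the group \<open>\<pi>\<close>) and their values outside the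
  carrier are irrelevant.  The spaces of one family share an element type, not a carrier.
\<close>

record ('p, 'k, 'c) pi_coalgebra =
  component :: "'p \<Rightarrow> ('k, 'c) module"
  comult :: "'p \<Rightarrow> 'p \<Rightarrow> 'c \<Rightarrow> ('k, 'c, 'c) tensor"
  counit :: "'c \<Rightarrow> 'k"

locale pi_coalgebra = K: field K + G: group G for K :: "'k ring" and G :: "'p monoid" +
  fixes C :: "('p, 'k, 'c, 'z) pi_coalgebra_scheme"
  assumes component_space: "\<alpha> \<in> carrier G \<Longrightarrow> module K (component C \<alpha>)"
    and comult_linear: "\<lbrakk>\<alpha> \<in> carrier G; \<beta> \<in> carrier G\<rbrakk> \<Longrightarrow>
      comult C \<alpha> \<beta> \<in> linear_maps K (component C (\<alpha> \<otimes>\<^bsub>G\<^esub> \<beta>))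
        (tensor K (component C \<alpha>) (component C \<beta>))"
    and counit_linear: "counit C \<in> linear_maps K (component C \<one>\<^bsub>G\<^esub>) (ground K)"
    and coassoc: "\<lbrakk>\<alpha> \<in> carrier G; \<beta> \<in> carrier G; \<gamma> \<in> carrier G;
        x \<in> carrier (component C (\<alpha> \<otimes>\<^bsub>G\<^esub> \<beta> \<otimes>\<^bsub>G\<^esub> \<gamma>))\<rbrakk> \<Longrightarrow>
      tensor_assoc K (component C \<alpha>) (component C \<beta>) (component C \<gamma>)
        (tensor_map K (tensor K (component C \<alpha>) (component C \<beta>)) (component C \<gamma>)
          (comult C \<alpha> \<beta>) (\<lambda>c. c) (comult C (\<alpha> \<otimes>\<^bsub>G\<^esub> \<beta>) \<gamma> x)) =
      tensor_map K (component C \<alpha>) (tensor K (component C \<beta>) (component C \<gamma>))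
        (\<lambda>c. c) (comult C \<beta> \<gamma>) (comult C \<alpha> (\<beta> \<otimes>\<^bsub>G\<^esub> \<gamma>) x)"
    and counit_left: "\<lbrakk>\<alpha> \<in> carrier G; x \<in> carrier (component C \<alpha>)\<rbrakk> \<Longrightarrow>
      tensor_unit_left K (component C \<alpha>)
        (tensor_map K (ground K) (component C \<alpha>) (counit C) (\<lambda>c. c) (comult C \<one>\<^bsub>G\<^esub> \<alpha> x)) = x"
    and counit_right: "\<lbrakk>\<alpha> \<in> carrier G; x \<in> carrier (component C \<alpha>)\<rbrakk> \<Longrightarrow>
      tensor_unit_right K (component C \<alpha>)
        (tensor_map K (component C \<alpha>) (ground K) (\<lambda>c. c) (counit C) (comult C \<alpha> \<one>\<^bsub>G\<^esub> x)) = x"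

record ('p, 'k, 'h) hopf_pi_coalgebra = "('p, 'k, 'h) pi_coalgebra" +
  antipode :: "'p \<Rightarrow> 'h \<Rightarrow> 'h"

text \<open>The algebra structure of \<open>H\<^sub>\<alpha>\<close> is given by \<^const>\<open>mult\<close> and \<^const>\<open>one\<close> of its component.\<close>

locale hopf_pi_coalgebra = pi_coalgebra K G H
  for K :: "'k ring" and G :: "'p monoid" and H :: "('p, 'k, 'h) hopf_pi_coalgebra" +
  assumes component_algebra: "\<alpha> \<in> carrier G \<Longrightarrow> assoc_algebra K (component H \<alpha>)"
    and comult_ring_hom: "\<lbrakk>\<alpha> \<in> carrier G; \<beta> \<in> carrier G\<rbrakk> \<Longrightarrow>
      comult H \<alpha> \<beta> \<in> ring_hom (component H (\<alpha> \<otimes>\<^bsub>G\<^esub> \<beta>))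
        (tensor K (component H \<alpha>) (component H \<beta>))"
    and counit_ring_hom: "counit H \<in> ring_hom (component H \<one>\<^bsub>G\<^esub>) (ground K)"
    and antipode_linear: "\<alpha> \<in> carrier G \<Longrightarrow>
      antipode H \<alpha> \<in> linear_maps K (component H \<alpha>) (component H (inv\<^bsub>G\<^esub> \<alpha>))"
    and antipode_left: "\<lbrakk>\<alpha> \<in> carrier G; x \<in> carrier (component H \<one>\<^bsub>G\<^esub>)\<rbrakk> \<Longrightarrow>
      tensor_lift K (component H \<alpha>) (mult (component H \<alpha>))
        (tensor_map K (component H \<alpha>) (component H \<alpha>)
          (antipode H (inv\<^bsub>G\<^esub> \<alpha>)) (\<lambda>h. h) (comult H (inv\<^bsub>G\<^esub> \<alpha>) \<alpha> x)) =
      counit H x \<odot>\<^bsub>component H \<alpha>\<^esub> \<one>\<^bsub>component H \<alpha>\<^esub>"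
    and antipode_right: "\<lbrakk>\<alpha> \<in> carrier G; x \<in> carrier (component H \<one>\<^bsub>G\<^esub>)\<rbrakk> \<Longrightarrow>
      tensor_lift K (component H \<alpha>) (mult (component H \<alpha>))
        (tensor_map K (component H \<alpha>) (component H \<alpha>)
          (\<lambda>h. h) (antipode H (inv\<^bsub>G\<^esub> \<alpha>)) (comult H \<alpha> (inv\<^bsub>G\<^esub> \<alpha>) x)) =
      counit H x \<odot>\<^bsub>component H \<alpha>\<^esub> \<one>\<^bsub>component H \<alpha>\<^esub>"

locale left_pi_coisotropic_subgroup = H: hopf_pi_coalgebra K G H + C: pi_coalgebra K G C
  for K :: "'k ring" and G :: "'p monoid" and H :: "('p, 'k, 'h) hopf_pi_coalgebra"
    and C :: "('p, 'k, 'c) pi_coalgebra" +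
  fixes act :: "'p \<Rightarrow> 'h \<Rightarrow> 'c \<Rightarrow> 'c" and \<sigma> :: "'p \<Rightarrow> 'h \<Rightarrow> 'c"
  assumes act_module: "\<alpha> \<in> carrier G \<Longrightarrow>
      left_algebra_module K (component H \<alpha>) (component C \<alpha>) (act \<alpha>)"
    and proj_linear: "\<alpha> \<in> carrier G \<Longrightarrow>
      \<sigma> \<alpha> \<in> linear_maps K (component H \<alpha>) (component C \<alpha>)"
    and proj_surj: "\<alpha> \<in> carrier G \<Longrightarrow>
      \<sigma> \<alpha> ` carrier (component H \<alpha>) = carrier (component C \<alpha>)"
    and proj_act: "\<lbrakk>\<alpha> \<in> carrier G; h \<in> carrier (component H \<alpha>); x \<in> carrier (component H \<alpha>)\<rbrakk> \<Longrightarrow>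
      \<sigma> \<alpha> (h \<otimes>\<^bsub>component H \<alpha>\<^esub> x) = act \<alpha> h (\<sigma> \<alpha> x)"
    and proj_comult: "\<lbrakk>\<alpha> \<in> carrier G; \<beta> \<in> carrier G;
        x \<in> carrier (component H (\<alpha> \<otimes>\<^bsub>G\<^esub> \<beta>))\<rbrakk> \<Longrightarrow>
      comult C \<alpha> \<beta> (\<sigma> (\<alpha> \<otimes>\<^bsub>G\<^esub> \<beta>) x) =
      tensor_map K (component C \<alpha>) (component C \<beta>) (\<sigma> \<alpha>) (\<sigma> \<beta>) (comult H \<alpha> \<beta> x)"
    and proj_counit: "x \<in> carrier (component H \<one>\<^bsub>G\<^esub>) \<Longrightarrow>
      counit C (\<sigma> \<one>\<^bsub>G\<^esub> x) = counit H x"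


section \<open>Comodules\<close>

record ('p, 'k, 'm, 'c) pi_comodule =
  fibre :: "'p \<Rightarrow> ('k, 'm) module"
  coaction :: "'p \<Rightarrow> 'p \<Rightarrow> 'm \<Rightarrow> ('k, 'm, 'c) tensor"

locale right_pi_comodule = pi_coalgebra K G C
  for K :: "'k ring" and G :: "'p monoid" and C :: "('p, 'k, 'c, 'z) pi_coalgebra_scheme" +
  fixes M :: "('p, 'k, 'm, 'c) pi_comodule"
  assumes fibre_space: "\<alpha> \<in> carrier G \<Longrightarrow> module K (fibre M \<alpha>)"
    and coaction_linear: "\<lbrakk>\<alpha> \<in> carrier G; \<beta> \<in> carrier G\<rbrakk> \<Longrightarrow>
      coaction M \<alpha> \<beta> \<in> linear_maps K (fibre M (\<alpha> \<otimes>\<^bsub>G\<^esub> \<beta>))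
        (tensor K (fibre M \<alpha>) (component C \<beta>))"
    and coaction_coassoc: "\<lbrakk>\<alpha> \<in> carrier G; \<beta> \<in> carrier G; \<gamma> \<in> carrier G;
        x \<in> carrier (fibre M (\<alpha> \<otimes>\<^bsub>G\<^esub> \<beta> \<otimes>\<^bsub>G\<^esub> \<gamma>))\<rbrakk> \<Longrightarrow>
      tensor_assoc K (fibre M \<alpha>) (component C \<beta>) (component C \<gamma>)
        (tensor_map K (tensor K (fibre M \<alpha>) (component C \<beta>)) (component C \<gamma>)
          (coaction M \<alpha> \<beta>) (\<lambda>c. c) (coaction M (\<alpha> \<otimes>\<^bsub>G\<^esub> \<beta>) \<gamma> x)) =
      tensor_map K (fibre M \<alpha>) (tensor K (component C \<beta>) (component C \<gamma>))
        (\<lambda>m. m) (comult C \<beta> \<gamma>) (coaction M \<alpha> (\<beta> \<otimes>\<^bsub>G\<^esub> \<gamma>) x)"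
    and coaction_counit: "\<lbrakk>\<alpha> \<in> carrier G; x \<in> carrier (fibre M \<alpha>)\<rbrakk> \<Longrightarrow>
      tensor_unit_right K (fibre M \<alpha>)
        (tensor_map K (fibre M \<alpha>) (ground K) (\<lambda>m. m) (counit C) (coaction M \<alpha> \<one>\<^bsub>G\<^esub> x)) = x"

definition comodule_equivalent ::
  "'k ring \<Rightarrow> 'p monoid \<Rightarrow> ('p, 'k, 'c, 'z) pi_coalgebra_scheme \<Rightarrow>
    ('p, 'k, 'm, 'c) pi_comodule \<Rightarrow> ('p, 'k, 'n, 'c) pi_comodule \<Rightarrow> bool"
  where "comodule_equivalent K G C M N \<longleftrightarrow>
    right_pi_comodule K G C M \<and> right_pi_comodule K G C N \<and>
    (\<exists>F. (\<forall>\<alpha>\<in>carrier G. F \<alpha> \<in> linear_maps K (fibre M \<alpha>) (fibre N \<alpha>) \<and>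
            bij_betw (F \<alpha>) (carrier (fibre M \<alpha>)) (carrier (fibre N \<alpha>))) \<and>
         (\<forall>\<alpha>\<in>carrier G. \<forall>\<beta>\<in>carrier G. \<forall>x\<in>carrier (fibre M (\<alpha> \<otimes>\<^bsub>G\<^esub> \<beta>)).
            coaction N \<alpha> \<beta> (F (\<alpha> \<otimes>\<^bsub>G\<^esub> \<beta>) x) =
            tensor_map K (fibre N \<alpha>) (component C \<beta>) (F \<alpha>) (\<lambda>c. c) (coaction M \<alpha> \<beta> x)))"

definition comodule_sum ::
  "'k ring \<Rightarrow> ('p, 'k, 'c, 'z) pi_coalgebra_scheme \<Rightarrow>
    ('p, 'k, 'm, 'c) pi_comodule \<Rightarrow> ('p, 'k, 'n, 'c) pi_comodule \<Rightarrow>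
    ('p, 'k, 'm \<times> 'n, 'c) pi_comodule"
  where "comodule_sum K C M N =
    \<lparr>fibre = (\<lambda>\<alpha>. direct_sum (fibre M \<alpha>) (fibre N \<alpha>)),
     coaction = (\<lambda>\<alpha> \<beta> (x, y).
       let S = direct_sum (fibre M \<alpha>) (fibre N \<alpha>) in
       tensor_map K S (component C \<beta>)
         (\<lambda>m. (m, \<zero>\<^bsub>fibre N \<alpha>\<^esub>)) (\<lambda>c. c) (coaction M \<alpha> \<beta> x)
       \<oplus>\<^bsub>tensor K S (component C \<beta>)\<^esub>
       tensor_map K S (component C \<beta>)
         (\<lambda>n. (\<zero>\<^bsub>fibre M \<alpha>\<^esub>, n)) (\<lambda>c. c) (coaction N \<alpha> \<beta> y))\<rparr>"


section \<open>Induced representations\<close>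

definition ind_L ::
  "'k ring \<Rightarrow> 'p monoid \<Rightarrow> ('p, 'k, 'h) hopf_pi_coalgebra \<Rightarrow> ('p, 'k, 'c) pi_coalgebra \<Rightarrow>
    ('p \<Rightarrow> 'h \<Rightarrow> 'c) \<Rightarrow> 'p \<Rightarrow> 'h \<Rightarrow> ('k, 'c, 'h) tensor"
  where "ind_L K G H C \<sigma> \<alpha> x =
    tensor_map K (component C \<one>\<^bsub>G\<^esub>) (component H \<alpha>) (\<sigma> \<one>\<^bsub>G\<^esub>) (\<lambda>h. h) (comult H \<one>\<^bsub>G\<^esub> \<alpha> x)"

text \<open>
  The two sides of the defining equation live in \<open>V\<^sub>1 \<otimes> (C\<^sub>1 \<otimes> H\<^sub>\<alpha>)\<close> and \<open>(V\<^sub>1 \<otimes> C\<^sub>1) \<otimes> H\<^sub>\<alpha>\<close>, whence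
  the \<^const>\<open>tensor_assoc\<close>.
\<close>

definition ind_fibre ::
  "'k ring \<Rightarrow> 'p monoid \<Rightarrow> ('p, 'k, 'h) hopf_pi_coalgebra \<Rightarrow> ('p, 'k, 'c) pi_coalgebra \<Rightarrow>
    ('p \<Rightarrow> 'h \<Rightarrow> 'c) \<Rightarrow> ('p, 'k, 'v, 'c) pi_comodule \<Rightarrow> 'p \<Rightarrow>
    ('k, ('k, 'v, 'h) tensor) module"
  where "ind_fibre K G H C \<sigma> V \<alpha> =
    (let V1 = fibre V \<one>\<^bsub>G\<^esub>; C1 = component C \<one>\<^bsub>G\<^esub>; H\<alpha> = component H \<alpha> in
      (tensor K V1 H\<alpha>)\<lparr>carrier :=
        {x \<in> carrier (tensor K V1 H\<alpha>).
          tensor_map K V1 (tensor K C1 H\<alpha>) (\<lambda>v. v) (ind_L K G H C \<sigma> \<alpha>) x =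
          tensor_assoc K V1 C1 H\<alpha>
            (tensor_map K (tensor K V1 C1) H\<alpha> (coaction V \<one>\<^bsub>G\<^esub> \<one>\<^bsub>G\<^esub>) (\<lambda>h. h) x)}\<rparr>)"

text \<open>
  The coaction is the restriction of \<open>I \<otimes> \<Delta>\<^sub>\<alpha>\<^sub>\<beta>\<close>, corestricted to \<open>Ind\<^sub>\<alpha> \<otimes> H\<^sub>\<beta>\<close>.  The latter is
  not literally a subset of \<open>V\<^sub>1 \<otimes> (H\<^sub>\<alpha> \<otimes> H\<^sub>\<beta>)\<close> but embeds into it by the composition of
  \<^const>\<open>tensor_assoc\<close> and \<open>\<iota> \<otimes> I\<close>, where \<open>\<iota>\<close> is the inclusion of \<open>Ind\<^sub>\<alpha>\<close> into \<open>V\<^sub>1 \<otimes> H\<^sub>\<alpha>\<close>.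
\<close>

definition Ind ::
  "'k ring \<Rightarrow> 'p monoid \<Rightarrow> ('p, 'k, 'h) hopf_pi_coalgebra \<Rightarrow> ('p, 'k, 'c) pi_coalgebra \<Rightarrow>
    ('p \<Rightarrow> 'h \<Rightarrow> 'c) \<Rightarrow> ('p, 'k, 'v, 'c) pi_comodule \<Rightarrow>
    ('p, 'k, ('k, 'v, 'h) tensor, 'h) pi_comodule"
  where "Ind K G H C \<sigma> V =
    \<lparr>fibre = ind_fibre K G H C \<sigma> V,
     coaction = (\<lambda>\<alpha> \<beta> x.
       let V1 = fibre V \<one>\<^bsub>G\<^esub>; H\<alpha> = component H \<alpha>; H\<beta> = component H \<beta> in
       THE y. y \<in> carrier (tensor K (ind_fibre K G H C \<sigma> V \<alpha>) H\<beta>) \<and>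
         tensor_assoc K V1 H\<alpha> H\<beta> (tensor_map K (tensor K V1 H\<alpha>) H\<beta> (\<lambda>z. z) (\<lambda>h. h) y) =
         tensor_map K V1 (tensor K H\<alpha> H\<beta>) (\<lambda>v. v) (comult H \<alpha> \<beta>) x)\<rparr>"

end

theory Submission
  imports Defs
begin

text \<open>
  \<open>Ind(\<rho>)\<close> is a subcomodule of the cofree comodule \<open>{V\<^sub>1 \<otimes> H\<^sub>\<alpha>}\<close>: its fibre at \<open>\<alpha>\<close> is the kernel of
  the difference of the two maps \<open>I \<otimes> L\<^sub>1\<^sub>,\<^sub>\<alpha>\<close> and \<open>\<rho>\<^sub>1\<^sub>,\<^sub>1 \<otimes> I\<close>.  Over a field every linear map \<open>f\<close> has a
  linear \<open>p\<close> with \<open>f p f = f\<close>, so tensoring with \<open>H\<^sub>\<beta>\<close> preserves kernels and inclusions; together with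
  coassociativity this shows that \<open>I \<otimes> \<Delta>\<^sub>\<alpha>\<^sub>,\<^sub>\<beta>\<close> corestricts to \<open>Ind(\<rho>)\<^sub>\<alpha> \<otimes> H\<^sub>\<beta>\<close>, in a unique way.
  A morphism \<open>\<phi>\<close> of comodules over \<open>C\<close> induces the morphism \<open>\<phi>\<^sub>1 \<otimes> I\<close> of induced representations.
  This functor is additive, hence it carries the projections and inclusions of \<open>\<rho> \<oplus> \<psi>\<close> to those of a
  direct sum.
\<close>

section \<open>Quotients and free spaces\<close>

text \<open>Equivalence demands that both sides be comodules, so coassociativity and counit of
  \<open>Ind\<close> have to be proved along with the bijection. The obstacle is the form of the
  coaction of \<open>Ind\<close>: it is a definite description whose value lives in a tensor product
  over the smaller fibre, while only its image in V_1 \<otimes> (H_\<alpha> \<otimes> H_\<beta>) is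
  prescribed. Facts about it are therefore equations tested after an injective map into a larger
  space. Since tensor products are nested cosets, they are not literally associative; every bracket
  is moved by an explicit map, which is why naturality of the associator and the pentagon identity
  are needed. The relation f p f = f is used twice. For f an inclusion, p is a retraction, and
  tensoring it gives injectivity, hence uniqueness of the corestriction. For f the difference of the
  two defining maps, I - p f maps into the kernel, and tensoring it gives existence.\<close>

lemma module_surjective_image:
  fixes K :: "'k ring" and M :: "('k, 'm) module" and N :: "('k, 'n) module"
  assumes "module K M"
    and image: "carrier N = q ` carrier M"
    and add: "\<And>x y. \<lbrakk>x \<in> carrier M; y \<in> carrier M\<rbrakk> \<Longrightarrow> q x \<oplus>\<^bsub>N\<^esub> q y = q (x \<oplus>\<^bsub>M\<^esub> y)"
    and zero: "\<zero>\<^bsub>N\<^esub> = q \<zero>\<^bsub>M\<^esub>"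
    and smult: "\<And>a x. \<lbrakk>a \<in> carrier K; x \<in> carrier M\<rbrakk> \<Longrightarrow> a \<odot>\<^bsub>N\<^esub> q x = q (a \<odot>\<^bsub>M\<^esub> x)"
  shows "module K N"
proof -
  interpret M: module K M by fact
  \<comment> \<open>Each axiom is an equation or an existence claim, so it passes along the
    surjection \<open>q\<close>; \<open>N\<close> is so far merely a record with operations.\<close>
  show ?thesis
  proof (rule moduleI)
    show "cring K" by (rule M.R.cring_axioms)
    show "abelian_group N"
    proof (rule abelian_groupI)
      fix x assume "x \<in> carrier N"
      then obtain x' where x': "x' \<in> carrier M" "x = q x'" by (auto simp: image)
      then have "q (\<ominus>\<^bsub>M\<^esub> x') \<in> carrier N" "q (\<ominus>\<^bsub>M\<^esub> x') \<oplus>\<^bsub>N\<^esub> x = \<zero>\<^bsub>N\<^esub>"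
        by (auto simp: image add zero M.M.l_neg)
      then show "\<exists>y\<in>carrier N. y \<oplus>\<^bsub>N\<^esub> x = \<zero>\<^bsub>N\<^esub>" by blast
    qed (auto simp: image add zero M.M.a_ac)
  qed (auto simp: image add smult M.smult_l_distr M.smult_r_distr M.smult_assoc1)
qed

text \<open>The locale \<open>module\<close> reads only the carrier, addition, zero and scalar
  action. This carries the structure from \<open>tensor_space\<close> to \<open>tensor\<close>,
  which differ in \<open>mult\<close> and \<open>one\<close>.\<close>

lemma module_cong:
  fixes K :: "'k ring" and M N :: "('k, 'm) module"
  assumes "module K M"
    and "carrier N = carrier M" "add N = add M" "zero N = zero M" "smult N = smult M"
  shows "module K N"
  by (rule module_surjective_image[where q = "\<lambda>x. x"]) (use assms in simp_all)

lemma module_restrict: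
  fixes K :: "'k ring" and M :: "('k, 'm) module"
  assumes "module K M" "submodule S K M"
  shows "module K (M\<lparr>carrier := S\<rparr>)"
  by (rule submodule.submodule_is_module[OF assms(2) assms(1)])

lemma submodule_zero_closed: "submodule S K M \<Longrightarrow> \<zero>\<^bsub>M\<^esub> \<in> S"
  using subgroup.one_closed[OF submodule.axioms(1)] by fastforce

text \<open>The additive facts come from the theory of cosets of an abelian subgroup. The scalar
  action is the delicate part: it is defined as a union over all representatives, so its value is a
  coset only once that union is known to be constant.\<close>

lemma quotient_space_coset:
  fixes K :: "'k ring" and M :: "('k, 'm) module"
  assumes "module K M" "submodule S K M"
  shows carrier_quotient_space: "carrier (quotient_space M S) = (\<lambda>x. S +>\<^bsub>M\<^esub> x) ` carrier M"
    and quotient_space_add: "\<lbrakk>x \<in> carrier M; y \<in> carrier M\<rbrakk> \<Longrightarrow>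
      (S +>\<^bsub>M\<^esub> x) \<oplus>\<^bsub>quotient_space M S\<^esub> (S +>\<^bsub>M\<^esub> y) = S +>\<^bsub>M\<^esub> (x \<oplus>\<^bsub>M\<^esub> y)"
    and quotient_space_zero: "\<zero>\<^bsub>quotient_space M S\<^esub> = S +>\<^bsub>M\<^esub> \<zero>\<^bsub>M\<^esub>"
    and quotient_space_smult: "\<lbrakk>a \<in> carrier K; x \<in> carrier M\<rbrakk> \<Longrightarrow>
      a \<odot>\<^bsub>quotient_space M S\<^esub> (S +>\<^bsub>M\<^esub> x) = S +>\<^bsub>M\<^esub> (a \<odot>\<^bsub>M\<^esub> x)"
    and coset_eq_iff: "\<lbrakk>x \<in> carrier M; y \<in> carrier M\<rbrakk> \<Longrightarrow>
      S +>\<^bsub>M\<^esub> x = S +>\<^bsub>M\<^esub> y \<longleftrightarrow> x \<ominus>\<^bsub>M\<^esub> y \<in> S"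
    and coset_self: "x \<in> carrier M \<Longrightarrow> x \<in> S +>\<^bsub>M\<^esub> x"
    and in_cosetD: "\<lbrakk>x \<in> carrier M; y \<in> S +>\<^bsub>M\<^esub> x\<rbrakk> \<Longrightarrow> y \<in> carrier M \<and> S +>\<^bsub>M\<^esub> y = S +>\<^bsub>M\<^esub> x"
proof -
  interpret M: module K M by fact
  interpret S: abelian_subgroup S M
    by (intro abelian_subgroupI3 additive_subgroupI submodule.axioms(1)[OF assms(2)] M.abelian_group_axioms)
  show "carrier (quotient_space M S) = (\<lambda>x. S +>\<^bsub>M\<^esub> x) ` carrier M"
    by (auto simp: quotient_space_def A_RCOSETS_def')
  show "(S +>\<^bsub>M\<^esub> x) \<oplus>\<^bsub>quotient_space M S\<^esub> (S +>\<^bsub>M\<^esub> y) = S +>\<^bsub>M\<^esub> (x \<oplus>\<^bsub>M\<^esub> y)"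
    if "x \<in> carrier M" "y \<in> carrier M" for x y
    using that by (simp add: quotient_space_def S.a_rcos_sum)
  show "\<zero>\<^bsub>quotient_space M S\<^esub> = S +>\<^bsub>M\<^esub> \<zero>\<^bsub>M\<^esub>"
    by (simp add: quotient_space_def S.a_subset)
  show iff: "S +>\<^bsub>M\<^esub> x = S +>\<^bsub>M\<^esub> y \<longleftrightarrow> x \<ominus>\<^bsub>M\<^esub> y \<in> S"
    if "x \<in> carrier M" "y \<in> carrier M" for x y
    using that S.a_rcos_module[of y x] S.a_repr_independence'[of x y] S.a_rcos_self[of x]
    by (auto simp: a_minus_def)
  show *: "y \<in> carrier M \<and> S +>\<^bsub>M\<^esub> y = S +>\<^bsub>M\<^esub> x"
    if "x \<in> carrier M" "y \<in> S +>\<^bsub>M\<^esub> x" for x y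
    using that S.a_elemrcos_carrier[of x y] S.a_repr_independence'[of y x] by simp
  show self: "x \<in> S +>\<^bsub>M\<^esub> x" if "x \<in> carrier M" for x
    using that by (rule S.a_rcos_self)
  show "a \<odot>\<^bsub>quotient_space M S\<^esub> (S +>\<^bsub>M\<^esub> x) = S +>\<^bsub>M\<^esub> (a \<odot>\<^bsub>M\<^esub> x)"
    if "a \<in> carrier K" "x \<in> carrier M" for a x
  proof -
    \<comment> \<open>Two representatives differ by an element of \<open>S\<close>, and
      \<open>S\<close> is closed under scalars, so all sets in the union are the same coset. The
      index set is nonempty, hence the union collapses.\<close>
    have "S +>\<^bsub>M\<^esub> (a \<odot>\<^bsub>M\<^esub> u) = S +>\<^bsub>M\<^esub> (a \<odot>\<^bsub>M\<^esub> x)" if u: "u \<in> S +>\<^bsub>M\<^esub> x" for u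
    proof -
      have uc: "u \<in> carrier M" "u \<ominus>\<^bsub>M\<^esub> x \<in> S"
        using *[OF \<open>x \<in> carrier M\<close> u] iff \<open>x \<in> carrier M\<close> by auto
      have "a \<odot>\<^bsub>M\<^esub> (u \<ominus>\<^bsub>M\<^esub> x) \<in> S"
        using uc \<open>a \<in> carrier K\<close> M.submoduleE(4)[OF assms(2)] by blast
      then have "a \<odot>\<^bsub>M\<^esub> u \<ominus>\<^bsub>M\<^esub> a \<odot>\<^bsub>M\<^esub> x \<in> S"
        using uc \<open>x \<in> carrier M\<close> \<open>a \<in> carrier K\<close>
        by (simp add: a_minus_def M.smult_r_distr M.smult_r_minus)
      then show ?thesis using uc \<open>x \<in> carrier M\<close> \<open>a \<in> carrier K\<close> by (simp add: iff)
    qed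
    moreover have "S +>\<^bsub>M\<^esub> x \<noteq> {}" using self[OF \<open>x \<in> carrier M\<close>] by blast
    ultimately have "(\<Union>u\<in>S +>\<^bsub>M\<^esub> x. S +>\<^bsub>M\<^esub> (a \<odot>\<^bsub>M\<^esub> u)) = S +>\<^bsub>M\<^esub> (a \<odot>\<^bsub>M\<^esub> x)"
      by (intro SUP_eq_const)
    then show ?thesis by (simp add: quotient_space_def)
  qed
qed

lemma module_quotient_space:
  fixes K :: "'k ring" and M :: "('k, 'm) module"
  assumes "module K M" "submodule S K M"
  shows "module K (quotient_space M S)"
  using assms(1)
  by (rule module_surjective_image[where q = "\<lambda>x. S +>\<^bsub>M\<^esub> x"])
    (simp_all add: carrier_quotient_space[OF assms] quotient_space_add[OF assms]
      quotient_space_zero[OF assms] quotient_space_smult[OF assms])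

lemma module_free_space:
  fixes K :: "'k ring"
  assumes "cring K"
  shows "module K (free_space K X)"
proof -
  interpret K: cring K by fact
  have carr: "f x \<in> carrier K" if "f \<in> carrier (free_space K X)" for f x
    using that by (cases "x \<in> X") (auto simp: free_space_def)
  have fin: "finite {x. f x \<oplus>\<^bsub>K\<^esub> g x \<noteq> \<zero>\<^bsub>K\<^esub>}"
    if "f \<in> carrier (free_space K X)" "g \<in> carrier (free_space K X)" for f g
    by (rule finite_subset[of _ "{x. f x \<noteq> \<zero>\<^bsub>K\<^esub>} \<union> {x. g x \<noteq> \<zero>\<^bsub>K\<^esub>}"])
      (use that in \<open>auto simp: free_space_def\<close>)
  have fin': "finite {x. a \<otimes>\<^bsub>K\<^esub> f x \<noteq> \<zero>\<^bsub>K\<^esub>}"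
    if "f \<in> carrier (free_space K X)" "a \<in> carrier K" for f a
    by (rule finite_subset[of _ "{x. f x \<noteq> \<zero>\<^bsub>K\<^esub>}"])
      (use that in \<open>auto simp: free_space_def\<close>)
  show ?thesis
  proof (rule moduleI)
    show "cring K" by fact
    show "abelian_group (free_space K X)"
    proof (rule abelian_groupI)
      fix f assume f: "f \<in> carrier (free_space K X)"
      have "(\<lambda>x. \<ominus>\<^bsub>K\<^esub> f x) \<in> carrier (free_space K X)"
        using carr[OF f] f
        by (auto simp: free_space_def intro: finite_subset[of _ "{x. f x \<noteq> \<zero>\<^bsub>K\<^esub>}"])
      moreover have "(\<lambda>x. \<ominus>\<^bsub>K\<^esub> f x) \<oplus>\<^bsub>free_space K X\<^esub> f = \<zero>\<^bsub>free_space K X\<^esub>"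
        using carr[OF f] by (simp add: free_space_def K.l_neg)
      ultimately show "\<exists>y\<in>carrier (free_space K X). y \<oplus>\<^bsub>free_space K X\<^esub> f = \<zero>\<^bsub>free_space K X\<^esub>"
        by blast
    next
      fix f g assume "f \<in> carrier (free_space K X)" "g \<in> carrier (free_space K X)"
      then show "f \<oplus>\<^bsub>free_space K X\<^esub> g \<in> carrier (free_space K X)"
        using fin[of f g] by (auto simp: free_space_def)
    next
      fix f g h assume "f \<in> carrier (free_space K X)" "g \<in> carrier (free_space K X)"
        "h \<in> carrier (free_space K X)"
      then show "f \<oplus>\<^bsub>free_space K X\<^esub> g \<oplus>\<^bsub>free_space K X\<^esub> h =
          f \<oplus>\<^bsub>free_space K X\<^esub> (g \<oplus>\<^bsub>free_space K X\<^esub> h)"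
        by (simp add: free_space_def K.a_assoc carr[of f] carr[of g] carr[of h])
    next
      fix f g assume "f \<in> carrier (free_space K X)" "g \<in> carrier (free_space K X)"
      then show "f \<oplus>\<^bsub>free_space K X\<^esub> g = g \<oplus>\<^bsub>free_space K X\<^esub> f"
        by (simp add: free_space_def K.a_comm carr[of f] carr[of g])
    next
      fix f assume "f \<in> carrier (free_space K X)"
      then show "\<zero>\<^bsub>free_space K X\<^esub> \<oplus>\<^bsub>free_space K X\<^esub> f = f"
        by (simp add: free_space_def carr[of f])
    qed (simp add: free_space_def)
  next
    fix a f assume "a \<in> carrier K" "f \<in> carrier (free_space K X)"
    then show "a \<odot>\<^bsub>free_space K X\<^esub> f \<in> carrier (free_space K X)"
      using fin'[of f a] by (auto simp: free_space_def)
  next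
    fix a b f assume "a \<in> carrier K" "b \<in> carrier K" "f \<in> carrier (free_space K X)"
    then show "(a \<oplus>\<^bsub>K\<^esub> b) \<odot>\<^bsub>free_space K X\<^esub> f =
        a \<odot>\<^bsub>free_space K X\<^esub> f \<oplus>\<^bsub>free_space K X\<^esub> b \<odot>\<^bsub>free_space K X\<^esub> f"
      and "(a \<otimes>\<^bsub>K\<^esub> b) \<odot>\<^bsub>free_space K X\<^esub> f =
        a \<odot>\<^bsub>free_space K X\<^esub> (b \<odot>\<^bsub>free_space K X\<^esub> f)"
      by (simp_all add: free_space_def K.l_distr K.m_assoc carr[of f])
  next
    fix a f g assume "a \<in> carrier K" "f \<in> carrier (free_space K X)" "g \<in> carrier (free_space K X)"
    then show "a \<odot>\<^bsub>free_space K X\<^esub> (f \<oplus>\<^bsub>free_space K X\<^esub> g) =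
        a \<odot>\<^bsub>free_space K X\<^esub> f \<oplus>\<^bsub>free_space K X\<^esub> a \<odot>\<^bsub>free_space K X\<^esub> g"
      by (simp add: free_space_def K.r_distr carr[of f] carr[of g])
  next
    fix f assume "f \<in> carrier (free_space K X)"
    then show "\<one>\<^bsub>K\<^esub> \<odot>\<^bsub>free_space K X\<^esub> f = f"
      by (simp add: free_space_def carr[of f])
  qed
qed

lemma free_gen_closed:
  "\<lbrakk>cring K; x \<in> X\<rbrakk> \<Longrightarrow> free_gen K x \<in> carrier (free_space K X)"
  by (auto simp: free_space_def free_gen_def cring_def
      intro: ring.ring_simprules finite_subset[of _ "{x}"])

text \<open>A finitely supported function arises from zero by adding one multiple of a generator at
  a time. This is the source of \<open>tensor_induct\<close>.\<close>

lemma free_space_induct [consumes 2, case_names zero add]: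
  fixes K :: "'k ring"
  assumes "cring K" and f: "f \<in> carrier (free_space K X)"
    and zero: "P \<zero>\<^bsub>free_space K X\<^esub>"
    and add: "\<And>f a x. \<lbrakk>f \<in> carrier (free_space K X); a \<in> carrier K; x \<in> X; P f\<rbrakk> \<Longrightarrow>
      P (f \<oplus>\<^bsub>free_space K X\<^esub> a \<odot>\<^bsub>free_space K X\<^esub> free_gen K x)"
  shows "P f"
proof -
  interpret K: cring K by fact
  \<comment> \<open>Quantifying over a finite \<open>A\<close> that contains the support, instead of
    over the support itself, makes this an ordinary induction on finite sets.\<close>
  have "\<forall>f\<in>carrier (free_space K X). {x. f x \<noteq> \<zero>\<^bsub>K\<^esub>} \<subseteq> A \<longrightarrow> P f" if "finite A" "A \<subseteq> X" for A
    using that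
  proof (induction A rule: finite_induct)
    case empty
    have "f = \<zero>\<^bsub>free_space K X\<^esub>" if "{x. f x \<noteq> \<zero>\<^bsub>K\<^esub>} \<subseteq> {}" for f
      using that by (auto simp: free_space_def)
    then show ?case using zero by blast
  next
    case (insert x A)
    show ?case
    proof (intro ballI impI)
      fix f assume f: "f \<in> carrier (free_space K X)" and supp: "{y. f y \<noteq> \<zero>\<^bsub>K\<^esub>} \<subseteq> insert x A"
      \<comment> \<open>\<open>g\<close> is \<open>f\<close> with its value at \<open>x\<close>
        erased: its support lies in \<open>A\<close>, and adding that value back at the generator of
        \<open>x\<close> recovers \<open>f\<close>.\<close>
      define g where "g = f(x := \<zero>\<^bsub>K\<^esub>)"
      have g: "g \<in> carrier (free_space K X)"
        using f by (auto simp: free_space_def g_def intro: finite_subset[of _ "{y. f y \<noteq> \<zero>\<^bsub>K\<^esub>}"])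
      have carr: "f y \<in> carrier K" for y
        using f by (cases "y \<in> X") (auto simp: free_space_def)
      have "{y. g y \<noteq> \<zero>\<^bsub>K\<^esub>} \<subseteq> A" using supp by (auto simp: g_def)
      then have "P g" using insert g by blast
      moreover have "f = g \<oplus>\<^bsub>free_space K X\<^esub> f x \<odot>\<^bsub>free_space K X\<^esub> free_gen K x"
        using carr by (auto simp: free_space_def g_def free_gen_def)
      ultimately show "P f" using add[OF g carr] insert.prems by (metis insert_subset)
    qed
  qed
  from this[of "{x. f x \<noteq> \<zero>\<^bsub>K\<^esub>}"] f show ?thesis by (force simp: free_space_def)
qed

section \<open>Linear maps\<close>

lemma linear_mapsI:
  assumes "\<And>x. x \<in> carrier M \<Longrightarrow> f x \<in> carrier N"
    and "\<And>x y. \<lbrakk>x \<in> carrier M; y \<in> carrier M\<rbrakk> \<Longrightarrow> f (x \<oplus>\<^bsub>M\<^esub> y) = f x \<oplus>\<^bsub>N\<^esub> f y"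
    and "\<And>a x. \<lbrakk>a \<in> carrier K; x \<in> carrier M\<rbrakk> \<Longrightarrow> f (a \<odot>\<^bsub>M\<^esub> x) = a \<odot>\<^bsub>N\<^esub> f x"
  shows "f \<in> linear_maps K M N"
  using assms by (simp add: linear_maps_def)

lemma linear_maps_closed: "\<lbrakk>f \<in> linear_maps K M N; x \<in> carrier M\<rbrakk> \<Longrightarrow> f x \<in> carrier N"
  and linear_maps_add: "\<lbrakk>f \<in> linear_maps K M N; x \<in> carrier M; y \<in> carrier M\<rbrakk> \<Longrightarrow>
    f (x \<oplus>\<^bsub>M\<^esub> y) = f x \<oplus>\<^bsub>N\<^esub> f y"
  and linear_maps_smult: "\<lbrakk>f \<in> linear_maps K M N; a \<in> carrier K; x \<in> carrier M\<rbrakk> \<Longrightarrow>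
    f (a \<odot>\<^bsub>M\<^esub> x) = a \<odot>\<^bsub>N\<^esub> f x"
  by (auto simp: linear_maps_def)

lemma linear_maps_id: "(\<lambda>x. x) \<in> linear_maps K M M"
  by (simp add: linear_maps_def)

lemma linear_maps_compose:
  "\<lbrakk>f \<in> linear_maps K M N; g \<in> linear_maps K N P\<rbrakk> \<Longrightarrow> (\<lambda>x. g (f x)) \<in> linear_maps K M P"
  by (auto simp: linear_maps_def Pi_def)

locale base_field = K: field K for K :: "'k ring"
begin

lemma linear_maps_zero:
  assumes "module K M" "module K N" "f \<in> linear_maps K M N"
  shows "f \<zero>\<^bsub>M\<^esub> = \<zero>\<^bsub>N\<^esub>"
proof -
  interpret M: module K M by fact
  interpret N: module K N by fact
  \<comment> \<open>Preservation of zero is not part of \<open>linear_maps\<close>; it is read off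
    from the scalar zero.\<close>
  have "f (\<zero>\<^bsub>K\<^esub> \<odot>\<^bsub>M\<^esub> \<zero>\<^bsub>M\<^esub>) = \<zero>\<^bsub>K\<^esub> \<odot>\<^bsub>N\<^esub> f \<zero>\<^bsub>M\<^esub>"
    by (rule linear_maps_smult[OF assms(3)]) simp_all
  then show ?thesis using linear_maps_closed[OF assms(3)] by simp
qed

lemma linear_maps_minus:
  assumes "module K M" "module K N" "f \<in> linear_maps K M N" "x \<in> carrier M" "y \<in> carrier M"
  shows "f (x \<ominus>\<^bsub>M\<^esub> y) = f x \<ominus>\<^bsub>N\<^esub> f y"
proof -
  interpret M: module K M by fact
  interpret N: module K N by fact
  \<comment> \<open>Negation is written as the scalar -1, to which the homogeneity of
    \<open>f\<close> applies.\<close>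
  have neg: "\<ominus>\<^bsub>M\<^esub> y = (\<ominus>\<^bsub>K\<^esub> \<one>\<^bsub>K\<^esub>) \<odot>\<^bsub>M\<^esub> y" "\<ominus>\<^bsub>N\<^esub> f y = (\<ominus>\<^bsub>K\<^esub> \<one>\<^bsub>K\<^esub>) \<odot>\<^bsub>N\<^esub> f y"
    using assms linear_maps_closed[OF assms(3)] by (simp_all add: M.smult_l_minus N.smult_l_minus)
  show ?thesis
    unfolding a_minus_def neg
    using linear_maps_add[OF assms(3)] linear_maps_smult[OF assms(3)] assms(4,5) by simp
qed

lemma kernel_submodule:
  assumes "module K M" "module K N" "f \<in> linear_maps K M N"
  shows "submodule {x \<in> carrier M. f x = \<zero>\<^bsub>N\<^esub>} K M"
proof -
  interpret M: module K M by fact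
  interpret N: module K N by fact
  have f0: "f \<zero>\<^bsub>M\<^esub> = \<zero>\<^bsub>N\<^esub>" using linear_maps_zero assms .
  show ?thesis
  proof (rule M.submoduleI; clarsimp simp: f0 linear_maps_add[OF assms(3)] linear_maps_smult[OF assms(3)])
    fix x assume "x \<in> carrier M" "f x = \<zero>\<^bsub>N\<^esub>"
    then have "f (\<zero>\<^bsub>M\<^esub> \<ominus>\<^bsub>M\<^esub> x) = \<zero>\<^bsub>N\<^esub>"
      using linear_maps_minus[OF assms, of "\<zero>\<^bsub>M\<^esub>" x] f0 by (simp add: a_minus_def)
    then show "f (\<ominus>\<^bsub>M\<^esub> x) = \<zero>\<^bsub>N\<^esub>" using \<open>x \<in> carrier M\<close> by (simp add: a_minus_def)
  qed
qed

lemma linear_maps_add_maps: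
  assumes "module K M" "module K N" "f \<in> linear_maps K M N" "g \<in> linear_maps K M N"
  shows "(\<lambda>x. f x \<oplus>\<^bsub>N\<^esub> g x) \<in> linear_maps K M N"
proof -
  interpret M: module K M by fact
  interpret N: module K N by fact
  show ?thesis
    using linear_maps_closed[OF assms(3)] linear_maps_closed[OF assms(4)]
    by (intro linear_mapsI) (simp_all add: linear_maps_add[OF assms(3)] linear_maps_add[OF assms(4)]
      linear_maps_smult[OF assms(3)] linear_maps_smult[OF assms(4)] N.smult_r_distr N.M.a_ac)
qed

lemma linear_maps_diff_maps:
  assumes "module K M" "module K N" "f \<in> linear_maps K M N" "g \<in> linear_maps K M N"
  shows "(\<lambda>x. f x \<ominus>\<^bsub>N\<^esub> g x) \<in> linear_maps K M N"
proof -
  interpret M: module K M by fact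
  interpret N: module K N by fact
  show ?thesis
    using linear_maps_closed[OF assms(3)] linear_maps_closed[OF assms(4)]
    by (intro linear_mapsI) (simp_all add: linear_maps_add[OF assms(3)] linear_maps_add[OF assms(4)]
      linear_maps_smult[OF assms(3)] linear_maps_smult[OF assms(4)] N.smult_r_distr N.M.a_ac
      a_minus_def N.smult_r_minus N.M.minus_add)
qed

text \<open>The sum inside \<open>tensor_lift\<close>, evaluated at a function instead of at a
  chosen member of a coset. Linearity is proved for this version, before any quotient is
  involved.\<close>

definition linear_extension :: "('k, 'p) module \<Rightarrow> ('x \<Rightarrow> 'p) \<Rightarrow> ('x \<Rightarrow> 'k) \<Rightarrow> 'p"
  where "linear_extension P b f = (\<Oplus>\<^bsub>P\<^esub>x\<in>{x. f x \<noteq> \<zero>\<^bsub>K\<^esub>}. f x \<odot>\<^bsub>P\<^esub> b x)"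

lemma free_space_closed: "f \<in> carrier (free_space K X) \<Longrightarrow> f x \<in> carrier K"
  by (cases "x \<in> X") (auto simp: free_space_def)

lemma free_space_support:
  "f \<in> carrier (free_space K X) \<Longrightarrow> finite {x. f x \<noteq> \<zero>\<^bsub>K\<^esub>} \<and> {x. f x \<noteq> \<zero>\<^bsub>K\<^esub>} \<subseteq> X"
  by (auto simp: free_space_def)

text \<open>The additional terms are zero. A common index set for f, g and f + g reduces linearity
  to additivity of finite sums, even where the supports cancel.\<close>

lemma linear_extension_superset:
  assumes "module K P" and b: "b \<in> X \<rightarrow> carrier P" and f: "f \<in> carrier (free_space K X)"
    and A: "finite A" "A \<subseteq> X" "{x. f x \<noteq> \<zero>\<^bsub>K\<^esub>} \<subseteq> A"
  shows "linear_extension P b f = (\<Oplus>\<^bsub>P\<^esub>x\<in>A. f x \<odot>\<^bsub>P\<^esub> b x)"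
proof -
  interpret P: module K P by fact
  have "f x \<odot>\<^bsub>P\<^esub> b x = \<zero>\<^bsub>P\<^esub>" if "x \<in> A - {x. f x \<noteq> \<zero>\<^bsub>K\<^esub>}" for x
    using that A b by (auto simp: Pi_iff subset_iff)
  moreover have "(\<lambda>x. f x \<odot>\<^bsub>P\<^esub> b x) \<in> A \<rightarrow> carrier P"
    using A b free_space_closed[OF f] by (auto simp: Pi_iff subset_iff)
  ultimately show ?thesis
    unfolding linear_extension_def
    by (intro P.M.add.finprod_mono_neutral_cong_left A) auto
qed

lemma linear_extension_linear:
  assumes "module K P" and b: "b \<in> X \<rightarrow> carrier P"
  shows "linear_extension P b \<in> linear_maps K (free_space K X) P"
proof -
  interpret P: module K P by fact
  interpret F: module K "free_space K X" by (rule module_free_space) (rule K.cring_axioms)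
  have closed: "(\<lambda>x. f x \<odot>\<^bsub>P\<^esub> b x) \<in> A \<rightarrow> carrier P"
    if "f \<in> carrier (free_space K X)" "A \<subseteq> X" for f A
    using b free_space_closed[OF that(1)] that(2) by (auto simp: Pi_iff subset_iff)
  show ?thesis
  proof (rule linear_mapsI)
    fix f assume f: "f \<in> carrier (free_space K X)"
    then show "linear_extension P b f \<in> carrier P"
      unfolding linear_extension_def using closed[OF f] free_space_support[OF f]
      by (intro P.M.finsum_closed) blast
  next
    fix f g assume f: "f \<in> carrier (free_space K X)" and g: "g \<in> carrier (free_space K X)"
    define A where "A = {x. f x \<noteq> \<zero>\<^bsub>K\<^esub>} \<union> {x. g x \<noteq> \<zero>\<^bsub>K\<^esub>}"
    have A: "finite A" "A \<subseteq> X" "{x. f x \<noteq> \<zero>\<^bsub>K\<^esub>} \<subseteq> A" "{x. g x \<noteq> \<zero>\<^bsub>K\<^esub>} \<subseteq> A"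
      "{x. (f \<oplus>\<^bsub>free_space K X\<^esub> g) x \<noteq> \<zero>\<^bsub>K\<^esub>} \<subseteq> A"
      using free_space_support[OF f] free_space_support[OF g] by (auto simp: A_def free_space_def)
    have "(\<Oplus>\<^bsub>P\<^esub>x\<in>A. (f \<oplus>\<^bsub>free_space K X\<^esub> g) x \<odot>\<^bsub>P\<^esub> b x) =
        (\<Oplus>\<^bsub>P\<^esub>x\<in>A. f x \<odot>\<^bsub>P\<^esub> b x \<oplus>\<^bsub>P\<^esub> g x \<odot>\<^bsub>P\<^esub> b x)"
      using b A closed[OF f A(2)] closed[OF g A(2)] free_space_closed[OF f] free_space_closed[OF g]
      by (intro P.M.finsum_cong') (auto simp: free_space_def P.smult_l_distr Pi_iff subset_iff)
    then show "linear_extension P b (f \<oplus>\<^bsub>free_space K X\<^esub> g) =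
        linear_extension P b f \<oplus>\<^bsub>P\<^esub> linear_extension P b g"
      using A closed[OF f A(2)] closed[OF g A(2)] f g
      by (simp add: linear_extension_superset[OF assms, of _ A] P.M.finsum_addf)
  next
    fix a f assume a: "a \<in> carrier K" and f: "f \<in> carrier (free_space K X)"
    define A where "A = {x. f x \<noteq> \<zero>\<^bsub>K\<^esub>}"
    have A: "finite A" "A \<subseteq> X" "{x. f x \<noteq> \<zero>\<^bsub>K\<^esub>} \<subseteq> A"
      "{x. (a \<odot>\<^bsub>free_space K X\<^esub> f) x \<noteq> \<zero>\<^bsub>K\<^esub>} \<subseteq> A"
      using free_space_support[OF f] a by (auto simp: A_def free_space_def)
    have "(\<Oplus>\<^bsub>P\<^esub>x\<in>A. (a \<odot>\<^bsub>free_space K X\<^esub> f) x \<odot>\<^bsub>P\<^esub> b x) =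
        (\<Oplus>\<^bsub>P\<^esub>x\<in>A. a \<odot>\<^bsub>P\<^esub> (f x \<odot>\<^bsub>P\<^esub> b x))"
      using b A closed[OF f A(2)] free_space_closed[OF f] a
      by (intro P.M.finsum_cong') (auto simp: free_space_def P.smult_assoc1 Pi_iff subset_iff)
    then show "linear_extension P b (a \<odot>\<^bsub>free_space K X\<^esub> f) = a \<odot>\<^bsub>P\<^esub> linear_extension P b f"
      using A closed[OF f A(2)] f a
      by (simp add: linear_extension_superset[OF assms, of _ A] P.finsum_smult_ldistr)
  qed
qed

lemma linear_extension_gen:
  assumes "module K P" and b: "b \<in> X \<rightarrow> carrier P" and "x \<in> X"
  shows "linear_extension P b (free_gen K x) = b x"
proof -
  interpret P: module K P by fact
  have bx: "b x \<in> carrier P" using b \<open>x \<in> X\<close> by blast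
  have "{y. free_gen K x y \<noteq> \<zero>\<^bsub>K\<^esub>} = {x}" by (auto simp: free_gen_def)
  then show ?thesis
    using bx by (simp add: linear_extension_def P.M.finsum_insert) (simp add: free_gen_def)
qed

lemma module_diff_eq_zero_iff:
  assumes "module K M" "x \<in> carrier M" "y \<in> carrier M"
  shows "x \<ominus>\<^bsub>M\<^esub> y = \<zero>\<^bsub>M\<^esub> \<longleftrightarrow> x = y"
proof -
  interpret M: module K M by fact
  show ?thesis
    using assms(2,3) M.M.minus_equality[of x "\<ominus>\<^bsub>M\<^esub> y"] by (auto simp: a_minus_def M.M.r_neg)
qed

section \<open>Tensor products\<close>

abbreviation tens (infixr \<open>\<boxtimes>\<close> 72)
  where "M \<boxtimes> N \<equiv> tensor K M N"

abbreviation lin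
  where "lin \<equiv> linear_maps K"

abbreviation tmap
  where "tmap \<equiv> tensor_map K"

abbreviation pure
  where "pure \<equiv> pure_tensor K"

abbreviation tassoc
  where "tassoc \<equiv> tensor_assoc K"

definition bilinear ::
  "('k, 'm) module \<Rightarrow> ('k, 'n) module \<Rightarrow> ('k, 'p) module \<Rightarrow> ('m \<Rightarrow> 'n \<Rightarrow> 'p) \<Rightarrow> bool"
  where "bilinear M N P b \<longleftrightarrow>
    (\<forall>n\<in>carrier N. (\<lambda>m. b m n) \<in> lin M P) \<and> (\<forall>m\<in>carrier M. b m \<in> lin N P)"

lemma bilinear_relations_subset:
  fixes M :: "('k, 'm) module" and N :: "('k, 'n) module"
  assumes "module K M" "module K N"
  shows "bilinear_relations K M N \<subseteq> carrier (free_space K (carrier M \<times> carrier N))"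
proof -
  interpret M: module K M by fact
  interpret N: module K N by fact
  interpret F: module K "free_space K (carrier M \<times> carrier N)"
    by (rule module_free_space) (rule K.cring_axioms)
  have "free_gen K (m, n) \<in> carrier (free_space K (carrier M \<times> carrier N))"
    if "m \<in> carrier M" "n \<in> carrier N" for m n
    using that by (intro free_gen_closed K.cring_axioms) simp
  then show ?thesis
    unfolding bilinear_relations_def Let_def by (auto intro!: F.M.minus_closed)
qed

lemma tensor_kernel_submodule:
  fixes M :: "('k, 'm) module" and N :: "('k, 'n) module"
  assumes "module K M" "module K N"
  shows "submodule (tensor_kernel K M N) K (free_space K (carrier M \<times> carrier N))"
    and "bilinear_relations K M N \<subseteq> tensor_kernel K M N"
proof -
  let ?F = "free_space K (carrier M \<times> carrier N)"
  interpret F: module K ?F by (rule module_free_space) (rule K.cring_axioms)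
  \<comment> \<open>The whole free space contains the relations and is thus a member of the
    intersected family, so the intersection stays inside it.\<close>
  have F: "tensor_kernel K M N \<subseteq> carrier ?F"
    using F.carrier_is_submodule bilinear_relations_subset[OF assms] by (auto simp: tensor_kernel_def)
  show "submodule (tensor_kernel K M N) K ?F"
  proof (rule F.submoduleI[OF F])
    show "\<zero>\<^bsub>?F\<^esub> \<in> tensor_kernel K M N"
      using submodule_zero_closed by (force simp: tensor_kernel_def)
  qed (auto simp: tensor_kernel_def dest: F.submoduleE)
  show "bilinear_relations K M N \<subseteq> tensor_kernel K M N"
    by (auto simp: tensor_kernel_def)
qed

lemma tensor_simps:
  "carrier (M \<boxtimes> N) = carrier (tensor_space K M N)"
  "add (M \<boxtimes> N) = add (tensor_space K M N)"
  "zero (M \<boxtimes> N) = zero (tensor_space K M N)"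
  "smult (M \<boxtimes> N) = smult (tensor_space K M N)"
  by (simp_all add: tensor_def)

lemma module_tensor [simp, intro]:
  fixes M :: "('k, 'm) module" and N :: "('k, 'n) module"
  assumes "module K M" "module K N"
  shows "module K (M \<boxtimes> N)"
proof (rule module_cong)
  show "module K (tensor_space K M N)"
    unfolding tensor_space_def
    by (intro module_quotient_space module_free_space K.cring_axioms tensor_kernel_submodule assms)
qed (simp_all add: tensor_simps)

context
  fixes M :: "('k, 'm) module" and N :: "('k, 'n) module"
  assumes M: "module K M" and N: "module K N"
begin

interpretation M: module K M by (rule M)
interpretation N: module K N by (rule N)
interpretation F: module K "free_space K (carrier M \<times> carrier N)"
  by (rule module_free_space) (rule K.cring_axioms)

text \<open>The coset facts for M \<otimes> N, cited by position: (1) carrier, (2) addition, (3)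
  zero, (4) scalars, (5) equality of cosets, (6) a representative lies in its coset, (7) members of
  a coset represent it.\<close>

lemmas tensor_coset = quotient_space_coset[OF F.module_axioms tensor_kernel_submodule(1)[OF M N],
    folded tensor_space_def, folded tensor_simps]

lemma free_gen_pair_closed:
  "\<lbrakk>m \<in> carrier M; n \<in> carrier N\<rbrakk> \<Longrightarrow> free_gen K (m, n) \<in> carrier (free_space K (carrier M \<times> carrier N))"
  by (rule free_gen_closed[OF K.cring_axioms]) simp

lemma pure_tensor_closed [simp, intro]:
  "\<lbrakk>m \<in> carrier M; n \<in> carrier N\<rbrakk> \<Longrightarrow> pure M N m n \<in> carrier (M \<boxtimes> N)"
  using free_gen_pair_closed by (auto simp: tensor_coset(1) pure_tensor_def)

text \<open>The difference of representatives is one of the generating relations, hence in the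
  kernel; equality of cosets gives the law. The three laws that follow are obtained likewise from
  the other families of relations.\<close>

lemma pure_tensor_add_left:
  assumes "m \<in> carrier M" "m' \<in> carrier M" "n \<in> carrier N"
  shows "pure M N (m \<oplus>\<^bsub>M\<^esub> m') n = pure M N m n \<oplus>\<^bsub>M \<boxtimes> N\<^esub> pure M N m' n"
proof -
  let ?F = "free_space K (carrier M \<times> carrier N)" and ?e = "\<lambda>m n. free_gen K (m, n)"
  have "?e (m \<oplus>\<^bsub>M\<^esub> m') n \<ominus>\<^bsub>?F\<^esub> (?e m n \<oplus>\<^bsub>?F\<^esub> ?e m' n) \<in> tensor_kernel K M N"
    using assms
    by (intro subsetD[OF tensor_kernel_submodule(2)[OF M N]]) (auto simp: bilinear_relations_def Let_def)
  then show ?thesis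
    unfolding pure_tensor_def using assms free_gen_pair_closed by (simp add: tensor_coset(2) tensor_coset(5))
qed

lemma pure_tensor_add_right:
  assumes "m \<in> carrier M" "n \<in> carrier N" "n' \<in> carrier N"
  shows "pure M N m (n \<oplus>\<^bsub>N\<^esub> n') = pure M N m n \<oplus>\<^bsub>M \<boxtimes> N\<^esub> pure M N m n'"
proof -
  let ?F = "free_space K (carrier M \<times> carrier N)" and ?e = "\<lambda>m n. free_gen K (m, n)"
  have "?e m (n \<oplus>\<^bsub>N\<^esub> n') \<ominus>\<^bsub>?F\<^esub> (?e m n \<oplus>\<^bsub>?F\<^esub> ?e m n') \<in> tensor_kernel K M N"
    using assms
    by (intro subsetD[OF tensor_kernel_submodule(2)[OF M N]]) (auto simp: bilinear_relations_def Let_def)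
  then show ?thesis
    unfolding pure_tensor_def using assms free_gen_pair_closed by (simp add: tensor_coset(2) tensor_coset(5))
qed

lemma pure_tensor_smult_left:
  assumes "a \<in> carrier K" "m \<in> carrier M" "n \<in> carrier N"
  shows "pure M N (a \<odot>\<^bsub>M\<^esub> m) n = a \<odot>\<^bsub>M \<boxtimes> N\<^esub> pure M N m n"
proof -
  let ?F = "free_space K (carrier M \<times> carrier N)" and ?e = "\<lambda>m n. free_gen K (m, n)"
  have "?e (a \<odot>\<^bsub>M\<^esub> m) n \<ominus>\<^bsub>?F\<^esub> a \<odot>\<^bsub>?F\<^esub> ?e m n \<in> tensor_kernel K M N"
    using assms
    by (intro subsetD[OF tensor_kernel_submodule(2)[OF M N]])
      (unfold bilinear_relations_def Let_def, blast)
  then show ?thesis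
    unfolding pure_tensor_def using assms free_gen_pair_closed by (simp add: tensor_coset(4) tensor_coset(5))
qed

lemma pure_tensor_smult_right:
  assumes "a \<in> carrier K" "m \<in> carrier M" "n \<in> carrier N"
  shows "pure M N m (a \<odot>\<^bsub>N\<^esub> n) = a \<odot>\<^bsub>M \<boxtimes> N\<^esub> pure M N m n"
proof -
  let ?F = "free_space K (carrier M \<times> carrier N)" and ?e = "\<lambda>m n. free_gen K (m, n)"
  have "?e m (a \<odot>\<^bsub>N\<^esub> n) \<ominus>\<^bsub>?F\<^esub> a \<odot>\<^bsub>?F\<^esub> ?e m n \<in> tensor_kernel K M N"
    using assms
    by (intro subsetD[OF tensor_kernel_submodule(2)[OF M N]])
      (unfold bilinear_relations_def Let_def, blast)
  then show ?thesis
    unfolding pure_tensor_def using assms free_gen_pair_closed by (simp add: tensor_coset(4) tensor_coset(5))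
qed

lemma pure_tensor_linear_left: "n \<in> carrier N \<Longrightarrow> (\<lambda>m. pure M N m n) \<in> lin M (M \<boxtimes> N)"
  and pure_tensor_linear_right: "m \<in> carrier M \<Longrightarrow> pure M N m \<in> lin N (M \<boxtimes> N)"
  by (simp_all add: linear_mapsI pure_tensor_add_left pure_tensor_add_right
      pure_tensor_smult_left pure_tensor_smult_right)

text \<open>Scalars are absorbed into the left factor, a (m \<otimes> n) = (a m) \<otimes> n, so
  every tensor is a plain sum of pure tensors and no scalar occurs in the induction step.\<close>

lemma tensor_induct [consumes 1, case_names zero add]:
  assumes t: "t \<in> carrier (M \<boxtimes> N)"
    and zero: "P \<zero>\<^bsub>M \<boxtimes> N\<^esub>"
    and add: "\<And>t m n. \<lbrakk>t \<in> carrier (M \<boxtimes> N); m \<in> carrier M; n \<in> carrier N; P t\<rbrakk> \<Longrightarrow>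
      P (t \<oplus>\<^bsub>M \<boxtimes> N\<^esub> pure M N m n)"
  shows "P t"
proof -
  let ?F = "free_space K (carrier M \<times> carrier N)"
  have "P (tensor_kernel K M N +>\<^bsub>?F\<^esub> f)" if "f \<in> carrier ?F" for f
    using K.cring_axioms that
  proof (induction rule: free_space_induct)
    case zero
    then show ?case using assms(2) by (simp add: tensor_coset(3))
  next
    case (add f a x)
    obtain m n where x: "x = (m, n)" "m \<in> carrier M" "n \<in> carrier N" using add by auto
    have "tensor_kernel K M N +>\<^bsub>?F\<^esub> (f \<oplus>\<^bsub>?F\<^esub> a \<odot>\<^bsub>?F\<^esub> free_gen K x) =
        (tensor_kernel K M N +>\<^bsub>?F\<^esub> f) \<oplus>\<^bsub>M \<boxtimes> N\<^esub> pure M N (a \<odot>\<^bsub>M\<^esub> m) n"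
      using add x free_gen_pair_closed
      by (subst pure_tensor_smult_left) (simp_all add: tensor_coset(2,4)[symmetric] pure_tensor_def)
    then show ?case
      using assms(3)[of "tensor_kernel K M N +>\<^bsub>?F\<^esub> f" "a \<odot>\<^bsub>M\<^esub> m" n] add x
      by (simp add: tensor_coset(1))
  qed
  then show ?thesis using t by (auto simp: tensor_coset(1))
qed

text \<open>Pure tensors generate. Identities between composites of \<open>tmap\<close>,
  \<open>tassoc\<close> and the unit map are reduced by this lemma to a computation on pure
  tensors.\<close>

lemma tensor_linear_ext:
  assumes "module K P" "f \<in> lin (M \<boxtimes> N) P" "g \<in> lin (M \<boxtimes> N) P"
    and eq: "\<And>m n. \<lbrakk>m \<in> carrier M; n \<in> carrier N\<rbrakk> \<Longrightarrow> f (pure M N m n) = g (pure M N m n)"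
    and t: "t \<in> carrier (M \<boxtimes> N)"
  shows "f t = g t"
  using t
proof (induction rule: tensor_induct)
  case zero
  then show ?case
    by (simp add: linear_maps_zero[OF module_tensor[OF M N] assms(1) assms(2)]
        linear_maps_zero[OF module_tensor[OF M N] assms(1) assms(3)])
next
  case (add t m n)
  then show ?case by (simp add: linear_maps_add[OF assms(2)] linear_maps_add[OF assms(3)] eq)
qed

text \<open>The universal property. The linear extension of \<open>b\<close> kills the bilinearity
  relations, so its kernel is one of the submodules intersected in \<open>tensor_kernel\<close>. The
  extension is therefore constant on cosets, and the representative picked by \<open>SOME\<close> is
  immaterial.\<close>

lemma tensor_lift:
  assumes "module K P" and b: "bilinear M N P b"
  shows tensor_lift_linear: "tensor_lift K P b \<in> lin (M \<boxtimes> N) P"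
    and tensor_lift_pure: "\<lbrakk>m \<in> carrier M; n \<in> carrier N\<rbrakk> \<Longrightarrow> tensor_lift K P b (pure M N m n) = b m n"
proof -
  let ?F = "free_space K (carrier M \<times> carrier N)" and ?E = "linear_extension P (case_prod b)"
  interpret P: module K P by fact
  have bl: "(\<lambda>m. b m n) \<in> lin M P" if "n \<in> carrier N" for n using b that by (simp add: bilinear_def)
  have br: "b m \<in> lin N P" if "m \<in> carrier M" for m using b that by (simp add: bilinear_def)
  have closed: "b m n \<in> carrier P" if "m \<in> carrier M" "n \<in> carrier N" for m n
    using linear_maps_closed[OF br] that by blast
  have b': "case_prod b \<in> carrier M \<times> carrier N \<rightarrow> carrier P" using closed by auto
  have E: "?E \<in> lin ?F P" by (rule linear_extension_linear) fact+
  have Egen: "?E (free_gen K (m, n)) = b m n" if "m \<in> carrier M" "n \<in> carrier N" for m n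
    using linear_extension_gen[OF assms(1) b', of "(m, n)"] that by simp
  have "bilinear_relations K M N \<subseteq> {f \<in> carrier ?F. ?E f = \<zero>\<^bsub>P\<^esub>}"
  proof
    fix f assume f: "f \<in> bilinear_relations K M N"
    then have "f \<in> carrier ?F" using bilinear_relations_subset[OF M N] by blast
    moreover have "?E f = \<zero>\<^bsub>P\<^esub>"
      using f unfolding bilinear_relations_def Let_def
      by (elim UnE; clarsimp simp: linear_maps_minus[OF F.module_axioms assms(1) E]
          linear_maps_add[OF E] linear_maps_smult[OF E] free_gen_pair_closed Egen closed
          linear_maps_add[OF bl] linear_maps_add[OF br] linear_maps_smult[OF bl] linear_maps_smult[OF br]
          module_diff_eq_zero_iff[OF assms(1)])
    ultimately show "f \<in> {f \<in> carrier ?F. ?E f = \<zero>\<^bsub>P\<^esub>}" by simp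
  qed
  then have ker: "tensor_kernel K M N \<subseteq> {f \<in> carrier ?F. ?E f = \<zero>\<^bsub>P\<^esub>}"
    using kernel_submodule[OF F.module_axioms assms(1) E] by (auto simp: tensor_kernel_def)
  have lift: "tensor_lift K P b (tensor_kernel K M N +>\<^bsub>?F\<^esub> f) = ?E f" if f: "f \<in> carrier ?F" for f
  proof -
    \<comment> \<open>\<open>g\<close> is the representative that \<open>tensor_lift\<close>
      evaluates; it differs from \<open>f\<close> by an element of the kernel of
      \<open>?E\<close>.\<close>
    define g where "g = (SOME g. g \<in> tensor_kernel K M N +>\<^bsub>?F\<^esub> f)"
    have "g \<in> tensor_kernel K M N +>\<^bsub>?F\<^esub> f"
      unfolding g_def some_in_eq using tensor_coset(6)[OF f] by blast
    then have g: "g \<in> carrier ?F" "g \<ominus>\<^bsub>?F\<^esub> f \<in> tensor_kernel K M N"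
      using tensor_coset(7)[OF f] tensor_coset(5)[OF _ f] by blast+
    then have "?E g \<ominus>\<^bsub>P\<^esub> ?E f = \<zero>\<^bsub>P\<^esub>"
      using ker linear_maps_minus[OF F.module_axioms assms(1) E _ f] by force
    then have "?E g = ?E f"
      using linear_maps_closed[OF E] f g by (simp add: module_diff_eq_zero_iff[OF assms(1)])
    moreover have "tensor_lift K P b (tensor_kernel K M N +>\<^bsub>?F\<^esub> f) = ?E g"
      by (simp add: tensor_lift_def linear_extension_def Let_def g_def split_def)
    ultimately show ?thesis by simp
  qed
  show "tensor_lift K P b \<in> lin (M \<boxtimes> N) P"
  proof (rule linear_mapsI)
    fix s assume "s \<in> carrier (M \<boxtimes> N)"
    then show "tensor_lift K P b s \<in> carrier P"
      using linear_maps_closed[OF E] by (auto simp: tensor_coset(1) lift)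
  next
    fix s t assume "s \<in> carrier (M \<boxtimes> N)" "t \<in> carrier (M \<boxtimes> N)"
    then show "tensor_lift K P b (s \<oplus>\<^bsub>M \<boxtimes> N\<^esub> t) = tensor_lift K P b s \<oplus>\<^bsub>P\<^esub> tensor_lift K P b t"
      by (auto simp: tensor_coset(1) tensor_coset(2) lift linear_maps_add[OF E])
  next
    fix a s assume "a \<in> carrier K" "s \<in> carrier (M \<boxtimes> N)"
    then show "tensor_lift K P b (a \<odot>\<^bsub>M \<boxtimes> N\<^esub> s) = a \<odot>\<^bsub>P\<^esub> tensor_lift K P b s"
      by (auto simp: tensor_coset(1) tensor_coset(4) lift linear_maps_smult[OF E])
  qed
  show "tensor_lift K P b (pure M N m n) = b m n" if "m \<in> carrier M" "n \<in> carrier N"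
    using that by (simp add: pure_tensor_def lift free_gen_pair_closed Egen)
qed

end

end

section \<open>Functoriality of the tensor product\<close>

lemma linear_maps_cong:
  assumes "module K M" "\<And>x. x \<in> carrier M \<Longrightarrow> f x = g x"
  shows "f \<in> linear_maps K M N \<longleftrightarrow> g \<in> linear_maps K M N"
proof -
  interpret M: module K M by fact
  show ?thesis using assms(2) by (simp add: linear_maps_def Pi_iff)
qed

context base_field
begin

lemma tensor_map:
  assumes "module K M" "module K N" "module K P" "module K Q" "f \<in> lin M P" "g \<in> lin N Q"
  shows tensor_map_linear [intro]: "tmap P Q f g \<in> lin (M \<boxtimes> N) (P \<boxtimes> Q)"
    and tensor_map_pure: "\<lbrakk>m \<in> carrier M; n \<in> carrier N\<rbrakk> \<Longrightarrow>
      tmap P Q f g (pure M N m n) = pure P Q (f m) (g n)"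
proof -
  have "bilinear M N (P \<boxtimes> Q) (\<lambda>m n. pure P Q (f m) (g n))"
    unfolding bilinear_def
    using linear_maps_compose[OF assms(5) pure_tensor_linear_left[OF assms(3,4)]]
      linear_maps_compose[OF assms(6) pure_tensor_linear_right[OF assms(3,4)]]
      linear_maps_closed[OF assms(5)] linear_maps_closed[OF assms(6)] by blast
  note b = assms(1,2) module_tensor[OF assms(3,4)] this
  show "tmap P Q f g \<in> lin (M \<boxtimes> N) (P \<boxtimes> Q)"
    unfolding tensor_map_def by (rule tensor_lift_linear[OF b])
  show "tmap P Q f g (pure M N m n) = pure P Q (f m) (g n)"
    if "m \<in> carrier M" "n \<in> carrier N"
    unfolding tensor_map_def by (rule tensor_lift_pure[OF b that])
qed

lemma tensor_map_closed:
  assumes "module K M" "module K N" "module K P" "module K Q" "f \<in> lin M P" "g \<in> lin N Q"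
    "t \<in> carrier (M \<boxtimes> N)"
  shows "tmap P Q f g t \<in> carrier (P \<boxtimes> Q)"
  using linear_maps_closed[OF tensor_map_linear] assms by blast

lemma tensor_map_id:
  assumes "module K M" "module K N" "t \<in> carrier (M \<boxtimes> N)"
  shows "tmap M N (\<lambda>x. x) (\<lambda>x. x) t = t"
  by (rule tensor_linear_ext[OF assms(1,2) module_tensor[OF assms(1,2)] _ _ _ assms(3), where g = "\<lambda>x. x"])
    (use assms in \<open>simp_all add: tensor_map_linear linear_maps_id tensor_map_pure\<close>)

text \<open>Functions are total, but the maps in question agree only on carriers, so an argument of
  \<open>tmap\<close> cannot simply be rewritten. On pure tensors only values on the carriers
  occur.\<close>

lemma tensor_map_cong:
  assumes "module K M" "module K N" "module K P" "module K Q" "f \<in> lin M P" "g \<in> lin N Q"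
    and eq: "\<And>x. x \<in> carrier M \<Longrightarrow> f' x = f x" "\<And>x. x \<in> carrier N \<Longrightarrow> g' x = g x"
    and "t \<in> carrier (M \<boxtimes> N)"
  shows "tmap P Q f' g' t = tmap P Q f g t"
proof -
  have "f' \<in> lin M P" "g' \<in> lin N Q"
    using linear_maps_cong[OF assms(1), of f' f P] linear_maps_cong[OF assms(2), of g' g Q]
      eq assms(5,6) by auto
  note t' = tensor_map[OF assms(1-4) this] and t = tensor_map[OF assms(1-6)]
  show ?thesis
    by (rule tensor_linear_ext[OF assms(1,2) module_tensor[OF assms(3,4)] t'(1) t(1) _ assms(9)])
      (simp add: t'(2) t(2) eq)
qed

lemma tensor_map_compose:
  assumes "module K M" "module K N" "module K P" "module K Q" "module K P'" "module K Q'"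
    "f \<in> lin M P" "g \<in> lin N Q" "f' \<in> lin P P'" "g' \<in> lin Q Q'" "t \<in> carrier (M \<boxtimes> N)"
  shows "tmap P' Q' f' g' (tmap P Q f g t) = tmap P' Q' (\<lambda>x. f' (f x)) (\<lambda>x. g' (g x)) t"
proof -
  have comp: "(\<lambda>x. f' (f x)) \<in> lin M P'" "(\<lambda>x. g' (g x)) \<in> lin N Q'"
    using assms linear_maps_compose by blast+
  show ?thesis
  proof (rule tensor_linear_ext[OF assms(1,2) module_tensor[OF assms(5,6)] _ _ _ assms(11)])
    show "(\<lambda>t. tmap P' Q' f' g' (tmap P Q f g t)) \<in> lin (M \<boxtimes> N) (P' \<boxtimes> Q')"
      by (rule linear_maps_compose[OF tensor_map_linear tensor_map_linear]) fact+
    show "tmap P' Q' (\<lambda>x. f' (f x)) (\<lambda>x. g' (g x)) \<in> lin (M \<boxtimes> N) (P' \<boxtimes> Q')"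
      by (rule tensor_map_linear) fact+
  qed (use assms comp in \<open>simp add: tensor_map_pure linear_maps_closed[OF assms(7)] linear_maps_closed[OF assms(8)]\<close>)
qed

lemma tensor_map_add_left:
  assumes "module K M" "module K N" "module K P" "module K Q"
    "f \<in> lin M P" "f' \<in> lin M P" "g \<in> lin N Q" "t \<in> carrier (M \<boxtimes> N)"
  shows "tmap P Q (\<lambda>x. f x \<oplus>\<^bsub>P\<^esub> f' x) g t = tmap P Q f g t \<oplus>\<^bsub>P \<boxtimes> Q\<^esub> tmap P Q f' g t"
proof -
  have sum: "(\<lambda>x. f x \<oplus>\<^bsub>P\<^esub> f' x) \<in> lin M P"
    by (rule linear_maps_add_maps) fact+
  show ?thesis
  proof (rule tensor_linear_ext[OF assms(1,2) module_tensor[OF assms(3,4)] _ _ _ assms(8)])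
    show "(\<lambda>t. tmap P Q f g t \<oplus>\<^bsub>P \<boxtimes> Q\<^esub> tmap P Q f' g t) \<in> lin (M \<boxtimes> N) (P \<boxtimes> Q)"
      using assms by (intro linear_maps_add_maps) auto
    show "tmap P Q (\<lambda>x. f x \<oplus>\<^bsub>P\<^esub> f' x) g \<in> lin (M \<boxtimes> N) (P \<boxtimes> Q)"
      by (rule tensor_map_linear) fact+
  qed (use assms sum in \<open>simp add: tensor_map_pure linear_maps_closed pure_tensor_add_left\<close>)
qed

lemma pure_tensor_diff_left:
  assumes "module K M" "module K N" "m \<in> carrier M" "m' \<in> carrier M" "n \<in> carrier N"
  shows "pure M N (m \<ominus>\<^bsub>M\<^esub> m') n = pure M N m n \<ominus>\<^bsub>M \<boxtimes> N\<^esub> pure M N m' n"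
  by (rule linear_maps_minus[OF _ _ pure_tensor_linear_left]) (use assms in auto)

lemma tensor_map_diff_left:
  assumes "module K M" "module K N" "module K P" "module K Q"
    "f \<in> lin M P" "f' \<in> lin M P" "g \<in> lin N Q" "t \<in> carrier (M \<boxtimes> N)"
  shows "tmap P Q (\<lambda>x. f x \<ominus>\<^bsub>P\<^esub> f' x) g t = tmap P Q f g t \<ominus>\<^bsub>P \<boxtimes> Q\<^esub> tmap P Q f' g t"
proof -
  have diff: "(\<lambda>x. f x \<ominus>\<^bsub>P\<^esub> f' x) \<in> lin M P"
    by (rule linear_maps_diff_maps) fact+
  show ?thesis
  proof (rule tensor_linear_ext[OF assms(1,2) module_tensor[OF assms(3,4)] _ _ _ assms(8)])
    show "(\<lambda>t. tmap P Q f g t \<ominus>\<^bsub>P \<boxtimes> Q\<^esub> tmap P Q f' g t) \<in> lin (M \<boxtimes> N) (P \<boxtimes> Q)"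
      using assms by (intro linear_maps_diff_maps) auto
    show "tmap P Q (\<lambda>x. f x \<ominus>\<^bsub>P\<^esub> f' x) g \<in> lin (M \<boxtimes> N) (P \<boxtimes> Q)"
      by (rule tensor_map_linear) fact+
  qed (use assms diff in \<open>simp add: tensor_map_pure linear_maps_closed pure_tensor_diff_left\<close>)
qed

text \<open>With the last factor fixed, \<open>f\<close> and \<open>g\<close> become linear maps on
  L \<otimes> M; extensionality is applied once for the outer and once for the inner tensor
  product.\<close>

lemma tensor_linear_ext_left:
  assumes "module K L" "module K M" "module K N" "module K P"
    and f: "f \<in> lin ((L \<boxtimes> M) \<boxtimes> N) P" and g: "g \<in> lin ((L \<boxtimes> M) \<boxtimes> N) P"
    and eq: "\<And>l m n. \<lbrakk>l \<in> carrier L; m \<in> carrier M; n \<in> carrier N\<rbrakk> \<Longrightarrow>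
      f (pure (L \<boxtimes> M) N (pure L M l m) n) = g (pure (L \<boxtimes> M) N (pure L M l m) n)"
    and t: "t \<in> carrier ((L \<boxtimes> M) \<boxtimes> N)"
  shows "f t = g t"
proof (rule tensor_linear_ext[OF _ assms(3,4) f g _ t])
  fix s n assume s: "s \<in> carrier (L \<boxtimes> M)" and n: "n \<in> carrier N"
  note p = pure_tensor_linear_left[OF module_tensor[OF assms(1,2)] assms(3) n]
  show "f (pure (L \<boxtimes> M) N s n) = g (pure (L \<boxtimes> M) N s n)"
    by (rule tensor_linear_ext[OF assms(1,2,4) linear_maps_compose[OF p f] linear_maps_compose[OF p g] _ s])
      (rule eq[OF _ _ n])
qed (use assms in simp)

lemma tensor_linear_ext_right:
  assumes "module K L" "module K M" "module K N" "module K P"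
    and f: "f \<in> lin (L \<boxtimes> (M \<boxtimes> N)) P" and g: "g \<in> lin (L \<boxtimes> (M \<boxtimes> N)) P"
    and eq: "\<And>l m n. \<lbrakk>l \<in> carrier L; m \<in> carrier M; n \<in> carrier N\<rbrakk> \<Longrightarrow>
      f (pure L (M \<boxtimes> N) l (pure M N m n)) = g (pure L (M \<boxtimes> N) l (pure M N m n))"
    and t: "t \<in> carrier (L \<boxtimes> (M \<boxtimes> N))"
  shows "f t = g t"
proof (rule tensor_linear_ext[OF assms(1) _ assms(4) f g _ t])
  fix l s assume s: "s \<in> carrier (M \<boxtimes> N)" and l: "l \<in> carrier L"
  note p = pure_tensor_linear_right[OF assms(1) module_tensor[OF assms(2,3)] l]
  show "f (pure L (M \<boxtimes> N) l s) = g (pure L (M \<boxtimes> N) l s)"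
    by (rule tensor_linear_ext[OF assms(2,3,4) linear_maps_compose[OF p f] linear_maps_compose[OF p g] _ s])
      (rule eq[OF l])
qed (use assms in simp)

text \<open>An outer lift needs the inner lift to be bilinear. Linearity in \<open>t\<close> is the
  universal property. Linearity in \<open>n\<close> is, for fixed parameters, an equation between
  linear maps of \<open>t\<close>, so it can be checked on pure tensors.\<close>

lemma bilinear_lift_left:
  assumes "module K L" "module K M" "module K N" "module K P"
    and bil: "\<And>n. n \<in> carrier N \<Longrightarrow> bilinear L M P (\<lambda>l m. b l m n)"
    and lin: "\<And>l m. \<lbrakk>l \<in> carrier L; m \<in> carrier M\<rbrakk> \<Longrightarrow> b l m \<in> lin N P"
  shows "bilinear (L \<boxtimes> M) N P (\<lambda>t n. tensor_lift K P (\<lambda>l m. b l m n) t)"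
proof -
  interpret N: module K N by fact
  interpret P: module K P by fact
  note lift = tensor_lift_linear[OF assms(1,2,4) bil]
  note lift_pure = tensor_lift_pure[OF assms(1,2,4) bil]
  have "(\<lambda>n. tensor_lift K P (\<lambda>l m. b l m n) t) \<in> lin N P" if t: "t \<in> carrier (L \<boxtimes> M)" for t
  proof (rule linear_mapsI)
    fix n assume "n \<in> carrier N"
    then show "tensor_lift K P (\<lambda>l m. b l m n) t \<in> carrier P"
      using linear_maps_closed[OF lift t] by simp
  next
    fix n n' assume n: "n \<in> carrier N" "n' \<in> carrier N"
    show "tensor_lift K P (\<lambda>l m. b l m (n \<oplus>\<^bsub>N\<^esub> n')) t =
        tensor_lift K P (\<lambda>l m. b l m n) t \<oplus>\<^bsub>P\<^esub> tensor_lift K P (\<lambda>l m. b l m n') t"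
    proof (rule tensor_linear_ext[OF assms(1,2,4) _ _ _ t])
      show "tensor_lift K P (\<lambda>l m. b l m (n \<oplus>\<^bsub>N\<^esub> n')) \<in> lin (L \<boxtimes> M) P"
        using lift n by simp
      show "(\<lambda>t. tensor_lift K P (\<lambda>l m. b l m n) t \<oplus>\<^bsub>P\<^esub> tensor_lift K P (\<lambda>l m. b l m n') t)
          \<in> lin (L \<boxtimes> M) P"
        using lift n assms by (intro linear_maps_add_maps) auto
    qed (use n in \<open>simp add: lift_pure linear_maps_add[OF lin]\<close>)
  next
    fix a n assume a: "a \<in> carrier K" and n: "n \<in> carrier N"
    have smult: "(\<lambda>x. a \<odot>\<^bsub>P\<^esub> x) \<in> lin P P"
      using a by (intro linear_mapsI)
        (simp_all add: P.smult_r_distr P.smult_assoc1[symmetric] K.m_comm)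
    show "tensor_lift K P (\<lambda>l m. b l m (a \<odot>\<^bsub>N\<^esub> n)) t = a \<odot>\<^bsub>P\<^esub> tensor_lift K P (\<lambda>l m. b l m n) t"
    proof (rule tensor_linear_ext[OF assms(1,2,4) _ _ _ t])
      show "tensor_lift K P (\<lambda>l m. b l m (a \<odot>\<^bsub>N\<^esub> n)) \<in> lin (L \<boxtimes> M) P"
        using lift n a by simp
      show "(\<lambda>t. a \<odot>\<^bsub>P\<^esub> tensor_lift K P (\<lambda>l m. b l m n) t) \<in> lin (L \<boxtimes> M) P"
        by (rule linear_maps_compose[OF lift smult]) fact
    qed (use n a in \<open>simp add: lift_pure linear_maps_smult[OF lin]\<close>)
  qed
  then show ?thesis using lift by (simp add: bilinear_def)
qed

text \<open>The previous lemma with the factors permuted: \<open>M\<close> and \<open>N\<close> are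
  lifted, \<open>L\<close> is the remaining variable, and bilinearity is symmetric in its two
  arguments.\<close>

lemma bilinear_lift_right:
  assumes "module K L" "module K M" "module K N" "module K P"
    and bil: "\<And>l. l \<in> carrier L \<Longrightarrow> bilinear M N P (b l)"
    and lin: "\<And>m n. \<lbrakk>m \<in> carrier M; n \<in> carrier N\<rbrakk> \<Longrightarrow> (\<lambda>l. b l m n) \<in> lin L P"
  shows "bilinear L (M \<boxtimes> N) P (\<lambda>l. tensor_lift K P (b l))"
  using bilinear_lift_left[OF assms(2,3,1,4), of "\<lambda>m n l. b l m n"] assms(5,6)
  by (simp add: bilinear_def)

lemma tensor_assoc:
  assumes "module K L" "module K M" "module K N"
  shows tensor_assoc_linear [intro]: "tassoc L M N \<in> lin ((L \<boxtimes> M) \<boxtimes> N) (L \<boxtimes> (M \<boxtimes> N))"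
    and tensor_assoc_pure: "\<lbrakk>l \<in> carrier L; m \<in> carrier M; n \<in> carrier N\<rbrakk> \<Longrightarrow>
      tassoc L M N (pure (L \<boxtimes> M) N (pure L M l m) n) = pure L (M \<boxtimes> N) l (pure M N m n)"
proof -
  let ?b = "\<lambda>l m n. pure L (M \<boxtimes> N) l (pure M N m n)"
  note LMN = module_tensor[OF assms(1) module_tensor[OF assms(2,3)]]
  have bil: "bilinear L M (L \<boxtimes> (M \<boxtimes> N)) (\<lambda>l m. ?b l m n)" if "n \<in> carrier N" for n
    unfolding bilinear_def
  proof (intro conjI ballI)
    fix m assume "m \<in> carrier M"
    then show "(\<lambda>l. ?b l m n) \<in> lin L (L \<boxtimes> (M \<boxtimes> N))"
      using assms that by (intro pure_tensor_linear_left) auto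
  next
    fix l assume "l \<in> carrier L"
    then show "(\<lambda>m. ?b l m n) \<in> lin M (L \<boxtimes> (M \<boxtimes> N))"
      using assms that
      by (intro linear_maps_compose[OF pure_tensor_linear_left pure_tensor_linear_right]) auto
  qed
  have lin: "?b l m \<in> lin N (L \<boxtimes> (M \<boxtimes> N))" if "l \<in> carrier L" "m \<in> carrier M" for l m
    using assms that
    by (intro linear_maps_compose[OF pure_tensor_linear_right pure_tensor_linear_right]) auto
  note b = module_tensor[OF assms(1,2)] assms(3) LMN bilinear_lift_left[OF assms LMN bil lin]
  show "tassoc L M N \<in> lin ((L \<boxtimes> M) \<boxtimes> N) (L \<boxtimes> (M \<boxtimes> N))"
    unfolding tensor_assoc_def by (rule tensor_lift_linear[OF b])
  show "tassoc L M N (pure (L \<boxtimes> M) N (pure L M l m) n) = pure L (M \<boxtimes> N) l (pure M N m n)"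
    if "l \<in> carrier L" "m \<in> carrier M" "n \<in> carrier N"
    unfolding tensor_assoc_def using assms that
    by (simp add: tensor_lift_pure[OF b] tensor_lift_pure[OF assms(1,2) LMN bil])
qed

text \<open>The inverse of \<open>tassoc\<close>, given by the universal property of the other
  bracketing. It makes \<open>tassoc\<close> injective and later brings I \<otimes> \<Delta> into
  the bracketing that a coaction requires.\<close>

definition tensor_assoc_inv ::
  "('k, 'l) module \<Rightarrow> ('k, 'm) module \<Rightarrow> ('k, 'n) module \<Rightarrow>
    ('k, 'l, ('k, 'm, 'n) tensor) tensor \<Rightarrow> ('k, ('k, 'l, 'm) tensor, 'n) tensor"
  where "tensor_assoc_inv L M N =
    tensor_lift K ((L \<boxtimes> M) \<boxtimes> N) (\<lambda>l.
      tensor_lift K ((L \<boxtimes> M) \<boxtimes> N) (\<lambda>m n. pure (L \<boxtimes> M) N (pure L M l m) n))"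

lemma tensor_assoc_inv:
  assumes "module K L" "module K M" "module K N"
  shows tensor_assoc_inv_linear [intro]: "tensor_assoc_inv L M N \<in> lin (L \<boxtimes> (M \<boxtimes> N)) ((L \<boxtimes> M) \<boxtimes> N)"
    and tensor_assoc_inv_pure: "\<lbrakk>l \<in> carrier L; m \<in> carrier M; n \<in> carrier N\<rbrakk> \<Longrightarrow>
      tensor_assoc_inv L M N (pure L (M \<boxtimes> N) l (pure M N m n)) = pure (L \<boxtimes> M) N (pure L M l m) n"
proof -
  let ?b = "\<lambda>l m n. pure (L \<boxtimes> M) N (pure L M l m) n"
  note LMN = module_tensor[OF module_tensor[OF assms(1,2)] assms(3)]
  have bil: "bilinear M N ((L \<boxtimes> M) \<boxtimes> N) (?b l)" if "l \<in> carrier L" for l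
    unfolding bilinear_def
  proof (intro conjI ballI)
    fix m assume "m \<in> carrier M"
    then show "?b l m \<in> lin N ((L \<boxtimes> M) \<boxtimes> N)"
      using assms that by (intro pure_tensor_linear_right) auto
  next
    fix n assume "n \<in> carrier N"
    then show "(\<lambda>m. ?b l m n) \<in> lin M ((L \<boxtimes> M) \<boxtimes> N)"
      using assms that
      by (intro linear_maps_compose[OF pure_tensor_linear_right pure_tensor_linear_left]) auto
  qed
  have lin: "(\<lambda>l. ?b l m n) \<in> lin L ((L \<boxtimes> M) \<boxtimes> N)" if "m \<in> carrier M" "n \<in> carrier N" for m n
    using assms that
    by (intro linear_maps_compose[OF pure_tensor_linear_left pure_tensor_linear_left]) auto
  note b = assms(1) module_tensor[OF assms(2,3)] LMN bilinear_lift_right[OF assms LMN bil lin]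
  show "tensor_assoc_inv L M N \<in> lin (L \<boxtimes> (M \<boxtimes> N)) ((L \<boxtimes> M) \<boxtimes> N)"
    unfolding tensor_assoc_inv_def by (rule tensor_lift_linear[OF b])
  show "tensor_assoc_inv L M N (pure L (M \<boxtimes> N) l (pure M N m n)) = pure (L \<boxtimes> M) N (pure L M l m) n"
    if "l \<in> carrier L" "m \<in> carrier M" "n \<in> carrier N"
    unfolding tensor_assoc_inv_def using assms that
    by (simp add: tensor_lift_pure[OF b] tensor_lift_pure[OF assms(2,3) LMN bil])
qed

lemma tensor_assoc_inverse:
  assumes "module K L" "module K M" "module K N"
  shows tensor_assoc_inv_left: "t \<in> carrier ((L \<boxtimes> M) \<boxtimes> N) \<Longrightarrow>
      tensor_assoc_inv L M N (tassoc L M N t) = t"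
    and tensor_assoc_inv_right: "s \<in> carrier (L \<boxtimes> (M \<boxtimes> N)) \<Longrightarrow>
      tassoc L M N (tensor_assoc_inv L M N s) = s"
proof -
  show "tensor_assoc_inv L M N (tassoc L M N t) = t" if "t \<in> carrier ((L \<boxtimes> M) \<boxtimes> N)"
    by (rule tensor_linear_ext_left[OF assms _ linear_maps_compose[OF tensor_assoc_linear tensor_assoc_inv_linear]
          linear_maps_id _ that])
      (use assms in \<open>simp_all add: tensor_assoc_pure tensor_assoc_inv_pure\<close>)
  show "tassoc L M N (tensor_assoc_inv L M N s) = s" if "s \<in> carrier (L \<boxtimes> (M \<boxtimes> N))"
    by (rule tensor_linear_ext_right[OF assms _ linear_maps_compose[OF tensor_assoc_inv_linear tensor_assoc_linear]
          linear_maps_id _ that])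
      (use assms in \<open>simp_all add: tensor_assoc_pure tensor_assoc_inv_pure\<close>)
qed

lemma tensor_assoc_natural:
  assumes "module K L" "module K M" "module K N" "module K L'" "module K M'" "module K N'"
    and f: "f \<in> lin L L'" and g: "g \<in> lin M M'" and h: "h \<in> lin N N'"
    and t: "t \<in> carrier ((L \<boxtimes> M) \<boxtimes> N)"
  shows "tassoc L' M' N' (tmap (L' \<boxtimes> M') N' (tmap L' M' f g) h t) =
    tmap L' (M' \<boxtimes> N') f (tmap M' N' g h) (tassoc L M N t)"
proof (rule tensor_linear_ext_left[OF assms(1-3) _ _ _ _ t])
  show "(\<lambda>t. tassoc L' M' N' (tmap (L' \<boxtimes> M') N' (tmap L' M' f g) h t)) \<in>
      lin ((L \<boxtimes> M) \<boxtimes> N) (L' \<boxtimes> (M' \<boxtimes> N'))"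
    by (rule linear_maps_compose[OF tensor_map_linear tensor_assoc_linear]) (use assms in auto)
  show "(\<lambda>t. tmap L' (M' \<boxtimes> N') f (tmap M' N' g h) (tassoc L M N t)) \<in>
      lin ((L \<boxtimes> M) \<boxtimes> N) (L' \<boxtimes> (M' \<boxtimes> N'))"
    by (rule linear_maps_compose[OF tensor_assoc_linear tensor_map_linear]) (use assms in auto)
qed (use assms in \<open>simp_all add: tensor_map_pure[where M = "_ \<boxtimes> _"] tensor_map_pure tensor_assoc_pure
    tensor_map_linear linear_maps_closed[OF f] linear_maps_closed[OF g] linear_maps_closed[OF h]\<close>)

text \<open>The pentagon identity: the two ways of moving all brackets to the right agree on ((a
  \<otimes> b) \<otimes> c) \<otimes> d, and these elements generate. It turns identities about
  iterated coactions into identities inside the second factor.\<close>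

lemma tensor_assoc_pentagon:
  assumes "module K A" "module K B" "module K C" "module K D"
    and t: "t \<in> carrier (((A \<boxtimes> B) \<boxtimes> C) \<boxtimes> D)"
  shows "tassoc A B (C \<boxtimes> D) (tassoc (A \<boxtimes> B) C D t) =
    tmap A (B \<boxtimes> (C \<boxtimes> D)) (\<lambda>x. x) (tassoc B C D)
      (tassoc A (B \<boxtimes> C) D (tmap (A \<boxtimes> (B \<boxtimes> C)) D (tassoc A B C) (\<lambda>x. x) t))"
    (is "?f t = ?g t")
proof -
  have f: "?f \<in> lin (((A \<boxtimes> B) \<boxtimes> C) \<boxtimes> D) (A \<boxtimes> (B \<boxtimes> (C \<boxtimes> D)))"
    by (rule linear_maps_compose[OF tensor_assoc_linear tensor_assoc_linear]) (use assms in auto)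
  have g: "?g \<in> lin (((A \<boxtimes> B) \<boxtimes> C) \<boxtimes> D) (A \<boxtimes> (B \<boxtimes> (C \<boxtimes> D)))"
    by (rule linear_maps_compose[OF linear_maps_compose[OF tensor_map_linear tensor_assoc_linear] tensor_map_linear])
      (use assms linear_maps_id in auto)
  show ?thesis
  proof (rule tensor_linear_ext[OF _ _ _ f g _ t])
    fix s d assume s: "s \<in> carrier ((A \<boxtimes> B) \<boxtimes> C)" and d: "d \<in> carrier D"
    note p = pure_tensor_linear_left[OF _ assms(4) d, of "(A \<boxtimes> B) \<boxtimes> C"]
    show "?f (pure ((A \<boxtimes> B) \<boxtimes> C) D s d) = ?g (pure ((A \<boxtimes> B) \<boxtimes> C) D s d)"
      by (rule tensor_linear_ext_left[OF assms(1-3) _ linear_maps_compose[OF p f] linear_maps_compose[OF p g] _ s])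
        (use assms d in \<open>simp_all add: tensor_assoc_pure[where L = "_ \<boxtimes> _"] tensor_assoc_pure
          tensor_map_pure[where M = "_ \<boxtimes> (_ \<boxtimes> _)"] tensor_map_pure[where N = "_ \<boxtimes> _"]
          tensor_map_pure tensor_assoc_linear linear_maps_id\<close>)
  qed (use assms in simp_all)
qed

end

section \<open>Direct sums\<close>

lemma direct_sum_simps [simp]:
  "carrier (direct_sum M N) = carrier M \<times> carrier N"
  "\<zero>\<^bsub>direct_sum M N\<^esub> = (\<zero>\<^bsub>M\<^esub>, \<zero>\<^bsub>N\<^esub>)"
  "(x, y) \<oplus>\<^bsub>direct_sum M N\<^esub> (x', y') = (x \<oplus>\<^bsub>M\<^esub> x', y \<oplus>\<^bsub>N\<^esub> y')"
  "a \<odot>\<^bsub>direct_sum M N\<^esub> (x, y) = (a \<odot>\<^bsub>M\<^esub> x, a \<odot>\<^bsub>N\<^esub> y)"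
  by (simp_all add: direct_sum_def)

lemma module_direct_sum [simp, intro]:
  fixes K :: "'k ring"
  assumes "module K M" "module K N"
  shows "module K (direct_sum M N)"
proof -
  interpret M: module K M by fact
  interpret N: module K N by fact
  show ?thesis
  proof (rule moduleI)
    show "cring K" by (rule M.R.cring_axioms)
    show "abelian_group (direct_sum M N)"
    proof (rule abelian_groupI)
      fix z assume "z \<in> carrier (direct_sum M N)"
      then obtain x y where z: "z = (x, y)" "x \<in> carrier M" "y \<in> carrier N" by auto
      show "\<exists>u\<in>carrier (direct_sum M N). u \<oplus>\<^bsub>direct_sum M N\<^esub> z = \<zero>\<^bsub>direct_sum M N\<^esub>"
        by (rule bexI[of _ "(\<ominus>\<^bsub>M\<^esub> x, \<ominus>\<^bsub>N\<^esub> y)"]) (use z in \<open>auto simp: M.M.l_neg N.M.l_neg\<close>)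
    qed (auto simp: M.M.a_ac N.M.a_ac)
  qed (auto simp: M.smult_l_distr M.smult_r_distr M.smult_assoc1
      N.smult_l_distr N.smult_r_distr N.smult_assoc1)
qed

lemma direct_sum_linear:
  fixes K :: "'k ring"
  assumes "module K M" "module K N"
  shows direct_sum_fst: "fst \<in> linear_maps K (direct_sum M N) M"
    and direct_sum_snd: "snd \<in> linear_maps K (direct_sum M N) N"
    and direct_sum_inl: "(\<lambda>x. (x, \<zero>\<^bsub>N\<^esub>)) \<in> linear_maps K M (direct_sum M N)"
    and direct_sum_inr: "(\<lambda>y. (\<zero>\<^bsub>M\<^esub>, y)) \<in> linear_maps K N (direct_sum M N)"
proof -
  interpret M: module K M by fact
  interpret N: module K N by fact
  show "fst \<in> linear_maps K (direct_sum M N) M" "snd \<in> linear_maps K (direct_sum M N) N"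
    "(\<lambda>x. (x, \<zero>\<^bsub>N\<^esub>)) \<in> linear_maps K M (direct_sum M N)"
    "(\<lambda>y. (\<zero>\<^bsub>M\<^esub>, y)) \<in> linear_maps K N (direct_sum M N)"
    by (auto intro!: linear_mapsI)
qed

lemma direct_sum_pair:
  assumes "f \<in> linear_maps K M P" "g \<in> linear_maps K M Q"
  shows "(\<lambda>x. (f x, g x)) \<in> linear_maps K M (direct_sum P Q)"
  by (rule linear_mapsI) (use assms in \<open>auto simp: linear_maps_def\<close>)

lemma linear_maps_restrict:
  "f \<in> linear_maps K M N \<Longrightarrow> S \<subseteq> carrier M \<Longrightarrow> f ` S \<subseteq> T \<Longrightarrow>
    f \<in> linear_maps K (M\<lparr>carrier := S\<rparr>) (N\<lparr>carrier := T\<rparr>)"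
  by (auto simp: linear_maps_def subset_iff image_subset_iff)

context base_field
begin

section \<open>The ground field as a unit for the tensor product\<close>

lemma carrier_ground [simp]: "carrier (ground K) = carrier K"
  by (simp add: ground_def)

lemma module_ground [simp]: "module K (ground K)"
proof (rule moduleI)
  show "cring K" by (rule K.cring_axioms)
  show "abelian_group (ground K)"
  proof (rule abelian_groupI)
    fix a assume "a \<in> carrier (ground K)"
    then show "\<exists>b\<in>carrier (ground K). b \<oplus>\<^bsub>ground K\<^esub> a = \<zero>\<^bsub>ground K\<^esub>"
      by (intro bexI[of _ "\<ominus>\<^bsub>K\<^esub> a"]) (auto simp: ground_def K.l_neg)
  qed (auto simp: ground_def K.a_ac)
qed (auto simp: ground_def K.l_distr K.r_distr K.m_assoc)

lemma tensor_unit_right: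
  assumes "module K M"
  shows tensor_unit_right_linear: "tensor_unit_right K M \<in> lin (M \<boxtimes> ground K) M"
    and tensor_unit_right_pure: "\<lbrakk>x \<in> carrier M; a \<in> carrier K\<rbrakk> \<Longrightarrow>
      tensor_unit_right K M (pure M (ground K) x a) = a \<odot>\<^bsub>M\<^esub> x"
proof -
  interpret M: module K M by fact
  have "bilinear M (ground K) M (\<lambda>x a. a \<odot>\<^bsub>M\<^esub> x)"
    unfolding bilinear_def
    by (auto intro!: linear_mapsI simp: ground_def M.smult_r_distr M.smult_l_distr
        M.smult_assoc1[symmetric] K.m_comm)
  note lift = tensor_lift[OF assms module_ground assms this]
  show "tensor_unit_right K M \<in> lin (M \<boxtimes> ground K) M"
    unfolding tensor_unit_right_def by (rule lift(1))
  show "tensor_unit_right K M (pure M (ground K) x a) = a \<odot>\<^bsub>M\<^esub> x"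
    if "x \<in> carrier M" "a \<in> carrier K"
    unfolding tensor_unit_right_def using that by (simp add: lift(2))
qed

lemma tensor_unit_right_natural:
  assumes "module K M" "module K N" and f: "f \<in> lin M N" and t: "t \<in> carrier (M \<boxtimes> ground K)"
  shows "f (tensor_unit_right K M t) = tensor_unit_right K N (tmap N (ground K) f (\<lambda>a. a) t)"
proof (rule tensor_linear_ext[OF assms(1) module_ground assms(2) _ _ _ t])
  show "(\<lambda>t. f (tensor_unit_right K M t)) \<in> lin (M \<boxtimes> ground K) N"
    by (rule linear_maps_compose[OF tensor_unit_right_linear f]) fact
  show "(\<lambda>t. tensor_unit_right K N (tmap N (ground K) f (\<lambda>a. a) t)) \<in> lin (M \<boxtimes> ground K) N"
    by (rule linear_maps_compose[OF tensor_map_linear tensor_unit_right_linear])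
      (use assms linear_maps_id in auto)
qed (use assms in \<open>simp add: tensor_map_pure linear_maps_id tensor_unit_right_pure
    linear_maps_closed[OF f] linear_maps_smult[OF f]\<close>)

text \<open>A scalar acting on M \<otimes> N may be moved to the factor \<open>N\<close>. This
  coherence reduces the counit law of a cofree comodule to that of the coalgebra.\<close>

lemma tensor_unit_right_tensor:
  assumes "module K M" "module K N" and t: "t \<in> carrier ((M \<boxtimes> N) \<boxtimes> ground K)"
  shows "tensor_unit_right K (M \<boxtimes> N) t =
    tmap M N (\<lambda>x. x) (tensor_unit_right K N) (tassoc M N (ground K) t)"
proof (rule tensor_linear_ext_left[OF assms(1,2) module_ground module_tensor[OF assms(1,2)] _ _ _ t])
  show "tensor_unit_right K (M \<boxtimes> N) \<in> lin ((M \<boxtimes> N) \<boxtimes> ground K) (M \<boxtimes> N)"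
    using assms by (simp add: tensor_unit_right_linear)
  show "(\<lambda>t. tmap M N (\<lambda>x. x) (tensor_unit_right K N) (tassoc M N (ground K) t)) \<in>
      lin ((M \<boxtimes> N) \<boxtimes> ground K) (M \<boxtimes> N)"
    by (rule linear_maps_compose[OF tensor_assoc_linear tensor_map_linear])
      (use assms linear_maps_id tensor_unit_right_linear in auto)
qed (use assms in \<open>simp add: tensor_unit_right_pure tensor_assoc_pure tensor_map_pure[where N = "N \<boxtimes> ground K"]
    linear_maps_id tensor_unit_right_linear pure_tensor_smult_right\<close>)

section \<open>Complements and exactness of the tensor product\<close>

lemma image_submodule:
  assumes "module K M" "module K N" "f \<in> lin M N"
  shows "submodule (f ` carrier M) K N"
proof -
  interpret M: module K M by fact
  interpret N: module K N by fact
  note closed = linear_maps_closed[OF assms(3)]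
  have f0: "f \<zero>\<^bsub>M\<^esub> = \<zero>\<^bsub>N\<^esub>" using linear_maps_zero assms .
  show ?thesis
  proof (rule N.submoduleI)
    show "\<zero>\<^bsub>N\<^esub> \<in> f ` carrier M" using f0 by (metis M.M.zero_closed imageI)
    fix y assume "y \<in> f ` carrier M"
    then obtain x where x: "x \<in> carrier M" "y = f x" by blast
    have "\<ominus>\<^bsub>N\<^esub> y = f (\<ominus>\<^bsub>M\<^esub> x)"
      using linear_maps_minus[OF assms M.M.zero_closed x(1)] x closed[OF x(1)] f0
      by (simp add: a_minus_def)
    then show "\<ominus>\<^bsub>N\<^esub> y \<in> f ` carrier M" using x by auto
  qed (use closed in \<open>auto simp: linear_maps_add[OF assms(3), symmetric] linear_maps_smult[OF assms(3), symmetric]\<close>)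
qed

lemma submodule_diff_closed:
  assumes "module K M" "submodule S K M" "x \<in> S" "y \<in> S"
  shows "x \<ominus>\<^bsub>M\<^esub> y \<in> S"
  using module.submoduleE(3,5)[OF assms(1,2)] assms(3,4) by (simp add: a_minus_def)

text \<open>By Zorn there is a submodule \<open>T\<close> maximal among those meeting
  \<open>S\<close> trivially. If \<open>x\<close> were outside S + T, adjoining the line through
  \<open>x\<close> would keep the intersection trivial, because nonzero scalars are
  invertible.\<close>

lemma submodule_complement:
  assumes "module K M" "submodule S K M"
  obtains T where "submodule T K M" "S \<inter> T = {\<zero>\<^bsub>M\<^esub>}"
    "\<And>x. x \<in> carrier M \<Longrightarrow> \<exists>s\<in>S. \<exists>t\<in>T. x = s \<oplus>\<^bsub>M\<^esub> t"
proof -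
  interpret M: module K M by fact
  note S = M.submoduleE[OF assms(2)] submodule_zero_closed[OF assms(2)]
  define \<A> where "\<A> = {T. submodule T K M \<and> S \<inter> T = {\<zero>\<^bsub>M\<^esub>}}"
  have "\<exists>T\<in>\<A>. \<forall>X\<in>\<A>. T \<subseteq> X \<longrightarrow> X = T"
  proof (rule subset_Zorn_nonempty)
    have "submodule {\<zero>\<^bsub>M\<^esub>} K M" by (rule M.submoduleI) auto
    then have "{\<zero>\<^bsub>M\<^esub>} \<in> \<A>" using S by (auto simp: \<A>_def)
    then show "\<A> \<noteq> {}" by blast
  next
    fix \<C> assume ne: "\<C> \<noteq> {}" and chain: "subset.chain \<A> \<C>"
    then have sub: "\<And>T. T \<in> \<C> \<Longrightarrow> submodule T K M" "\<And>T. T \<in> \<C> \<Longrightarrow> S \<inter> T = {\<zero>\<^bsub>M\<^esub>}"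
      by (auto simp: subset.chain_def \<A>_def)
    have "submodule (\<Union>\<C>) K M"
    proof (rule M.submoduleI)
      fix x y assume "x \<in> \<Union>\<C>" "y \<in> \<Union>\<C>"
      then obtain X Y where XY: "X \<in> \<C>" "Y \<in> \<C>" "x \<in> X" "y \<in> Y" by blast
      moreover have "X \<subseteq> Y \<or> Y \<subseteq> X" using chain XY by (auto simp: subset.chain_def)
      ultimately show "x \<oplus>\<^bsub>M\<^esub> y \<in> \<Union>\<C>"
        using M.submoduleE(5)[OF sub(1)] by blast
    next
      show "\<zero>\<^bsub>M\<^esub> \<in> \<Union>\<C>" using ne submodule_zero_closed[OF sub(1)] by blast
    qed (use M.submoduleE[OF sub(1)] in blast)+
    moreover have "S \<inter> \<Union>\<C> = {\<zero>\<^bsub>M\<^esub>}" using sub(2) ne by blast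
    ultimately show "\<Union>\<C> \<in> \<A>" by (simp add: \<A>_def)
  qed
  then obtain T where "T \<in> \<A>" and "\<forall>X\<in>\<A>. T \<subseteq> X \<longrightarrow> X = T" ..
  then have T: "submodule T K M" "S \<inter> T = {\<zero>\<^bsub>M\<^esub>}"
    and max: "\<And>X. \<lbrakk>submodule X K M; S \<inter> X = {\<zero>\<^bsub>M\<^esub>}; T \<subseteq> X\<rbrakk> \<Longrightarrow> X = T"
    by (simp_all add: \<A>_def)
  note T' = M.submoduleE[OF T(1)] submodule_zero_closed[OF T(1)]
  have "\<exists>s\<in>S. \<exists>t\<in>T. x = s \<oplus>\<^bsub>M\<^esub> t" if x: "x \<in> carrier M" for x
  proof (rule ccontr)
    assume no: "\<not> (\<exists>s\<in>S. \<exists>t\<in>T. x = s \<oplus>\<^bsub>M\<^esub> t)"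
    \<comment> \<open>\<open>T\<close> enlarged by the line through \<open>x\<close>: the candidate
      that contradicts maximality.\<close>
    define X where "X = {t \<oplus>\<^bsub>M\<^esub> a \<odot>\<^bsub>M\<^esub> x | t a. t \<in> T \<and> a \<in> carrier K}"
    have XI: "t \<oplus>\<^bsub>M\<^esub> a \<odot>\<^bsub>M\<^esub> x \<in> X" if "t \<in> T" "a \<in> carrier K" for t a
      using that by (auto simp: X_def)
    have inT: "t \<in> carrier M" if "t \<in> T" for t using that T' by blast
    have "submodule X K M"
    proof (rule M.submoduleI)
      show "X \<subseteq> carrier M" using T' x by (auto simp: X_def)
      show "\<zero>\<^bsub>M\<^esub> \<in> X" using XI[of "\<zero>\<^bsub>M\<^esub>" "\<zero>\<^bsub>K\<^esub>"] T' x by simp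
      fix y assume "y \<in> X"
      then obtain t a where y: "y = t \<oplus>\<^bsub>M\<^esub> a \<odot>\<^bsub>M\<^esub> x" "t \<in> T" "a \<in> carrier K" by (auto simp: X_def)
      then show "\<ominus>\<^bsub>M\<^esub> y \<in> X"
        using XI[of "\<ominus>\<^bsub>M\<^esub> t" "\<ominus>\<^bsub>K\<^esub> a"] T' x by (simp add: inT M.smult_l_minus M.M.minus_add)
      show "b \<odot>\<^bsub>M\<^esub> y \<in> X" if "b \<in> carrier K" for b
        using XI[of "b \<odot>\<^bsub>M\<^esub> t" "b \<otimes>\<^bsub>K\<^esub> a"] T' x y that
        by (simp add: inT M.smult_r_distr M.smult_assoc1)
      fix z assume "z \<in> X"
      then obtain u b where z: "z = u \<oplus>\<^bsub>M\<^esub> b \<odot>\<^bsub>M\<^esub> x" "u \<in> T" "b \<in> carrier K" by (auto simp: X_def)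
      show "y \<oplus>\<^bsub>M\<^esub> z \<in> X"
        using XI[of "t \<oplus>\<^bsub>M\<^esub> u" "a \<oplus>\<^bsub>K\<^esub> b"] T' x y z
        by (simp add: inT M.smult_l_distr M.M.a_ac)
    qed
    moreover have "S \<inter> X = {\<zero>\<^bsub>M\<^esub>}"
    proof (intro equalityI subsetI)
      fix s assume "s \<in> S \<inter> X"
      then obtain t a where s: "s \<in> S" "s = t \<oplus>\<^bsub>M\<^esub> a \<odot>\<^bsub>M\<^esub> x" "t \<in> T" "a \<in> carrier K"
        by (auto simp: X_def)
      show "s \<in> {\<zero>\<^bsub>M\<^esub>}"
      proof (cases "a = \<zero>\<^bsub>K\<^esub>")
        case True
        then show ?thesis using s x T(2) inT[OF s(3)] by auto
      next
        \<comment> \<open>A nonzero coefficient can be divided out of s = t + a x, which puts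
          \<open>x\<close> into S + T against the assumption.\<close>
        case False
        then have a: "inv\<^bsub>K\<^esub> a \<in> carrier K" "inv\<^bsub>K\<^esub> a \<otimes>\<^bsub>K\<^esub> a = \<one>\<^bsub>K\<^esub>"
          using s(4) by (auto simp: K.field_Units)
        have "s \<oplus>\<^bsub>M\<^esub> \<ominus>\<^bsub>M\<^esub> t = a \<odot>\<^bsub>M\<^esub> x"
          using s x inT[OF s(3)] by (simp add: M.M.a_ac M.M.r_neg1 M.M.r_neg2)
        then have "x = inv\<^bsub>K\<^esub> a \<odot>\<^bsub>M\<^esub> (s \<oplus>\<^bsub>M\<^esub> \<ominus>\<^bsub>M\<^esub> t)"
          using a s(4) x by (simp add: M.smult_assoc1[symmetric])
        also have "\<dots> = inv\<^bsub>K\<^esub> a \<odot>\<^bsub>M\<^esub> s \<oplus>\<^bsub>M\<^esub> inv\<^bsub>K\<^esub> a \<odot>\<^bsub>M\<^esub> (\<ominus>\<^bsub>M\<^esub> t)"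
          using a s(1) S(1) inT[OF s(3)] by (intro M.smult_r_distr) auto
        finally show ?thesis using no a s(1,3) S(4) T'(3,4) by blast
      qed
    qed (use S submodule_zero_closed[OF \<open>submodule X K M\<close>] in auto)
    moreover have "T \<subseteq> X"
    proof
      fix t assume "t \<in> T"
      then show "t \<in> X" using XI[of t "\<zero>\<^bsub>K\<^esub>"] x inT[of t] by simp
    qed
    ultimately have "X = T" by (rule max)
    then have "x \<in> T" using XI[of "\<zero>\<^bsub>M\<^esub>" "\<one>\<^bsub>K\<^esub>"] T' x by simp
    then show False using no S x by force
  qed
  then show thesis using that T by blast
qed

text \<open>With \<open>T\<close> a complement of the kernel and \<open>U\<close> a complement of
  the image, \<open>f\<close> maps \<open>T\<close> bijectively onto the image; \<open>p\<close>
  inverts this bijection and vanishes on \<open>U\<close>. In one formula, p y is the only t in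
  \<open>T\<close> with y - f t in \<open>U\<close>.\<close>

lemma pseudo_inverse:
  assumes "module K M" "module K P" "f \<in> lin M P"
  obtains p where "p \<in> lin P M" "\<And>m. m \<in> carrier M \<Longrightarrow> f (p (f m)) = f m"
proof -
  interpret M: module K M by fact
  interpret P: module K P by fact
  note f = linear_maps_closed[OF assms(3)]
  obtain T where T: "submodule T K M" "{x \<in> carrier M. f x = \<zero>\<^bsub>P\<^esub>} \<inter> T = {\<zero>\<^bsub>M\<^esub>}"
    "\<And>x. x \<in> carrier M \<Longrightarrow> \<exists>s\<in>{x \<in> carrier M. f x = \<zero>\<^bsub>P\<^esub>}. \<exists>t\<in>T. x = s \<oplus>\<^bsub>M\<^esub> t"
    using submodule_complement[OF assms(1) kernel_submodule[OF assms]] by blast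
  obtain U where U: "submodule U K P" "f ` carrier M \<inter> U = {\<zero>\<^bsub>P\<^esub>}"
    "\<And>y. y \<in> carrier P \<Longrightarrow> \<exists>s\<in>f ` carrier M. \<exists>u\<in>U. y = s \<oplus>\<^bsub>P\<^esub> u"
    using submodule_complement[OF assms(2) image_submodule[OF assms]] by blast
  note T' = M.submoduleE[OF T(1)] and U' = P.submoduleE[OF U(1)]
  have ex: "\<exists>t\<in>T. y \<ominus>\<^bsub>P\<^esub> f t \<in> U" if yP: "y \<in> carrier P" for y
  proof -
    obtain m u where y: "m \<in> carrier M" "u \<in> U" "y = f m \<oplus>\<^bsub>P\<^esub> u" using U(3)[OF yP] by blast
    obtain s t where m: "s \<in> carrier M" "f s = \<zero>\<^bsub>P\<^esub>" "t \<in> T" "m = s \<oplus>\<^bsub>M\<^esub> t" using T(3)[OF y(1)] by blast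
    have tu: "t \<in> carrier M" "u \<in> carrier P" using T'(1) U'(1) m(3) y(2) by auto
    then have "y = u \<oplus>\<^bsub>P\<^esub> f t" using m y f by (simp add: linear_maps_add[OF assms(3)] P.M.a_comm)
    then have "y \<ominus>\<^bsub>P\<^esub> f t = u" using tu f by (simp add: a_minus_def P.M.a_assoc P.M.r_neg)
    then show ?thesis using m(3) y(2) by metis
  qed
  \<comment> \<open>f t - f t' lies in the image and in \<open>U\<close>, so it is zero; then t - t'
    lies in the kernel and in \<open>T\<close>, so it is zero. Linearity of \<open>p\<close>
    follows, since sums and multiples of witnesses are witnesses.\<close>
  have unique: "t = t'"
    if "y \<in> carrier P" "t \<in> T" "t' \<in> T" "y \<ominus>\<^bsub>P\<^esub> f t \<in> U" "y \<ominus>\<^bsub>P\<^esub> f t' \<in> U" for y t t'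
  proof -
    have c: "t \<in> carrier M" "t' \<in> carrier M" using that(2,3) T'(1) by auto
    have "(y \<ominus>\<^bsub>P\<^esub> f t') \<ominus>\<^bsub>P\<^esub> (y \<ominus>\<^bsub>P\<^esub> f t) = f t \<ominus>\<^bsub>P\<^esub> f t'"
      using c f that(1) by (simp add: a_minus_def P.M.minus_add P.M.a_ac P.M.r_neg1 P.M.r_neg2)
    then have "f (t \<ominus>\<^bsub>M\<^esub> t') \<in> U"
      using submodule_diff_closed[OF assms(2) U(1) that(5,4)] c by (simp add: linear_maps_minus[OF assms])
    then have "f (t \<ominus>\<^bsub>M\<^esub> t') = \<zero>\<^bsub>P\<^esub>" using U(2) c by (blast intro: M.M.minus_closed)
    then have "t \<ominus>\<^bsub>M\<^esub> t' = \<zero>\<^bsub>M\<^esub>"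
      using T(2) submodule_diff_closed[OF assms(1) T(1) that(2,3)] c by (blast intro: M.M.minus_closed)
    then show ?thesis using c by (simp add: module_diff_eq_zero_iff[OF assms(1)])
  qed
  obtain p where p: "\<And>y. y \<in> carrier P \<Longrightarrow> p y \<in> T" "\<And>y. y \<in> carrier P \<Longrightarrow> y \<ominus>\<^bsub>P\<^esub> f (p y) \<in> U"
    using ex by metis
  have pc: "p y \<in> carrier M" if "y \<in> carrier P" for y using p(1)[OF that] T'(1) by blast
  have "p \<in> lin P M"
  proof (rule linear_mapsI)
    fix y z assume yz: "y \<in> carrier P" "z \<in> carrier P"
    have "(y \<oplus>\<^bsub>P\<^esub> z) \<ominus>\<^bsub>P\<^esub> f (p y \<oplus>\<^bsub>M\<^esub> p z) = (y \<ominus>\<^bsub>P\<^esub> f (p y)) \<oplus>\<^bsub>P\<^esub> (z \<ominus>\<^bsub>P\<^esub> f (p z))"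
      using yz pc f by (simp add: linear_maps_add[OF assms(3)] a_minus_def P.M.minus_add P.M.a_ac)
    also have "\<dots> \<in> U" using p(2) yz U'(5) by blast
    finally show "p (y \<oplus>\<^bsub>P\<^esub> z) = p y \<oplus>\<^bsub>M\<^esub> p z"
      using p yz T'(5) by (intro unique[of "y \<oplus>\<^bsub>P\<^esub> z"]) auto
  next
    fix a y assume ay: "a \<in> carrier K" "y \<in> carrier P"
    have "(a \<odot>\<^bsub>P\<^esub> y) \<ominus>\<^bsub>P\<^esub> f (a \<odot>\<^bsub>M\<^esub> p y) = a \<odot>\<^bsub>P\<^esub> (y \<ominus>\<^bsub>P\<^esub> f (p y))"
      using ay pc f by (simp add: linear_maps_smult[OF assms(3)] a_minus_def P.smult_r_distr P.smult_r_minus)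
    also have "\<dots> \<in> U" using p(2) ay U'(4) by blast
    finally show "p (a \<odot>\<^bsub>P\<^esub> y) = a \<odot>\<^bsub>M\<^esub> p y"
      using p ay T'(4) by (intro unique[of "a \<odot>\<^bsub>P\<^esub> y"]) auto
  qed (rule pc)
  moreover have "f (p (f m)) = f m" if "m \<in> carrier M" for m
  proof -
    \<comment> \<open>This difference is in the image by linearity and in \<open>U\<close> by the
      choice of \<open>p\<close>, and the two meet only in zero.\<close>
    have "f m \<ominus>\<^bsub>P\<^esub> f (p (f m)) \<in> f ` carrier M"
      using that f pc by (simp add: linear_maps_minus[OF assms, symmetric] M.M.minus_closed)
    then have "f m \<ominus>\<^bsub>P\<^esub> f (p (f m)) = \<zero>\<^bsub>P\<^esub>" using p(2)[OF f[OF that]] U(2) by blast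
    then show ?thesis using that f pc by (simp add: module_diff_eq_zero_iff[OF assms(2)])
  qed
  ultimately show thesis by (rule that)
qed

lemma submodule_inclusion:
  "module K M \<Longrightarrow> submodule S K M \<Longrightarrow> (\<lambda>x. x) \<in> lin (M\<lparr>carrier := S\<rparr>) M"
  using module.submoduleE(1) by (fastforce simp: linear_maps_def)

text \<open>For \<open>f\<close> the inclusion, f p f = f says that p restricts to the identity on
  \<open>S\<close>. Such a retraction, tensored with the identity of \<open>N\<close>, is a left
  inverse.\<close>

lemma tensor_map_inclusion_inj:
  assumes "module K M" "module K N" "submodule S K M"
  shows "inj_on (tmap M N (\<lambda>x. x) (\<lambda>x. x)) (carrier (M\<lparr>carrier := S\<rparr> \<boxtimes> N))"
proof -
  let ?S = "M\<lparr>carrier := S\<rparr>"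
  have S: "module K ?S" by (rule module_restrict[OF assms(1,3)])
  note incl = submodule_inclusion[OF assms(1,3)]
  obtain r where r: "r \<in> lin M ?S" "\<And>s. s \<in> carrier ?S \<Longrightarrow> r s = s"
    using pseudo_inverse[OF S assms(1) incl] by blast
  have "tmap ?S N r (\<lambda>x. x) (tmap M N (\<lambda>x. x) (\<lambda>x. x) t) = t" if t: "t \<in> carrier (?S \<boxtimes> N)" for t
  proof -
    have "tmap ?S N r (\<lambda>x. x) (tmap M N (\<lambda>x. x) (\<lambda>x. x) t) = tmap ?S N r (\<lambda>x. x) t"
      by (rule tensor_map_compose[OF S assms(2,1,2) S assms(2) incl linear_maps_id r(1) linear_maps_id t])
    also have "\<dots> = tmap ?S N (\<lambda>x. x) (\<lambda>x. x) t"
      by (rule tensor_map_cong[OF S assms(2) S assms(2) linear_maps_id linear_maps_id _ _ t])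
        (simp_all add: r(2))
    also have "\<dots> = t" by (rule tensor_map_id[OF S assms(2) t])
    finally show ?thesis .
  qed
  then show ?thesis by (rule inj_on_inverseI)
qed

text \<open>If f p f = f, then e = I - p f takes values in the kernel of \<open>f\<close>. On
  \<open>z\<close> the correction (p f) \<otimes> I vanishes because f \<otimes> I does, so (e
  \<otimes> I) z is a preimage of \<open>z\<close>.\<close>

lemma tensor_map_kernel:
  assumes "module K M" "module K N" "module K P" "f \<in> lin M P"
    and z: "z \<in> carrier (M \<boxtimes> N)" "tmap P N f (\<lambda>x. x) z = \<zero>\<^bsub>P \<boxtimes> N\<^esub>"
  shows "\<exists>y\<in>carrier (M\<lparr>carrier := {x \<in> carrier M. f x = \<zero>\<^bsub>P\<^esub>}\<rparr> \<boxtimes> N).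
    tmap M N (\<lambda>x. x) (\<lambda>x. x) y = z"
proof -
  let ?E = "M\<lparr>carrier := {x \<in> carrier M. f x = \<zero>\<^bsub>P\<^esub>}\<rparr>"
  note E = kernel_submodule[OF assms(1,3,4)]
  have mE: "module K ?E" by (rule module_restrict[OF assms(1) E])
  interpret MN: module K "M \<boxtimes> N" using assms by simp
  interpret M: module K M by fact
  obtain p where p: "p \<in> lin P M" "\<And>m. m \<in> carrier M \<Longrightarrow> f (p (f m)) = f m"
    using pseudo_inverse[OF assms(1,3,4)] by blast
  note pf = linear_maps_compose[OF assms(4) p(1)]
  define e where "e x = x \<ominus>\<^bsub>M\<^esub> p (f x)" for x
  have e: "e \<in> lin M M"
    unfolding e_def by (rule linear_maps_diff_maps[OF assms(1,1) linear_maps_id pf])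
  have "f (e x) = \<zero>\<^bsub>P\<^esub>" if "x \<in> carrier M" for x
    using that p linear_maps_closed[OF pf] linear_maps_closed[OF assms(4)]
    by (simp add: e_def linear_maps_minus[OF assms(1,3,4)] module_diff_eq_zero_iff[OF assms(3)])
  then have eE: "e \<in> lin M ?E"
    using linear_maps_restrict[OF e subset_refl, of "{x \<in> carrier M. f x = \<zero>\<^bsub>P\<^esub>}"]
      linear_maps_closed[OF e] by (auto simp: image_subset_iff)
  have "tmap M N (\<lambda>x. x) (\<lambda>x. x) (tmap ?E N e (\<lambda>x. x) z) = tmap M N e (\<lambda>x. x) z"
    by (rule tensor_map_compose[OF assms(1,2) mE assms(2,1,2) eE linear_maps_id
          submodule_inclusion[OF assms(1) E] linear_maps_id z(1)])
  also have "\<dots> = tmap M N (\<lambda>x. x) (\<lambda>x. x) z \<ominus>\<^bsub>M \<boxtimes> N\<^esub> tmap M N (\<lambda>x. p (f x)) (\<lambda>x. x) z"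
    unfolding e_def
    by (rule tensor_map_diff_left[OF assms(1,2,1,2) linear_maps_id pf linear_maps_id z(1)])
  also have "tmap M N (\<lambda>x. p (f x)) (\<lambda>x. x) z = tmap M N p (\<lambda>x. x) (tmap P N f (\<lambda>x. x) z)"
    by (rule tensor_map_compose[symmetric, OF assms(1,2,3,2,1,2,4) linear_maps_id p(1) linear_maps_id z(1)])
  also have "\<dots> = \<zero>\<^bsub>M \<boxtimes> N\<^esub>"
    unfolding z(2) using assms p(1) linear_maps_id
    by (intro linear_maps_zero[OF _ _ tensor_map_linear]) auto
  finally have "tmap M N (\<lambda>x. x) (\<lambda>x. x) (tmap ?E N e (\<lambda>x. x) z) = z"
    using z(1) by (simp add: tensor_map_id[OF assms(1,2)] a_minus_def)
  then show ?thesis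
    using tensor_map_closed[OF assms(1,2) mE assms(2) eE linear_maps_id z(1)] by blast
qed

section \<open>Associators, and maps that act on a single tensor factor\<close>

lemma tensor_assoc_closed:
  "\<lbrakk>module K L; module K M; module K N; t \<in> carrier ((L \<boxtimes> M) \<boxtimes> N)\<rbrakk> \<Longrightarrow>
    tassoc L M N t \<in> carrier (L \<boxtimes> (M \<boxtimes> N))"
  using linear_maps_closed[OF tensor_assoc_linear] by blast

lemma tensor_assoc_inv_closed:
  "\<lbrakk>module K L; module K M; module K N; t \<in> carrier (L \<boxtimes> (M \<boxtimes> N))\<rbrakk> \<Longrightarrow>
    tensor_assoc_inv L M N t \<in> carrier ((L \<boxtimes> M) \<boxtimes> N)"
  using linear_maps_closed[OF tensor_assoc_inv_linear] by blast

lemma tensor_assoc_inj: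
  "\<lbrakk>module K L; module K M; module K N\<rbrakk> \<Longrightarrow> inj_on (tassoc L M N) (carrier ((L \<boxtimes> M) \<boxtimes> N))"
  by (rule inj_on_inverseI[where g = "tensor_assoc_inv L M N"]) (rule tensor_assoc_inv_left)

text \<open>General naturality leaves I \<otimes> I on M \<otimes> N, which is the identity only on
  the carrier; \<open>tensor_map_cong\<close> removes it.\<close>

lemma tensor_assoc_natural_left:
  assumes "module K L" "module K M" "module K N" "module K L'"
    and f: "f \<in> lin L L'" and t: "t \<in> carrier ((L \<boxtimes> M) \<boxtimes> N)"
  shows "tassoc L' M N (tmap (L' \<boxtimes> M) N (tmap L' M f (\<lambda>m. m)) (\<lambda>n. n) t) =
    tmap L' (M \<boxtimes> N) f (\<lambda>s. s) (tassoc L M N t)"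
proof -
  have "tassoc L' M N (tmap (L' \<boxtimes> M) N (tmap L' M f (\<lambda>m. m)) (\<lambda>n. n) t) =
      tmap L' (M \<boxtimes> N) f (tmap M N (\<lambda>m. m) (\<lambda>n. n)) (tassoc L M N t)"
    by (rule tensor_assoc_natural[OF assms(1-4,2,3) f linear_maps_id linear_maps_id t])
  also have "\<dots> = tmap L' (M \<boxtimes> N) f (\<lambda>s. s) (tassoc L M N t)"
    by (rule tensor_map_cong[OF assms(1) _ assms(4) _ f linear_maps_id _ _ tensor_assoc_closed[OF assms(1-3) t]])
      (simp_all add: assms tensor_map_id)
  finally show ?thesis .
qed

lemma tensor_assoc_natural_mid:
  assumes "module K L" "module K M" "module K N" "module K M'"
    and g: "g \<in> lin M M'" and t: "t \<in> carrier ((L \<boxtimes> M) \<boxtimes> N)"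
  shows "tassoc L M' N (tmap (L \<boxtimes> M') N (tmap L M' (\<lambda>l. l) g) (\<lambda>n. n) t) =
    tmap L (M' \<boxtimes> N) (\<lambda>l. l) (tmap M' N g (\<lambda>n. n)) (tassoc L M N t)"
  by (rule tensor_assoc_natural[OF assms(1-3,1,4,3) linear_maps_id g linear_maps_id t])

lemma tensor_assoc_natural_right:
  assumes "module K L" "module K M" "module K N" "module K N'"
    and h: "h \<in> lin N N'" and t: "t \<in> carrier ((L \<boxtimes> M) \<boxtimes> N)"
  shows "tassoc L M N' (tmap (L \<boxtimes> M) N' (\<lambda>s. s) h t) =
    tmap L (M \<boxtimes> N') (\<lambda>l. l) (tmap M N' (\<lambda>m. m) h) (tassoc L M N t)"
proof -
  have "tmap (L \<boxtimes> M) N' (\<lambda>s. s) h t = tmap (L \<boxtimes> M) N' (tmap L M (\<lambda>l. l) (\<lambda>m. m)) h t"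
    by (rule tensor_map_cong[symmetric, OF _ assms(3) _ assms(4) linear_maps_id h _ _ t])
      (simp_all add: assms tensor_map_id)
  then show ?thesis
    using tensor_assoc_natural[OF assms(1-3,1,2,4) linear_maps_id linear_maps_id h t] by simp
qed

lemma tensor_map_compose_left:
  assumes "module K M" "module K N" "module K P" "module K Q"
    "f \<in> lin M P" "g \<in> lin P Q" "t \<in> carrier (M \<boxtimes> N)"
  shows "tmap Q N g (\<lambda>n. n) (tmap P N f (\<lambda>n. n) t) = tmap Q N (\<lambda>x. g (f x)) (\<lambda>n. n) t"
  by (rule tensor_map_compose[OF assms(1-3,2,4,2,5) linear_maps_id assms(6) linear_maps_id assms(7)])

lemma tensor_map_compose_right:
  assumes "module K M" "module K N" "module K P" "module K Q"
    "f \<in> lin N P" "g \<in> lin P Q" "t \<in> carrier (M \<boxtimes> N)"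
  shows "tmap M Q (\<lambda>m. m) g (tmap M P (\<lambda>m. m) f t) = tmap M Q (\<lambda>m. m) (\<lambda>x. g (f x)) t"
  by (rule tensor_map_compose[OF assms(1,2,1,3,1,4) linear_maps_id assms(5) linear_maps_id assms(6,7)])

text \<open>Both composites equal f \<otimes> g.\<close>

lemma tensor_map_exchange:
  assumes "module K M" "module K N" "module K P" "module K Q"
    "f \<in> lin M P" "g \<in> lin N Q" "t \<in> carrier (M \<boxtimes> N)"
  shows "tmap P Q (\<lambda>x. x) g (tmap P N f (\<lambda>x. x) t) = tmap P Q f (\<lambda>x. x) (tmap M Q (\<lambda>x. x) g t)"
  using tensor_map_compose[OF assms(1-3,2,3,4,5) linear_maps_id linear_maps_id assms(6,7)]
    tensor_map_compose[OF assms(1,2,1,4,3,4) linear_maps_id assms(6,5) linear_maps_id assms(7)]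
  by simp

lemma tensor_map_linear_left:
  assumes "module K M" "module K N" "module K P" "f \<in> lin M P"
  shows "tmap P N f (\<lambda>x. x) \<in> lin (M \<boxtimes> N) (P \<boxtimes> N)"
  by (rule tensor_map_linear[OF assms(1-3,2,4) linear_maps_id])

lemma tensor_map_linear_right:
  assumes "module K M" "module K N" "module K Q" "g \<in> lin N Q"
  shows "tmap M Q (\<lambda>x. x) g \<in> lin (M \<boxtimes> N) (M \<boxtimes> Q)"
  by (rule tensor_map_linear[OF assms(1,2,1,3) linear_maps_id assms(4)])

section \<open>Comodules and their morphisms\<close>

text \<open>A comodule stripped of coassociativity and counit. Sums and \<open>Ind\<close> are first
  studied at this level, because compatibility with morphisms is what later proves their
  axioms.\<close>

definition precomodule ::
  "'p monoid \<Rightarrow> ('p, 'k, 'c, 'z) pi_coalgebra_scheme \<Rightarrow> ('p, 'k, 'm, 'c) pi_comodule \<Rightarrow> bool"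
  where "precomodule G C M \<longleftrightarrow>
    (\<forall>\<alpha>\<in>carrier G. module K (fibre M \<alpha>)) \<and>
    (\<forall>\<alpha>\<in>carrier G. \<forall>\<beta>\<in>carrier G. coaction M \<alpha> \<beta> \<in>
      lin (fibre M (\<alpha> \<otimes>\<^bsub>G\<^esub> \<beta>)) (fibre M \<alpha> \<boxtimes> component C \<beta>))"

definition comodule_morphism ::
  "'p monoid \<Rightarrow> ('p, 'k, 'c, 'z) pi_coalgebra_scheme \<Rightarrow> ('p, 'k, 'm, 'c) pi_comodule \<Rightarrow>
    ('p, 'k, 'n, 'c) pi_comodule \<Rightarrow> ('p \<Rightarrow> 'm \<Rightarrow> 'n) \<Rightarrow> bool"
  where "comodule_morphism G C M N F \<longleftrightarrow>
    (\<forall>\<alpha>\<in>carrier G. F \<alpha> \<in> lin (fibre M \<alpha>) (fibre N \<alpha>)) \<and>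
    (\<forall>\<alpha>\<in>carrier G. \<forall>\<beta>\<in>carrier G. \<forall>x\<in>carrier (fibre M (\<alpha> \<otimes>\<^bsub>G\<^esub> \<beta>)).
      coaction N \<alpha> \<beta> (F (\<alpha> \<otimes>\<^bsub>G\<^esub> \<beta>) x) =
      tmap (fibre N \<alpha>) (component C \<beta>) (F \<alpha>) (\<lambda>c. c) (coaction M \<alpha> \<beta> x))"

text \<open>The sides of the comodule axioms (\<open>coassoc_left\<close>,
  \<open>coassoc_right\<close>, \<open>counit_action\<close>) are maps in their own right. Each is
  linear and commutes with morphisms, so the axioms can be transported instead of
  recomputed.\<close>

definition coassoc_left ::
  "'p monoid \<Rightarrow> ('p, 'k, 'c, 'z) pi_coalgebra_scheme \<Rightarrow> ('p, 'k, 'm, 'c) pi_comodule \<Rightarrow>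
    'p \<Rightarrow> 'p \<Rightarrow> 'p \<Rightarrow> 'm \<Rightarrow> ('k, 'm, ('k, 'c, 'c) tensor) tensor"
  where "coassoc_left G C M \<alpha> \<beta> \<gamma> x =
    tassoc (fibre M \<alpha>) (component C \<beta>) (component C \<gamma>)
      (tmap (fibre M \<alpha> \<boxtimes> component C \<beta>) (component C \<gamma>)
        (coaction M \<alpha> \<beta>) (\<lambda>c. c) (coaction M (\<alpha> \<otimes>\<^bsub>G\<^esub> \<beta>) \<gamma> x))"

definition coassoc_right ::
  "'p monoid \<Rightarrow> ('p, 'k, 'c, 'z) pi_coalgebra_scheme \<Rightarrow> ('p, 'k, 'm, 'c) pi_comodule \<Rightarrow>
    'p \<Rightarrow> 'p \<Rightarrow> 'p \<Rightarrow> 'm \<Rightarrow> ('k, 'm, ('k, 'c, 'c) tensor) tensor"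
  where "coassoc_right G C M \<alpha> \<beta> \<gamma> x =
    tmap (fibre M \<alpha>) (component C \<beta> \<boxtimes> component C \<gamma>)
      (\<lambda>m. m) (comult C \<beta> \<gamma>) (coaction M \<alpha> (\<beta> \<otimes>\<^bsub>G\<^esub> \<gamma>) x)"

definition counit_action ::
  "'p monoid \<Rightarrow> ('p, 'k, 'c, 'z) pi_coalgebra_scheme \<Rightarrow> ('p, 'k, 'm, 'c) pi_comodule \<Rightarrow>
    'p \<Rightarrow> 'm \<Rightarrow> 'm"
  where "counit_action G C M \<alpha> x =
    tensor_unit_right K (fibre M \<alpha>)
      (tmap (fibre M \<alpha>) (ground K) (\<lambda>m. m) (counit C) (coaction M \<alpha> \<one>\<^bsub>G\<^esub> x))"

section \<open>Transport of the comodule axioms along morphisms\<close>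

context
  fixes G :: "'p monoid" and C :: "('p, 'k, 'c, 'z) pi_coalgebra_scheme"
  assumes C: "pi_coalgebra K G C"
begin

interpretation C: pi_coalgebra K G C by (rule C)

lemmas component_module = C.component_space

lemma right_pi_comodule_iff:
  "right_pi_comodule K G C M \<longleftrightarrow> precomodule G C M \<and>
    (\<forall>\<alpha>\<in>carrier G. \<forall>\<beta>\<in>carrier G. \<forall>\<gamma>\<in>carrier G. \<forall>x\<in>carrier (fibre M (\<alpha> \<otimes>\<^bsub>G\<^esub> \<beta> \<otimes>\<^bsub>G\<^esub> \<gamma>)).
      coassoc_left G C M \<alpha> \<beta> \<gamma> x = coassoc_right G C M \<alpha> \<beta> \<gamma> x) \<and>
    (\<forall>\<alpha>\<in>carrier G. \<forall>x\<in>carrier (fibre M \<alpha>). counit_action G C M \<alpha> x = x)"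
  using C
  by (auto simp: right_pi_comodule_def right_pi_comodule_axioms_def precomodule_def
      coassoc_left_def coassoc_right_def counit_action_def)

context
  fixes M :: "('p, 'k, 'm, 'c) pi_comodule"
  assumes M: "precomodule G C M"
begin

lemma fibre_module: "\<alpha> \<in> carrier G \<Longrightarrow> module K (fibre M \<alpha>)"
  and coaction_map: "\<lbrakk>\<alpha> \<in> carrier G; \<beta> \<in> carrier G\<rbrakk> \<Longrightarrow>
    coaction M \<alpha> \<beta> \<in> lin (fibre M (\<alpha> \<otimes>\<^bsub>G\<^esub> \<beta>)) (fibre M \<alpha> \<boxtimes> component C \<beta>)"
  using M by (auto simp: precomodule_def)

lemma coassoc_left_linear:
  assumes "\<alpha> \<in> carrier G" "\<beta> \<in> carrier G" "\<gamma> \<in> carrier G"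
  shows "coassoc_left G C M \<alpha> \<beta> \<gamma> \<in> lin (fibre M (\<alpha> \<otimes>\<^bsub>G\<^esub> \<beta> \<otimes>\<^bsub>G\<^esub> \<gamma>))
    (fibre M \<alpha> \<boxtimes> (component C \<beta> \<boxtimes> component C \<gamma>))"
  unfolding coassoc_left_def
  by (rule linear_maps_compose[OF linear_maps_compose[OF coaction_map tensor_map_linear_left] tensor_assoc_linear])
    (use assms fibre_module component_module coaction_map in auto)

lemma coassoc_right_linear:
  assumes "\<alpha> \<in> carrier G" "\<beta> \<in> carrier G" "\<gamma> \<in> carrier G"
  shows "coassoc_right G C M \<alpha> \<beta> \<gamma> \<in> lin (fibre M (\<alpha> \<otimes>\<^bsub>G\<^esub> \<beta> \<otimes>\<^bsub>G\<^esub> \<gamma>))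
    (fibre M \<alpha> \<boxtimes> (component C \<beta> \<boxtimes> component C \<gamma>))"
  \<comment> \<open>The coaction splits \<alpha>(\<beta>\<gamma>), while the domain is indexed by
    (\<alpha>\<beta>)\<gamma>; the index is rewritten so that the fibres match.\<close>
  unfolding coassoc_right_def C.G.m_assoc[OF assms]
  by (rule linear_maps_compose[OF coaction_map tensor_map_linear_right])
    (use assms fibre_module component_module C.comult_linear in auto)

lemma counit_action_linear:
  assumes "\<alpha> \<in> carrier G"
  shows "counit_action G C M \<alpha> \<in> lin (fibre M \<alpha>) (fibre M \<alpha>)"
proof -
  have "coaction M \<alpha> \<one>\<^bsub>G\<^esub> \<in> lin (fibre M \<alpha>) (fibre M \<alpha> \<boxtimes> component C \<one>\<^bsub>G\<^esub>)"
    using coaction_map[OF assms C.G.one_closed] assms by simp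
  then show ?thesis
    unfolding counit_action_def
    by (rule linear_maps_compose[OF linear_maps_compose[OF _ tensor_map_linear_right] tensor_unit_right_linear])
      (use assms fibre_module component_module C.counit_linear in auto)
qed

end

context
  fixes M :: "('p, 'k, 'm, 'c) pi_comodule" and N :: "('p, 'k, 'n, 'c) pi_comodule"
    and F :: "'p \<Rightarrow> 'm \<Rightarrow> 'n"
  assumes M: "precomodule G C M" and N: "precomodule G C N" and F: "comodule_morphism G C M N F"
begin

lemma morphism_linear: "\<alpha> \<in> carrier G \<Longrightarrow> F \<alpha> \<in> lin (fibre M \<alpha>) (fibre N \<alpha>)"
  and morphism_coaction:
    "\<lbrakk>\<alpha> \<in> carrier G; \<beta> \<in> carrier G; x \<in> carrier (fibre M (\<alpha> \<otimes>\<^bsub>G\<^esub> \<beta>))\<rbrakk> \<Longrightarrow>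
      coaction N \<alpha> \<beta> (F (\<alpha> \<otimes>\<^bsub>G\<^esub> \<beta>) x) =
      tmap (fibre N \<alpha>) (component C \<beta>) (F \<alpha>) (\<lambda>c. c) (coaction M \<alpha> \<beta> x)"
  using F by (auto simp: comodule_morphism_def)

text \<open>The morphism property is used once for each of the two coactions, which carries
  \<open>F\<close> to the leftmost factor; naturality of the associator then pulls it out.\<close>

lemma coassoc_left_morphism:
  assumes \<alpha>: "\<alpha> \<in> carrier G" and \<beta>: "\<beta> \<in> carrier G" and \<gamma>: "\<gamma> \<in> carrier G"
    and x: "x \<in> carrier (fibre M (\<alpha> \<otimes>\<^bsub>G\<^esub> \<beta> \<otimes>\<^bsub>G\<^esub> \<gamma>))"
  shows "coassoc_left G C N \<alpha> \<beta> \<gamma> (F (\<alpha> \<otimes>\<^bsub>G\<^esub> \<beta> \<otimes>\<^bsub>G\<^esub> \<gamma>) x) =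
    tmap (fibre N \<alpha>) (component C \<beta> \<boxtimes> component C \<gamma>) (F \<alpha>) (\<lambda>c. c) (coassoc_left G C M \<alpha> \<beta> \<gamma> x)"
proof -
  let ?M = "fibre M" and ?N = "fibre N" and ?C = "component C"
  note \<alpha>\<beta> = C.G.m_closed[OF \<alpha> \<beta>]
  define t where "t = coaction M (\<alpha> \<otimes>\<^bsub>G\<^esub> \<beta>) \<gamma> x"
  have t: "t \<in> carrier (?M (\<alpha> \<otimes>\<^bsub>G\<^esub> \<beta>) \<boxtimes> ?C \<gamma>)"
    unfolding t_def by (rule linear_maps_closed[OF coaction_map[OF M \<alpha>\<beta> \<gamma>] x])
  note mods = fibre_module[OF M \<alpha>] fibre_module[OF M \<alpha>\<beta>] fibre_module[OF N \<alpha>] fibre_module[OF N \<alpha>\<beta>] component_module[OF \<beta>] component_module[OF \<gamma>]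
  have "tmap (?N \<alpha> \<boxtimes> ?C \<beta>) (?C \<gamma>) (coaction N \<alpha> \<beta>) (\<lambda>c. c) (coaction N (\<alpha> \<otimes>\<^bsub>G\<^esub> \<beta>) \<gamma> (F (\<alpha> \<otimes>\<^bsub>G\<^esub> \<beta> \<otimes>\<^bsub>G\<^esub> \<gamma>) x))
      = tmap (?N \<alpha> \<boxtimes> ?C \<beta>) (?C \<gamma>) (coaction N \<alpha> \<beta>) (\<lambda>c. c)
          (tmap (?N (\<alpha> \<otimes>\<^bsub>G\<^esub> \<beta>)) (?C \<gamma>) (F (\<alpha> \<otimes>\<^bsub>G\<^esub> \<beta>)) (\<lambda>c. c) t)"
    using morphism_coaction[OF \<alpha>\<beta> \<gamma> x] by (simp add: t_def)
  also have "\<dots> = tmap (?N \<alpha> \<boxtimes> ?C \<beta>) (?C \<gamma>) (\<lambda>m. coaction N \<alpha> \<beta> (F (\<alpha> \<otimes>\<^bsub>G\<^esub> \<beta>) m)) (\<lambda>c. c) t"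
    by (rule tensor_map_compose_left[OF _ _ _ _ morphism_linear coaction_map[OF N] t]) (use mods \<alpha> \<beta> \<alpha>\<beta> in auto)
  also have "\<dots> = tmap (?N \<alpha> \<boxtimes> ?C \<beta>) (?C \<gamma>)
      (\<lambda>m. tmap (?N \<alpha>) (?C \<beta>) (F \<alpha>) (\<lambda>c. c) (coaction M \<alpha> \<beta> m)) (\<lambda>c. c) t"
    by (rule tensor_map_cong[OF _ _ _ _ linear_maps_compose[OF coaction_map[OF M] tensor_map_linear_left] linear_maps_id _ _ t])
      (use mods \<alpha> \<beta> \<alpha>\<beta> morphism_linear morphism_coaction in auto)
  also have "\<dots> = tmap (?N \<alpha> \<boxtimes> ?C \<beta>) (?C \<gamma>) (tmap (?N \<alpha>) (?C \<beta>) (F \<alpha>) (\<lambda>c. c)) (\<lambda>c. c)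
      (tmap (?M \<alpha> \<boxtimes> ?C \<beta>) (?C \<gamma>) (coaction M \<alpha> \<beta>) (\<lambda>c. c) t)"
    by (rule tensor_map_compose_left[symmetric, OF _ _ _ _ coaction_map[OF M] tensor_map_linear_left t])
      (use mods \<alpha> \<beta> \<alpha>\<beta> morphism_linear in auto)
  finally show ?thesis
    unfolding coassoc_left_def t_def[symmetric]
    using tensor_assoc_natural_left[OF mods(1,5,6,3) morphism_linear[OF \<alpha>]
        linear_maps_closed[OF tensor_map_linear_left[OF mods(2,6) _ coaction_map[OF M \<alpha> \<beta>]] t]] mods
    by simp
qed

lemma coassoc_right_morphism:
  assumes \<alpha>: "\<alpha> \<in> carrier G" and \<beta>: "\<beta> \<in> carrier G" and \<gamma>: "\<gamma> \<in> carrier G"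
    and x: "x \<in> carrier (fibre M (\<alpha> \<otimes>\<^bsub>G\<^esub> \<beta> \<otimes>\<^bsub>G\<^esub> \<gamma>))"
  shows "coassoc_right G C N \<alpha> \<beta> \<gamma> (F (\<alpha> \<otimes>\<^bsub>G\<^esub> \<beta> \<otimes>\<^bsub>G\<^esub> \<gamma>) x) =
    tmap (fibre N \<alpha>) (component C \<beta> \<boxtimes> component C \<gamma>) (F \<alpha>) (\<lambda>c. c) (coassoc_right G C M \<alpha> \<beta> \<gamma> x)"
proof -
  note \<beta>\<gamma> = C.G.m_closed[OF \<beta> \<gamma>]
  note x' = x[unfolded C.G.m_assoc[OF \<alpha> \<beta> \<gamma>]]
  show ?thesis
    unfolding coassoc_right_def C.G.m_assoc[OF \<alpha> \<beta> \<gamma>] morphism_coaction[OF \<alpha> \<beta>\<gamma> x']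
    by (rule tensor_map_exchange[OF fibre_module[OF M \<alpha>] component_module[OF \<beta>\<gamma>] fibre_module[OF N \<alpha>] _ morphism_linear[OF \<alpha>]
          C.comult_linear[OF \<beta> \<gamma>] linear_maps_closed[OF coaction_map[OF M \<alpha> \<beta>\<gamma>] x']])
      (use component_module \<beta> \<gamma> in auto)
qed

lemma counit_action_morphism:
  assumes \<alpha>: "\<alpha> \<in> carrier G" and x: "x \<in> carrier (fibre M \<alpha>)"
  shows "counit_action G C N \<alpha> (F \<alpha> x) = F \<alpha> (counit_action G C M \<alpha> x)"
proof -
  note one = C.G.one_closed
  have x': "x \<in> carrier (fibre M (\<alpha> \<otimes>\<^bsub>G\<^esub> \<one>\<^bsub>G\<^esub>))" using x \<alpha> by simp
  note t = linear_maps_closed[OF coaction_map[OF M \<alpha> one] x']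
  have "tmap (fibre N \<alpha>) (ground K) (\<lambda>m. m) (counit C) (coaction N \<alpha> \<one>\<^bsub>G\<^esub> (F \<alpha> x)) =
      tmap (fibre N \<alpha>) (ground K) (\<lambda>m. m) (counit C)
        (tmap (fibre N \<alpha>) (component C \<one>\<^bsub>G\<^esub>) (F \<alpha>) (\<lambda>c. c) (coaction M \<alpha> \<one>\<^bsub>G\<^esub> x))"
    using morphism_coaction[OF \<alpha> one x'] \<alpha> by simp
  also have "\<dots> = tmap (fibre N \<alpha>) (ground K) (F \<alpha>) (\<lambda>c. c)
      (tmap (fibre M \<alpha>) (ground K) (\<lambda>m. m) (counit C) (coaction M \<alpha> \<one>\<^bsub>G\<^esub> x))"
    by (rule tensor_map_exchange[OF fibre_module[OF M \<alpha>] component_module[OF one] fibre_module[OF N \<alpha>] module_ground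
          morphism_linear[OF \<alpha>] C.counit_linear t])
  finally show ?thesis
    unfolding counit_action_def
    by (simp add: tensor_unit_right_natural[OF fibre_module[OF M \<alpha>] fibre_module[OF N \<alpha>] morphism_linear[OF \<alpha>]
          linear_maps_closed[OF tensor_map_linear_right[OF fibre_module[OF M \<alpha>] component_module[OF one] module_ground C.counit_linear] t]])
qed

end

text \<open>The inclusion is a morphism into a comodule. The two sides of coassociativity agree
  after the inclusion tensored with an identity, which is injective. For the counit law the
  inclusion does nothing to elements, so the equation in \<open>N\<close> is already the one
  wanted.\<close>

lemma subcomodule:
  assumes N: "right_pi_comodule K G C N" and M: "precomodule G C M"
    and sub: "\<And>\<alpha>. \<alpha> \<in> carrier G \<Longrightarrow> submodule (S \<alpha>) K (fibre N \<alpha>)"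
      "\<And>\<alpha>. \<alpha> \<in> carrier G \<Longrightarrow> fibre M \<alpha> = fibre N \<alpha>\<lparr>carrier := S \<alpha>\<rparr>"
    and incl: "comodule_morphism G C M N (\<lambda>\<alpha> x. x)"
  shows "right_pi_comodule K G C M"
proof -
  have N': "precomodule G C N" using N by (simp add: right_pi_comodule_iff)
  show ?thesis
    unfolding right_pi_comodule_iff
  proof (intro conjI ballI M)
    fix \<alpha> \<beta> \<gamma> x
    assume G: "\<alpha> \<in> carrier G" "\<beta> \<in> carrier G" "\<gamma> \<in> carrier G"
      and x: "x \<in> carrier (fibre M (\<alpha> \<otimes>\<^bsub>G\<^esub> \<beta> \<otimes>\<^bsub>G\<^esub> \<gamma>))"
    have xN: "x \<in> carrier (fibre N (\<alpha> \<otimes>\<^bsub>G\<^esub> \<beta> \<otimes>\<^bsub>G\<^esub> \<gamma>))"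
      using linear_maps_closed[OF morphism_linear[OF M N' incl] x] G by simp
    have CC: "module K (component C \<beta> \<boxtimes> component C \<gamma>)" using component_module G by simp
    have "coassoc_left G C N \<alpha> \<beta> \<gamma> x = coassoc_right G C N \<alpha> \<beta> \<gamma> x"
      using N G xN by (simp add: right_pi_comodule_iff)
    then show "coassoc_left G C M \<alpha> \<beta> \<gamma> x = coassoc_right G C M \<alpha> \<beta> \<gamma> x"
      using coassoc_left_morphism[OF M N' incl G x] coassoc_right_morphism[OF M N' incl G x]
        linear_maps_closed[OF coassoc_left_linear[OF M G] x]
        linear_maps_closed[OF coassoc_right_linear[OF M G] x]
        tensor_map_inclusion_inj[OF fibre_module[OF N' G(1)] CC sub(1)[OF G(1)]] sub(2)[OF G(1)]
      by (simp add: inj_on_eq_iff)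
  next
    fix \<alpha> x assume \<alpha>: "\<alpha> \<in> carrier G" and x: "x \<in> carrier (fibre M \<alpha>)"
    have "x \<in> carrier (fibre N \<alpha>)"
      using linear_maps_closed[OF morphism_linear[OF M N' incl \<alpha>] x] .
    then show "counit_action G C M \<alpha> x = x"
      using counit_action_morphism[OF M N' incl \<alpha> x] N \<alpha> by (simp add: right_pi_comodule_iff)
  qed
qed

end

lemma tensor_map_zero_left:
  assumes "module K M" "module K N" "module K P" "module K Q" "g \<in> lin N Q" "t \<in> carrier (M \<boxtimes> N)"
  shows "tmap P Q (\<lambda>x. \<zero>\<^bsub>P\<^esub>) g t = \<zero>\<^bsub>P \<boxtimes> Q\<^esub>"
proof -
  interpret P: module K P by fact
  interpret PQ: module K "P \<boxtimes> Q" using assms by simp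
  have zero: "(\<lambda>x. \<zero>\<^bsub>P\<^esub>) \<in> lin M P" "(\<lambda>t. \<zero>\<^bsub>P \<boxtimes> Q\<^esub>) \<in> lin (M \<boxtimes> N) (P \<boxtimes> Q)"
    by (rule linear_mapsI; simp)+
  show ?thesis
  proof (rule tensor_linear_ext[OF assms(1,2) _ tensor_map_linear[OF assms(1-4) zero(1) assms(5)] zero(2) _ assms(6)])
    fix m n assume "m \<in> carrier M" and n: "n \<in> carrier N"
    then show "tmap P Q (\<lambda>x. \<zero>\<^bsub>P\<^esub>) g (pure M N m n) = \<zero>\<^bsub>P \<boxtimes> Q\<^esub>"
      using linear_maps_zero[OF assms(3) _ pure_tensor_linear_left[OF assms(3,4) linear_maps_closed[OF assms(5) n]]]
        assms zero by (simp add: tensor_map_pure)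
  qed (use assms in simp)
qed

section \<open>Sums and cofree comodules\<close>

text \<open>I \<otimes> \<Delta> lands in V \<otimes> (C_\<alpha> \<otimes> C_\<beta>); the inverse
  associator moves it to (V \<otimes> C_\<alpha>) \<otimes> C_\<beta>, where a coaction takes its
  values.\<close>

definition cofree ::
  "('k, 'v) module \<Rightarrow> ('p, 'k, 'c, 'z) pi_coalgebra_scheme \<Rightarrow>
    ('p, 'k, ('k, 'v, 'c) tensor, 'c) pi_comodule"
  where "cofree V C = \<lparr>fibre = (\<lambda>\<alpha>. V \<boxtimes> component C \<alpha>),
    coaction = (\<lambda>\<alpha> \<beta> x. tensor_assoc_inv V (component C \<alpha>) (component C \<beta>)
      (tmap V (component C \<alpha> \<boxtimes> component C \<beta>) (\<lambda>v. v) (comult C \<alpha> \<beta>) x))\<rparr>"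

context
  fixes G :: "'p monoid" and C :: "('p, 'k, 'c, 'z) pi_coalgebra_scheme"
  assumes C: "pi_coalgebra K G C"
begin

interpretation C: pi_coalgebra K G C by (rule C)

text \<open>On the image of an inclusion one summand of the coaction is zero; a projection cancels
  one inclusion and annihilates the other. These four morphisms are the input for
  \<open>Ind_morphism\<close>.\<close>

lemma comodule_sum_morphisms:
  assumes M: "precomodule G C M" and N: "precomodule G C N"
  shows precomodule_sum: "precomodule G C (comodule_sum K C M N)"
    and comodule_sum_inl:
      "comodule_morphism G C M (comodule_sum K C M N) (\<lambda>\<alpha> x. (x, \<zero>\<^bsub>fibre N \<alpha>\<^esub>))"
    and comodule_sum_inr:
      "comodule_morphism G C N (comodule_sum K C M N) (\<lambda>\<alpha> y. (\<zero>\<^bsub>fibre M \<alpha>\<^esub>, y))"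
    and comodule_sum_fst: "comodule_morphism G C (comodule_sum K C M N) M (\<lambda>\<alpha>. fst)"
    and comodule_sum_snd: "comodule_morphism G C (comodule_sum K C M N) N (\<lambda>\<alpha>. snd)"
proof -
  let ?S = "\<lambda>\<alpha>. direct_sum (fibre M \<alpha>) (fibre N \<alpha>)"
  let ?M = "\<lambda>\<alpha> \<beta>. tmap (?S \<alpha>) (component C \<beta>) (\<lambda>m. (m, \<zero>\<^bsub>fibre N \<alpha>\<^esub>)) (\<lambda>c. c)"
  let ?N = "\<lambda>\<alpha> \<beta>. tmap (?S \<alpha>) (component C \<beta>) (\<lambda>n. (\<zero>\<^bsub>fibre M \<alpha>\<^esub>, n)) (\<lambda>c. c)"
  note mods = fibre_module[OF C M] fibre_module[OF C N] C.component_space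
  note coM = coaction_map[OF C M] and coN = coaction_map[OF C N]
  have fib: "fibre (comodule_sum K C M N) = ?S" by (simp add: comodule_sum_def)
  have co: "coaction (comodule_sum K C M N) \<alpha> \<beta> z =
      ?M \<alpha> \<beta> (coaction M \<alpha> \<beta> (fst z)) \<oplus>\<^bsub>?S \<alpha> \<boxtimes> component C \<beta>\<^esub> ?N \<alpha> \<beta> (coaction N \<alpha> \<beta> (snd z))"
    for \<alpha> \<beta> z
    by (simp add: comodule_sum_def Let_def split_def)
  have lM: "?M \<alpha> \<beta> \<in> lin (fibre M \<alpha> \<boxtimes> component C \<beta>) (?S \<alpha> \<boxtimes> component C \<beta>)"
    and lN: "?N \<alpha> \<beta> \<in> lin (fibre N \<alpha> \<boxtimes> component C \<beta>) (?S \<alpha> \<boxtimes> component C \<beta>)"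
    if "\<alpha> \<in> carrier G" "\<beta> \<in> carrier G" for \<alpha> \<beta>
    by (rule tensor_map_linear_left[OF _ _ _ direct_sum_inl]
          tensor_map_linear_left[OF _ _ _ direct_sum_inr]; use mods that in simp)+
  have "coaction (comodule_sum K C M N) \<alpha> \<beta> \<in> lin (?S (\<alpha> \<otimes>\<^bsub>G\<^esub> \<beta>)) (?S \<alpha> \<boxtimes> component C \<beta>)"
    if G: "\<alpha> \<in> carrier G" "\<beta> \<in> carrier G" for \<alpha> \<beta>
    unfolding co
  proof (rule linear_maps_add_maps)
    show "(\<lambda>z. ?M \<alpha> \<beta> (coaction M \<alpha> \<beta> (fst z))) \<in> lin (?S (\<alpha> \<otimes>\<^bsub>G\<^esub> \<beta>)) (?S \<alpha> \<boxtimes> component C \<beta>)"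
      by (rule linear_maps_compose[OF linear_maps_compose[OF direct_sum_fst coM[OF G]] lM[OF G]])
        (use mods G in auto)
    show "(\<lambda>z. ?N \<alpha> \<beta> (coaction N \<alpha> \<beta> (snd z))) \<in> lin (?S (\<alpha> \<otimes>\<^bsub>G\<^esub> \<beta>)) (?S \<alpha> \<boxtimes> component C \<beta>)"
      by (rule linear_maps_compose[OF linear_maps_compose[OF direct_sum_snd coN[OF G]] lN[OF G]])
        (use mods G in auto)
  qed (use mods G in auto)
  then show "precomodule G C (comodule_sum K C M N)"
    using mods by (simp add: precomodule_def fib)

  have zM: "coaction M \<alpha> \<beta> \<zero>\<^bsub>fibre M (\<alpha> \<otimes>\<^bsub>G\<^esub> \<beta>)\<^esub> = \<zero>\<^bsub>fibre M \<alpha> \<boxtimes> component C \<beta>\<^esub>"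
    and zN: "coaction N \<alpha> \<beta> \<zero>\<^bsub>fibre N (\<alpha> \<otimes>\<^bsub>G\<^esub> \<beta>)\<^esub> = \<zero>\<^bsub>fibre N \<alpha> \<boxtimes> component C \<beta>\<^esub>"
    and z'M: "?M \<alpha> \<beta> \<zero>\<^bsub>fibre M \<alpha> \<boxtimes> component C \<beta>\<^esub> = \<zero>\<^bsub>?S \<alpha> \<boxtimes> component C \<beta>\<^esub>"
    and z'N: "?N \<alpha> \<beta> \<zero>\<^bsub>fibre N \<alpha> \<boxtimes> component C \<beta>\<^esub> = \<zero>\<^bsub>?S \<alpha> \<boxtimes> component C \<beta>\<^esub>"
    if G: "\<alpha> \<in> carrier G" "\<beta> \<in> carrier G" for \<alpha> \<beta>
    using mods G
    by (simp_all add: linear_maps_zero[OF _ _ coM[OF G]] linear_maps_zero[OF _ _ coN[OF G]]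
        linear_maps_zero[OF _ _ lM[OF G]] linear_maps_zero[OF _ _ lN[OF G]])
  have unit: "x \<oplus>\<^bsub>?S \<alpha> \<boxtimes> component C \<beta>\<^esub> \<zero>\<^bsub>?S \<alpha> \<boxtimes> component C \<beta>\<^esub> = x"
    "\<zero>\<^bsub>?S \<alpha> \<boxtimes> component C \<beta>\<^esub> \<oplus>\<^bsub>?S \<alpha> \<boxtimes> component C \<beta>\<^esub> x = x"
    if "\<alpha> \<in> carrier G" "\<beta> \<in> carrier G" "x \<in> carrier (?S \<alpha> \<boxtimes> component C \<beta>)" for x \<alpha> \<beta>
  proof -
    interpret module K "?S \<alpha> \<boxtimes> component C \<beta>" using mods that by simp
    show "x \<oplus>\<^bsub>?S \<alpha> \<boxtimes> component C \<beta>\<^esub> \<zero>\<^bsub>?S \<alpha> \<boxtimes> component C \<beta>\<^esub> = x"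
      "\<zero>\<^bsub>?S \<alpha> \<boxtimes> component C \<beta>\<^esub> \<oplus>\<^bsub>?S \<alpha> \<boxtimes> component C \<beta>\<^esub> x = x"
      using that by auto
  qed
  show "comodule_morphism G C M (comodule_sum K C M N) (\<lambda>\<alpha> x. (x, \<zero>\<^bsub>fibre N \<alpha>\<^esub>))"
    unfolding comodule_morphism_def fib co
    using direct_sum_inl[OF mods(1,2)] linear_maps_closed[OF lM linear_maps_closed[OF coM]]
    by (simp add: zN z'N unit)
  show "comodule_morphism G C N (comodule_sum K C M N) (\<lambda>\<alpha> y. (\<zero>\<^bsub>fibre M \<alpha>\<^esub>, y))"
    unfolding comodule_morphism_def fib co
    using direct_sum_inr[OF mods(1,2)] linear_maps_closed[OF lN linear_maps_closed[OF coN]]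
    by (simp add: zM z'M unit)
  have fst_co: "coaction M \<alpha> \<beta> (fst z) =
        tmap (fibre M \<alpha>) (component C \<beta>) fst (\<lambda>c. c) (coaction (comodule_sum K C M N) \<alpha> \<beta> z)"
    and snd_co: "coaction N \<alpha> \<beta> (snd z) =
        tmap (fibre N \<alpha>) (component C \<beta>) snd (\<lambda>c. c) (coaction (comodule_sum K C M N) \<alpha> \<beta> z)"
    if G: "\<alpha> \<in> carrier G" "\<beta> \<in> carrier G" and z: "z \<in> carrier (?S (\<alpha> \<otimes>\<^bsub>G\<^esub> \<beta>))" for \<alpha> \<beta> z
  proof -
    note m = mods(1,2)[OF G(1)] mods(3)[OF G(2)]
    note S = module_direct_sum[OF m(1,2)]
    interpret MC: module K "fibre M \<alpha> \<boxtimes> component C \<beta>" using m by simp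
    interpret NC: module K "fibre N \<alpha> \<boxtimes> component C \<beta>" using m by simp
    have tM: "coaction M \<alpha> \<beta> (fst z) \<in> carrier (fibre M \<alpha> \<boxtimes> component C \<beta>)"
      and tN: "coaction N \<alpha> \<beta> (snd z) \<in> carrier (fibre N \<alpha> \<boxtimes> component C \<beta>)"
      using linear_maps_closed[OF coM[OF G]] linear_maps_closed[OF coN[OF G]] z by auto
    note inl = direct_sum_inl[OF m(1,2)] and inr = direct_sum_inr[OF m(1,2)]
      and fst = direct_sum_fst[OF m(1,2)] and snd = direct_sum_snd[OF m(1,2)]
    note fstS = tensor_map_linear_left[OF S m(3,1) fst] and sndS = tensor_map_linear_left[OF S m(3,2) snd]
    \<comment> \<open>The four composites of a projection with an inclusion, each the identity or
      zero, tensored with the identity.\<close>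
    have "tmap (fibre M \<alpha>) (component C \<beta>) fst (\<lambda>c. c) (?M \<alpha> \<beta> (coaction M \<alpha> \<beta> (fst z))) = coaction M \<alpha> \<beta> (fst z)"
      "tmap (fibre M \<alpha>) (component C \<beta>) fst (\<lambda>c. c) (?N \<alpha> \<beta> (coaction N \<alpha> \<beta> (snd z))) = \<zero>\<^bsub>fibre M \<alpha> \<boxtimes> component C \<beta>\<^esub>"
      "tmap (fibre N \<alpha>) (component C \<beta>) snd (\<lambda>c. c) (?M \<alpha> \<beta> (coaction M \<alpha> \<beta> (fst z))) = \<zero>\<^bsub>fibre N \<alpha> \<boxtimes> component C \<beta>\<^esub>"
      "tmap (fibre N \<alpha>) (component C \<beta>) snd (\<lambda>c. c) (?N \<alpha> \<beta> (coaction N \<alpha> \<beta> (snd z))) = coaction N \<alpha> \<beta> (snd z)"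
      by (simp_all add: tensor_map_compose_left[OF m(1,3) S m(1) inl fst tM] tensor_map_compose_left[OF m(2,3) S m(1) inr fst tN]
          tensor_map_compose_left[OF m(1,3) S m(2) inl snd tM] tensor_map_compose_left[OF m(2,3) S m(2) inr snd tN]
          tensor_map_id[OF m(1,3) tM] tensor_map_id[OF m(2,3) tN]
          tensor_map_zero_left[OF m(2,3,1,3) linear_maps_id tN] tensor_map_zero_left[OF m(1,3,2,3) linear_maps_id tM])
    then show "coaction M \<alpha> \<beta> (fst z) =
        tmap (fibre M \<alpha>) (component C \<beta>) fst (\<lambda>c. c) (coaction (comodule_sum K C M N) \<alpha> \<beta> z)"
      and "coaction N \<alpha> \<beta> (snd z) =
        tmap (fibre N \<alpha>) (component C \<beta>) snd (\<lambda>c. c) (coaction (comodule_sum K C M N) \<alpha> \<beta> z)"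
      using tM tN linear_maps_closed[OF lM[OF G] tM] linear_maps_closed[OF lN[OF G] tN]
      by (simp_all add: co linear_maps_add[OF fstS] linear_maps_add[OF sndS])
  qed
  show "comodule_morphism G C (comodule_sum K C M N) M (\<lambda>\<alpha>. fst)"
    unfolding comodule_morphism_def fib
    by (intro conjI ballI direct_sum_fst fst_co mods)
  show "comodule_morphism G C (comodule_sum K C M N) N (\<lambda>\<alpha>. snd)"
    unfolding comodule_morphism_def fib
    by (intro conjI ballI direct_sum_snd snd_co mods)
qed

text \<open>Since (x, y) = (x, 0) + (0, y) and both sides of each axiom are linear, the axioms need
  checking only on the images of the inclusions. There they come from the summands, the inclusions
  being morphisms.\<close>

lemma right_pi_comodule_sum:
  assumes M: "right_pi_comodule K G C M" and N: "right_pi_comodule K G C N"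
  shows "right_pi_comodule K G C (comodule_sum K C M N)"
proof -
  let ?S = "comodule_sum K C M N"
  have M': "precomodule G C M" and N': "precomodule G C N"
    using M N by (simp_all add: right_pi_comodule_iff[OF C])
  note S' = precomodule_sum[OF M' N']
  note inl = comodule_sum_inl[OF M' N'] and inr = comodule_sum_inr[OF M' N']
  have fib: "fibre ?S \<alpha> = direct_sum (fibre M \<alpha>) (fibre N \<alpha>)" for \<alpha> by (simp add: comodule_sum_def)
  note mods = fibre_module[OF C M'] fibre_module[OF C N']
  have eqI: "f z = g z" if "\<alpha> \<in> carrier G" "f \<in> lin (fibre ?S \<alpha>) P" "g \<in> lin (fibre ?S \<alpha>) P"
    and l: "\<And>x. x \<in> carrier (fibre M \<alpha>) \<Longrightarrow> f (x, \<zero>\<^bsub>fibre N \<alpha>\<^esub>) = g (x, \<zero>\<^bsub>fibre N \<alpha>\<^esub>)"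
    and r: "\<And>y. y \<in> carrier (fibre N \<alpha>) \<Longrightarrow> f (\<zero>\<^bsub>fibre M \<alpha>\<^esub>, y) = g (\<zero>\<^bsub>fibre M \<alpha>\<^esub>, y)"
    and z: "z \<in> carrier (fibre ?S \<alpha>)" for f g :: "_ \<Rightarrow> 'q" and P \<alpha> z
  proof -
    interpret M: module K "fibre M \<alpha>" using mods that by simp
    interpret N: module K "fibre N \<alpha>" using mods that by simp
    obtain x y where z': "z = (x, y)" "x \<in> carrier (fibre M \<alpha>)" "y \<in> carrier (fibre N \<alpha>)"
      using z by (auto simp: fib)
    then have "z = (x, \<zero>\<^bsub>fibre N \<alpha>\<^esub>) \<oplus>\<^bsub>fibre ?S \<alpha>\<^esub> (\<zero>\<^bsub>fibre M \<alpha>\<^esub>, y)"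
      "(x, \<zero>\<^bsub>fibre N \<alpha>\<^esub>) \<in> carrier (fibre ?S \<alpha>)" "(\<zero>\<^bsub>fibre M \<alpha>\<^esub>, y) \<in> carrier (fibre ?S \<alpha>)"
      by (simp_all add: fib)
    then show ?thesis
      using linear_maps_add[OF that(2)] linear_maps_add[OF that(3)] l[OF z'(2)] r[OF z'(3)] by metis
  qed
  show ?thesis
    unfolding right_pi_comodule_iff[OF C]
  proof (intro conjI ballI S')
    fix \<alpha> \<beta> \<gamma> z
    assume G: "\<alpha> \<in> carrier G" "\<beta> \<in> carrier G" "\<gamma> \<in> carrier G"
      and z: "z \<in> carrier (fibre ?S (\<alpha> \<otimes>\<^bsub>G\<^esub> \<beta> \<otimes>\<^bsub>G\<^esub> \<gamma>))"
    show "coassoc_left G C ?S \<alpha> \<beta> \<gamma> z = coassoc_right G C ?S \<alpha> \<beta> \<gamma> z"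
    proof (rule eqI[OF _ coassoc_left_linear[OF C S' G] coassoc_right_linear[OF C S' G] _ _ z])
      fix x assume x: "x \<in> carrier (fibre M (\<alpha> \<otimes>\<^bsub>G\<^esub> \<beta> \<otimes>\<^bsub>G\<^esub> \<gamma>))"
      then have "coassoc_left G C M \<alpha> \<beta> \<gamma> x = coassoc_right G C M \<alpha> \<beta> \<gamma> x"
        using M G by (simp add: right_pi_comodule_iff[OF C])
      then show "coassoc_left G C ?S \<alpha> \<beta> \<gamma> (x, \<zero>\<^bsub>fibre N (\<alpha> \<otimes>\<^bsub>G\<^esub> \<beta> \<otimes>\<^bsub>G\<^esub> \<gamma>)\<^esub>) =
          coassoc_right G C ?S \<alpha> \<beta> \<gamma> (x, \<zero>\<^bsub>fibre N (\<alpha> \<otimes>\<^bsub>G\<^esub> \<beta> \<otimes>\<^bsub>G\<^esub> \<gamma>)\<^esub>)"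
        using coassoc_left_morphism[OF C M' S' inl G x] coassoc_right_morphism[OF C M' S' inl G x] by simp
    next
      fix y assume y: "y \<in> carrier (fibre N (\<alpha> \<otimes>\<^bsub>G\<^esub> \<beta> \<otimes>\<^bsub>G\<^esub> \<gamma>))"
      then have "coassoc_left G C N \<alpha> \<beta> \<gamma> y = coassoc_right G C N \<alpha> \<beta> \<gamma> y"
        using N G by (simp add: right_pi_comodule_iff[OF C])
      then show "coassoc_left G C ?S \<alpha> \<beta> \<gamma> (\<zero>\<^bsub>fibre M (\<alpha> \<otimes>\<^bsub>G\<^esub> \<beta> \<otimes>\<^bsub>G\<^esub> \<gamma>)\<^esub>, y) =
          coassoc_right G C ?S \<alpha> \<beta> \<gamma> (\<zero>\<^bsub>fibre M (\<alpha> \<otimes>\<^bsub>G\<^esub> \<beta> \<otimes>\<^bsub>G\<^esub> \<gamma>)\<^esub>, y)"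
        using coassoc_left_morphism[OF C N' S' inr G y] coassoc_right_morphism[OF C N' S' inr G y] by simp
    qed (use G in simp)
  next
    fix \<alpha> z assume \<alpha>: "\<alpha> \<in> carrier G" and z: "z \<in> carrier (fibre ?S \<alpha>)"
    show "counit_action G C ?S \<alpha> z = z"
      by (rule eqI[OF \<alpha> counit_action_linear[OF C S' \<alpha>] linear_maps_id _ _ z])
        (use M N \<alpha> counit_action_morphism[OF C M' S' inl \<alpha>] counit_action_morphism[OF C N' S' inr \<alpha>]
          in \<open>simp_all add: right_pi_comodule_iff[OF C]\<close>)
  qed
qed

text \<open>The coaction is I \<otimes> \<Delta> pulled back along an associator, so both sides of
  coassociativity are compared after a further, injective associator. There they become I tensored
  with the two sides of coassociativity in \<open>C\<close>.\<close>

lemma right_pi_comodule_cofree: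
  fixes V :: "('k, 'v) module"
  assumes V: "module K V"
  shows "right_pi_comodule K G C (cofree V C)"
proof -
  let ?C = "component C"
  let ?D = "\<lambda>\<alpha> \<beta>. tmap V (?C \<alpha> \<boxtimes> ?C \<beta>) (\<lambda>v. v) (comult C \<alpha> \<beta>)"
  note comp = C.component_space
  have fib: "fibre (cofree V C) \<alpha> = V \<boxtimes> ?C \<alpha>" for \<alpha> by (simp add: cofree_def)
  have co: "coaction (cofree V C) \<alpha> \<beta> x = tensor_assoc_inv V (?C \<alpha>) (?C \<beta>) (?D \<alpha> \<beta> x)" for \<alpha> \<beta> x
    by (simp add: cofree_def)
  have D: "?D \<alpha> \<beta> \<in> lin (V \<boxtimes> ?C (\<alpha> \<otimes>\<^bsub>G\<^esub> \<beta>)) (V \<boxtimes> (?C \<alpha> \<boxtimes> ?C \<beta>))"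
    if "\<alpha> \<in> carrier G" "\<beta> \<in> carrier G" for \<alpha> \<beta>
    using V comp C.comult_linear that by (simp add: tensor_map_linear_right)
  have coL: "coaction (cofree V C) \<alpha> \<beta> \<in> lin (V \<boxtimes> ?C (\<alpha> \<otimes>\<^bsub>G\<^esub> \<beta>)) ((V \<boxtimes> ?C \<alpha>) \<boxtimes> ?C \<beta>)"
    if G: "\<alpha> \<in> carrier G" "\<beta> \<in> carrier G" for \<alpha> \<beta>
    unfolding co by (rule linear_maps_compose[OF D[OF G] tensor_assoc_inv_linear]) (use V comp G in auto)
  have assoc_co: "tassoc V (?C \<alpha>) (?C \<beta>) (coaction (cofree V C) \<alpha> \<beta> x) = ?D \<alpha> \<beta> x"
    if G: "\<alpha> \<in> carrier G" "\<beta> \<in> carrier G" and x: "x \<in> carrier (V \<boxtimes> ?C (\<alpha> \<otimes>\<^bsub>G\<^esub> \<beta>))" for \<alpha> \<beta> x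
    unfolding co using V comp G linear_maps_closed[OF D[OF G] x] by (simp add: tensor_assoc_inv_right)
  have pre: "precomodule G C (cofree V C)"
    unfolding precomodule_def fib using coL V comp by simp
  show ?thesis
    unfolding right_pi_comodule_iff[OF C]
  proof (intro conjI ballI pre)
    fix \<alpha> \<beta> \<gamma> x
    assume G: "\<alpha> \<in> carrier G" "\<beta> \<in> carrier G" "\<gamma> \<in> carrier G"
      and x: "x \<in> carrier (fibre (cofree V C) (\<alpha> \<otimes>\<^bsub>G\<^esub> \<beta> \<otimes>\<^bsub>G\<^esub> \<gamma>))"
    note ab = C.G.m_closed[OF G(1,2)] and bc = C.G.m_closed[OF G(2,3)]
    note x1 = x[unfolded fib] and x2 = x[unfolded fib C.G.m_assoc[OF G]]
    note mods = V comp[OF G(1)] comp[OF G(2)] comp[OF G(3)] comp[OF ab] comp[OF bc]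
    let ?A = "?C \<alpha>" and ?B = "?C \<beta>" and ?E = "?C \<gamma>"
    define s where "s = coaction (cofree V C) (\<alpha> \<otimes>\<^bsub>G\<^esub> \<beta>) \<gamma> x"
    have s: "s \<in> carrier ((V \<boxtimes> ?C (\<alpha> \<otimes>\<^bsub>G\<^esub> \<beta>)) \<boxtimes> ?E)"
      unfolding s_def by (rule linear_maps_closed[OF coL[OF ab G(3)] x1])
    define t where "t = tmap ((V \<boxtimes> ?A) \<boxtimes> ?B) ?E (coaction (cofree V C) \<alpha> \<beta>) (\<lambda>c. c) s"
    have t: "t \<in> carrier (((V \<boxtimes> ?A) \<boxtimes> ?B) \<boxtimes> ?E)"
      unfolding t_def by (rule linear_maps_closed[OF tensor_map_linear_left[OF _ _ _ coL] s]) (use mods G in auto)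
    have "tassoc V ?A (?B \<boxtimes> ?E) (coassoc_left G C (cofree V C) \<alpha> \<beta> \<gamma> x) =
        tassoc V ?A (?B \<boxtimes> ?E) (tassoc (V \<boxtimes> ?A) ?B ?E t)"
      by (simp add: coassoc_left_def fib t_def s_def)
    \<comment> \<open>The pentagon brings \<open>tassoc V ?A ?B\<close> directly in front of the
      inner coaction, with which it composes to I \<otimes> \<Delta>.\<close>
    also have "\<dots> = tmap V (?A \<boxtimes> (?B \<boxtimes> ?E)) (\<lambda>x. x) (tassoc ?A ?B ?E)
        (tassoc V (?A \<boxtimes> ?B) ?E (tmap (V \<boxtimes> (?A \<boxtimes> ?B)) ?E (tassoc V ?A ?B) (\<lambda>x. x) t))"
      by (rule tensor_assoc_pentagon[OF mods(1-4) t])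
    also have "tmap (V \<boxtimes> (?A \<boxtimes> ?B)) ?E (tassoc V ?A ?B) (\<lambda>x. x) t =
        tmap (V \<boxtimes> (?A \<boxtimes> ?B)) ?E (\<lambda>y. tassoc V ?A ?B (coaction (cofree V C) \<alpha> \<beta> y)) (\<lambda>x. x) s"
      unfolding t_def
      by (rule tensor_map_compose_left[OF _ _ _ _ coL tensor_assoc_linear s]) (use mods G in auto)
    also have "\<dots> = tmap (V \<boxtimes> (?A \<boxtimes> ?B)) ?E (?D \<alpha> \<beta>) (\<lambda>x. x) s"
      by (rule tensor_map_cong[OF _ _ _ _ D linear_maps_id _ _ s]) (use mods G assoc_co in auto)
    also have "tassoc V (?A \<boxtimes> ?B) ?E \<dots> = tmap V ((?A \<boxtimes> ?B) \<boxtimes> ?E) (\<lambda>v. v)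
        (tmap (?A \<boxtimes> ?B) ?E (comult C \<alpha> \<beta>) (\<lambda>c. c)) (tassoc V (?C (\<alpha> \<otimes>\<^bsub>G\<^esub> \<beta>)) ?E s)"
      by (rule tensor_assoc_natural_mid[OF _ _ _ _ _ s]) (use mods G C.comult_linear in auto)
    also have "tassoc V (?C (\<alpha> \<otimes>\<^bsub>G\<^esub> \<beta>)) ?E s = ?D (\<alpha> \<otimes>\<^bsub>G\<^esub> \<beta>) \<gamma> x"
      unfolding s_def by (rule assoc_co[OF ab G(3) x1])
    also have "tmap V ((?A \<boxtimes> ?B) \<boxtimes> ?E) (\<lambda>v. v) (tmap (?A \<boxtimes> ?B) ?E (comult C \<alpha> \<beta>) (\<lambda>c. c)) \<dots> =
        tmap V ((?A \<boxtimes> ?B) \<boxtimes> ?E) (\<lambda>v. v)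
          (\<lambda>c. tmap (?A \<boxtimes> ?B) ?E (comult C \<alpha> \<beta>) (\<lambda>c. c) (comult C (\<alpha> \<otimes>\<^bsub>G\<^esub> \<beta>) \<gamma> c)) x"
      by (rule tensor_map_compose_right[OF _ _ _ _ C.comult_linear tensor_map_linear_left x1])
        (use mods G ab C.comult_linear comp in auto)
    also have "tmap V (?A \<boxtimes> (?B \<boxtimes> ?E)) (\<lambda>x. x) (tassoc ?A ?B ?E) \<dots> =
        tmap V (?A \<boxtimes> (?B \<boxtimes> ?E)) (\<lambda>x. x) (\<lambda>c. tassoc ?A ?B ?E
          (tmap (?A \<boxtimes> ?B) ?E (comult C \<alpha> \<beta>) (\<lambda>c. c) (comult C (\<alpha> \<otimes>\<^bsub>G\<^esub> \<beta>) \<gamma> c))) x"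
      by (rule tensor_map_compose_right[OF _ _ _ _ linear_maps_compose[OF C.comult_linear tensor_map_linear_left]
            tensor_assoc_linear x1])
        (use mods G ab C.comult_linear comp in auto)
    \<comment> \<open>The coalgebra axiom enters here, inside the second factor; the other steps
      move brackets and merge composites.\<close>
    also have "\<dots> = tmap V (?A \<boxtimes> (?B \<boxtimes> ?E)) (\<lambda>x. x)
        (\<lambda>c. tmap ?A (?B \<boxtimes> ?E) (\<lambda>c. c) (comult C \<beta> \<gamma>) (comult C \<alpha> (\<beta> \<otimes>\<^bsub>G\<^esub> \<gamma>) c)) x"
      by (rule tensor_map_cong[OF _ _ _ _ linear_maps_id linear_maps_compose[OF C.comult_linear tensor_map_linear_right]
            _ _ x2])
        (use mods G bc C.comult_linear comp C.coassoc C.G.m_assoc in auto)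
    also have "\<dots> = tmap V (?A \<boxtimes> (?B \<boxtimes> ?E)) (\<lambda>v. v) (tmap ?A (?B \<boxtimes> ?E) (\<lambda>c. c) (comult C \<beta> \<gamma>))
        (?D \<alpha> (\<beta> \<otimes>\<^bsub>G\<^esub> \<gamma>) x)"
      by (rule tensor_map_compose_right[symmetric, OF _ _ _ _ C.comult_linear tensor_map_linear_right x2])
        (use mods G bc C.comult_linear comp in auto)
    also have "?D \<alpha> (\<beta> \<otimes>\<^bsub>G\<^esub> \<gamma>) x = tassoc V ?A (?C (\<beta> \<otimes>\<^bsub>G\<^esub> \<gamma>)) (coaction (cofree V C) \<alpha> (\<beta> \<otimes>\<^bsub>G\<^esub> \<gamma>) x)"
      by (rule assoc_co[symmetric, OF G(1) bc x2])
    also have "tmap V (?A \<boxtimes> (?B \<boxtimes> ?E)) (\<lambda>v. v) (tmap ?A (?B \<boxtimes> ?E) (\<lambda>c. c) (comult C \<beta> \<gamma>)) \<dots> =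
        tassoc V ?A (?B \<boxtimes> ?E) (coassoc_right G C (cofree V C) \<alpha> \<beta> \<gamma> x)"
      unfolding coassoc_right_def fib
      by (rule tensor_assoc_natural_right[symmetric, OF mods(1,2,6) _ C.comult_linear linear_maps_closed[OF coL x2]])
        (use mods G bc in auto)
    finally show "coassoc_left G C (cofree V C) \<alpha> \<beta> \<gamma> x = coassoc_right G C (cofree V C) \<alpha> \<beta> \<gamma> x"
      using tensor_assoc_inj[of V ?A "?B \<boxtimes> ?E"] mods
        linear_maps_closed[OF coassoc_left_linear[OF C pre G] x, unfolded fib]
        linear_maps_closed[OF coassoc_right_linear[OF C pre G] x, unfolded fib]
      by (simp add: inj_on_eq_iff)
  next
    fix \<alpha> x assume \<alpha>: "\<alpha> \<in> carrier G" and x: "x \<in> carrier (fibre (cofree V C) \<alpha>)"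
    let ?A = "?C \<alpha>" and ?U = "?C \<one>\<^bsub>G\<^esub>"
    note one = C.G.one_closed
    note mods = V comp[OF \<alpha>] comp[OF one]
    have x': "x \<in> carrier (V \<boxtimes> ?C (\<alpha> \<otimes>\<^bsub>G\<^esub> \<one>\<^bsub>G\<^esub>))" and x'': "x \<in> carrier (V \<boxtimes> ?A)"
      using x \<alpha> by (simp_all add: fib)
    have \<Delta>: "comult C \<alpha> \<one>\<^bsub>G\<^esub> \<in> lin ?A (?A \<boxtimes> ?U)"
      using C.comult_linear[OF \<alpha> one] \<alpha> by simp
    define s where "s = coaction (cofree V C) \<alpha> \<one>\<^bsub>G\<^esub> x"
    have s: "s \<in> carrier ((V \<boxtimes> ?A) \<boxtimes> ?U)"
      unfolding s_def by (rule linear_maps_closed[OF coL[OF \<alpha> one] x'])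
    have "counit_action G C (cofree V C) \<alpha> x =
        tensor_unit_right K (V \<boxtimes> ?A) (tmap (V \<boxtimes> ?A) (ground K) (\<lambda>m. m) (counit C) s)"
      by (simp add: counit_action_def fib s_def)
    \<comment> \<open>The scalar produced by the counit is moved from V \<otimes> C_\<alpha> onto
      C_\<alpha>, where the counit law of the coalgebra applies.\<close>
    also have "\<dots> = tmap V ?A (\<lambda>x. x) (tensor_unit_right K ?A)
        (tassoc V ?A (ground K) (tmap (V \<boxtimes> ?A) (ground K) (\<lambda>m. m) (counit C) s))"
      by (rule tensor_unit_right_tensor[OF mods(1,2) linear_maps_closed[OF tensor_map_linear_right s]])
        (use mods C.counit_linear in auto)
    also have "tassoc V ?A (ground K) (tmap (V \<boxtimes> ?A) (ground K) (\<lambda>m. m) (counit C) s) =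
        tmap V (?A \<boxtimes> ground K) (\<lambda>v. v) (tmap ?A (ground K) (\<lambda>c. c) (counit C)) (tassoc V ?A ?U s)"
      by (rule tensor_assoc_natural_right[OF mods module_ground C.counit_linear s])
    also have "tassoc V ?A ?U s = ?D \<alpha> \<one>\<^bsub>G\<^esub> x"
      unfolding s_def by (rule assoc_co[OF \<alpha> one x'])
    also have "tmap V (?A \<boxtimes> ground K) (\<lambda>v. v) (tmap ?A (ground K) (\<lambda>c. c) (counit C)) \<dots> =
        tmap V (?A \<boxtimes> ground K) (\<lambda>v. v) (\<lambda>c. tmap ?A (ground K) (\<lambda>c. c) (counit C) (comult C \<alpha> \<one>\<^bsub>G\<^esub> c)) x"
      by (rule tensor_map_compose_right[OF _ _ _ _ \<Delta> tensor_map_linear_right x''])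
        (use mods C.counit_linear in auto)
    also have "tmap V ?A (\<lambda>x. x) (tensor_unit_right K ?A) \<dots> =
        tmap V ?A (\<lambda>v. v) (\<lambda>c. tensor_unit_right K ?A
          (tmap ?A (ground K) (\<lambda>c. c) (counit C) (comult C \<alpha> \<one>\<^bsub>G\<^esub> c))) x"
      by (rule tensor_map_compose_right[OF _ _ _ _ linear_maps_compose[OF \<Delta> tensor_map_linear_right]
            tensor_unit_right_linear x''])
        (use mods C.counit_linear in auto)
    also have "\<dots> = tmap V ?A (\<lambda>v. v) (\<lambda>c. c) x"
      by (rule tensor_map_cong[OF mods(1,2,1,2) linear_maps_id linear_maps_id _ _ x''])
        (use C.counit_right \<alpha> in auto)
    also have "\<dots> = x" by (rule tensor_map_id[OF mods(1,2) x''])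
    finally show "counit_action G C (cofree V C) \<alpha> x = x" .
  qed
qed

text \<open>The pairing of \<open>p\<close> and \<open>q\<close> is inverted by the sum of
  \<open>i\<close> and \<open>j\<close>; that the mixed composites p j and q i vanish follows from
  the three identities. It thus suffices to have the maps and these identities, which an additive
  functor preserves.\<close>

lemma comodule_equivalent_biproduct:
  assumes X: "right_pi_comodule K G C X"
    and A: "right_pi_comodule K G C A" and B: "right_pi_comodule K G C B"
    and p: "comodule_morphism G C X A p" and q: "comodule_morphism G C X B q"
    and i: "comodule_morphism G C A X i" and j: "comodule_morphism G C B X j"
    and pi: "\<And>\<alpha> a. \<lbrakk>\<alpha> \<in> carrier G; a \<in> carrier (fibre A \<alpha>)\<rbrakk> \<Longrightarrow> p \<alpha> (i \<alpha> a) = a"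
    and qj: "\<And>\<alpha> b. \<lbrakk>\<alpha> \<in> carrier G; b \<in> carrier (fibre B \<alpha>)\<rbrakk> \<Longrightarrow> q \<alpha> (j \<alpha> b) = b"
    and sum: "\<And>\<alpha> x. \<lbrakk>\<alpha> \<in> carrier G; x \<in> carrier (fibre X \<alpha>)\<rbrakk> \<Longrightarrow>
      i \<alpha> (p \<alpha> x) \<oplus>\<^bsub>fibre X \<alpha>\<^esub> j \<alpha> (q \<alpha> x) = x"
  shows "comodule_equivalent K G C X (comodule_sum K C A B)"
proof -
  let ?S = "comodule_sum K C A B"
  let ?F = "\<lambda>\<alpha> x. (p \<alpha> x, q \<alpha> x)"
  have X': "precomodule G C X" and A': "precomodule G C A" and B': "precomodule G C B"
    using X A B by (simp_all add: right_pi_comodule_iff[OF C])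
  note plin = morphism_linear[OF C X' A' p] and qlin = morphism_linear[OF C X' B' q]
    and ilin = morphism_linear[OF C A' X' i] and jlin = morphism_linear[OF C B' X' j]
  note mods = fibre_module[OF C X'] fibre_module[OF C A'] fibre_module[OF C B'] C.component_space
  have fib: "fibre ?S \<alpha> = direct_sum (fibre A \<alpha>) (fibre B \<alpha>)" for \<alpha> by (simp add: comodule_sum_def)
  have lin: "?F \<alpha> \<in> lin (fibre X \<alpha>) (fibre ?S \<alpha>)" if "\<alpha> \<in> carrier G" for \<alpha>
    unfolding fib by (rule direct_sum_pair[OF plin[OF that] qlin[OF that]])
  have bij: "bij_betw (?F \<alpha>) (carrier (fibre X \<alpha>)) (carrier (fibre ?S \<alpha>))" if \<alpha>: "\<alpha> \<in> carrier G" for \<alpha>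
  proof -
    interpret X: module K "fibre X \<alpha>" using mods \<alpha> by simp
    interpret A: module K "fibre A \<alpha>" using mods \<alpha> by simp
    interpret B: module K "fibre B \<alpha>" using mods \<alpha> by simp
    note closed = linear_maps_closed[OF plin[OF \<alpha>]] linear_maps_closed[OF qlin[OF \<alpha>]]
      linear_maps_closed[OF ilin[OF \<alpha>]] linear_maps_closed[OF jlin[OF \<alpha>]]
    \<comment> \<open>The decomposition of j b reads i p j b + j b = j b, so i p j b = 0; applying
      \<open>p\<close> and p i = I gives p j b = 0.\<close>
    have pj: "p \<alpha> (j \<alpha> b) = \<zero>\<^bsub>fibre A \<alpha>\<^esub>" if "b \<in> carrier (fibre B \<alpha>)" for b
    proof -
      have "i \<alpha> (p \<alpha> (j \<alpha> b)) \<oplus>\<^bsub>fibre X \<alpha>\<^esub> j \<alpha> b = j \<alpha> b"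
        using sum[OF \<alpha> closed(4)[OF that]] qj[OF \<alpha> that] by simp
      then have "i \<alpha> (p \<alpha> (j \<alpha> b)) = \<zero>\<^bsub>fibre X \<alpha>\<^esub>"
        by (simp add: closed that)
      then show ?thesis
        using pi[OF \<alpha> closed(1)[OF closed(4)[OF that]]] linear_maps_zero[OF _ _ plin[OF \<alpha>]] mods \<alpha> by simp
    qed
    have qi: "q \<alpha> (i \<alpha> a) = \<zero>\<^bsub>fibre B \<alpha>\<^esub>" if "a \<in> carrier (fibre A \<alpha>)" for a
    proof -
      have "i \<alpha> a \<oplus>\<^bsub>fibre X \<alpha>\<^esub> j \<alpha> (q \<alpha> (i \<alpha> a)) = i \<alpha> a"
        using sum[OF \<alpha> closed(3)[OF that]] pi[OF \<alpha> that] by simp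
      then have "j \<alpha> (q \<alpha> (i \<alpha> a)) = \<zero>\<^bsub>fibre X \<alpha>\<^esub>"
        by (simp add: closed that)
      then show ?thesis
        using qj[OF \<alpha> closed(2)[OF closed(3)[OF that]]] linear_maps_zero[OF _ _ qlin[OF \<alpha>]] mods \<alpha> by simp
    qed
    show ?thesis
    proof (rule bij_betw_byWitness[where f' = "\<lambda>(a, b). i \<alpha> a \<oplus>\<^bsub>fibre X \<alpha>\<^esub> j \<alpha> b"])
      show "\<forall>x\<in>carrier (fibre X \<alpha>). (case ?F \<alpha> x of (a, b) \<Rightarrow> i \<alpha> a \<oplus>\<^bsub>fibre X \<alpha>\<^esub> j \<alpha> b) = x"
        using sum[OF \<alpha>] by simp
      show "\<forall>z\<in>carrier (fibre ?S \<alpha>). ?F \<alpha> (case z of (a, b) \<Rightarrow> i \<alpha> a \<oplus>\<^bsub>fibre X \<alpha>\<^esub> j \<alpha> b) = z"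
        using closed pi[OF \<alpha>] qj[OF \<alpha>]
        by (auto simp: fib linear_maps_add[OF plin[OF \<alpha>]] linear_maps_add[OF qlin[OF \<alpha>]] pj qi)
    qed (use closed in \<open>auto simp: fib\<close>)
  qed
  have co: "coaction ?S \<alpha> \<beta> (?F (\<alpha> \<otimes>\<^bsub>G\<^esub> \<beta>) x) =
      tmap (fibre ?S \<alpha>) (component C \<beta>) (?F \<alpha>) (\<lambda>c. c) (coaction X \<alpha> \<beta> x)"
    if G: "\<alpha> \<in> carrier G" "\<beta> \<in> carrier G" and x: "x \<in> carrier (fibre X (\<alpha> \<otimes>\<^bsub>G\<^esub> \<beta>))" for \<alpha> \<beta> x
  proof -
    interpret A: module K "fibre A \<alpha>" using mods G by simp
    interpret B: module K "fibre B \<alpha>" using mods G by simp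
    let ?l = "\<lambda>a. (a, \<zero>\<^bsub>fibre B \<alpha>\<^esub>)" and ?r = "\<lambda>b. (\<zero>\<^bsub>fibre A \<alpha>\<^esub>, b)"
    note m = mods(1-3)[OF G(1)] mods(4)[OF G(2)] module_direct_sum[OF mods(2,3)[OF G(1)]]
    note t = linear_maps_closed[OF coaction_map[OF C X' G] x]
    note l = direct_sum_inl[OF m(2,3)] and r = direct_sum_inr[OF m(2,3)]
    note pl = linear_maps_compose[OF plin[OF G(1)] l] and qr = linear_maps_compose[OF qlin[OF G(1)] r]
    have "coaction ?S \<alpha> \<beta> (?F (\<alpha> \<otimes>\<^bsub>G\<^esub> \<beta>) x) =
        tmap (fibre ?S \<alpha>) (component C \<beta>) ?l (\<lambda>c. c)
          (tmap (fibre A \<alpha>) (component C \<beta>) (p \<alpha>) (\<lambda>c. c) (coaction X \<alpha> \<beta> x))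
        \<oplus>\<^bsub>fibre ?S \<alpha> \<boxtimes> component C \<beta>\<^esub>
        tmap (fibre ?S \<alpha>) (component C \<beta>) ?r (\<lambda>c. c)
          (tmap (fibre B \<alpha>) (component C \<beta>) (q \<alpha>) (\<lambda>c. c) (coaction X \<alpha> \<beta> x))"
      using morphism_coaction[OF C X' A' p G x] morphism_coaction[OF C X' B' q G x]
      by (simp add: comodule_sum_def Let_def)
    \<comment> \<open>The pairing is l p + r q for the inclusions \<open>?l\<close> and
      \<open>?r\<close> of the direct sum, and the tensor product of maps is additive in its left
      argument.\<close>
    also have "\<dots> = tmap (fibre ?S \<alpha>) (component C \<beta>)
        (\<lambda>x. ?l (p \<alpha> x) \<oplus>\<^bsub>fibre ?S \<alpha>\<^esub> ?r (q \<alpha> x)) (\<lambda>c. c) (coaction X \<alpha> \<beta> x)"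
      unfolding fib
        tensor_map_compose_left[OF m(1,4,2,5) plin[OF G(1)] l t]
        tensor_map_compose_left[OF m(1,4,3,5) qlin[OF G(1)] r t]
      by (rule tensor_map_add_left[symmetric, OF m(1,4,5,4) pl qr linear_maps_id t])
    also have "\<dots> = tmap (fibre ?S \<alpha>) (component C \<beta>) (?F \<alpha>) (\<lambda>c. c) (coaction X \<alpha> \<beta> x)"
      by (rule tensor_map_cong[OF m(1,4) _ m(4) lin[OF G(1)] linear_maps_id _ _ t])
        (use m linear_maps_closed[OF plin[OF G(1)]] linear_maps_closed[OF qlin[OF G(1)]] in \<open>auto simp: fib\<close>)
    finally show ?thesis .
  qed
  show ?thesis
    unfolding comodule_equivalent_def
    by (intro conjI exI[of _ ?F] ballI X right_pi_comodule_sum[OF A B] lin bij co)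
qed

end

section \<open>Induced representations\<close>

context
  fixes G :: "'p monoid" and H :: "('p, 'k, 'h) hopf_pi_coalgebra"
    and C :: "('p, 'k, 'c) pi_coalgebra" and act :: "'p \<Rightarrow> 'h \<Rightarrow> 'c \<Rightarrow> 'c"
    and \<sigma> :: "'p \<Rightarrow> 'h \<Rightarrow> 'c"
  assumes sub: "left_pi_coisotropic_subgroup K G H C act \<sigma>"
begin

interpretation Q: left_pi_coisotropic_subgroup K G H C act \<sigma> by (rule sub)

lemmas coalgebra_H = Q.H.pi_coalgebra_axioms
lemmas component_H = Q.H.component_space and component_C = Q.C.component_space
lemmas index_one = Q.H.G.one_closed

section \<open>Compatibility of the map L with the comultiplication of H\<close>

lemma comult_one_linear:
  assumes "\<alpha> \<in> carrier G"
  shows "comult H \<one>\<^bsub>G\<^esub> \<alpha> \<in> lin (component H \<alpha>) (component H \<one>\<^bsub>G\<^esub> \<boxtimes> component H \<alpha>)"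
  using Q.H.comult_linear[OF index_one assms] assms by simp

lemma ind_L_linear:
  assumes \<alpha>: "\<alpha> \<in> carrier G"
  shows "ind_L K G H C \<sigma> \<alpha> \<in> lin (component H \<alpha>) (component C \<one>\<^bsub>G\<^esub> \<boxtimes> component H \<alpha>)"
  unfolding ind_L_def
  by (rule linear_maps_compose[OF comult_one_linear tensor_map_linear_left])
    (use \<alpha> component_H component_C Q.proj_linear in auto)

text \<open>Coassociativity of \<open>H\<close> at the indices 1, \<alpha>, \<beta>, with \<sigma>
  applied to the first factor; acting there alone, it commutes with \<Delta> on the second
  factor.\<close>

lemma ind_L_coassoc:
  assumes \<alpha>: "\<alpha> \<in> carrier G" and \<beta>: "\<beta> \<in> carrier G" and h: "h \<in> carrier (component H (\<alpha> \<otimes>\<^bsub>G\<^esub> \<beta>))"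
  shows "tassoc (component C \<one>\<^bsub>G\<^esub>) (component H \<alpha>) (component H \<beta>)
      (tmap (component C \<one>\<^bsub>G\<^esub> \<boxtimes> component H \<alpha>) (component H \<beta>) (ind_L K G H C \<sigma> \<alpha>) (\<lambda>x. x) (comult H \<alpha> \<beta> h)) =
    tmap (component C \<one>\<^bsub>G\<^esub>) (component H \<alpha> \<boxtimes> component H \<beta>) (\<lambda>x. x) (comult H \<alpha> \<beta>)
      (ind_L K G H C \<sigma> (\<alpha> \<otimes>\<^bsub>G\<^esub> \<beta>) h)"
proof -
  let ?C = "component C \<one>\<^bsub>G\<^esub>" and ?U = "component H \<one>\<^bsub>G\<^esub>" and ?A = "component H \<alpha>" and ?B = "component H \<beta>"
    and ?\<sigma> = "\<sigma> \<one>\<^bsub>G\<^esub>"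
  note ab = Q.H.G.m_closed[OF \<alpha> \<beta>]
  note mods = component_C[OF index_one] component_H[OF index_one] component_H[OF \<alpha>] component_H[OF \<beta>] component_H[OF ab]
  note \<sigma> = Q.proj_linear[OF index_one] and \<Delta> = Q.H.comult_linear[OF \<alpha> \<beta>]
  note w = linear_maps_closed[OF \<Delta> h]
  have e1: "tmap (?C \<boxtimes> ?A) ?B (ind_L K G H C \<sigma> \<alpha>) (\<lambda>x. x) (comult H \<alpha> \<beta> h) =
      tmap (?C \<boxtimes> ?A) ?B (tmap ?C ?A ?\<sigma> (\<lambda>x. x)) (\<lambda>x. x)
        (tmap (?U \<boxtimes> ?A) ?B (comult H \<one>\<^bsub>G\<^esub> \<alpha>) (\<lambda>x. x) (comult H \<alpha> \<beta> h))"
    unfolding ind_L_def[abs_def]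
    by (rule tensor_map_compose_left[symmetric, OF _ _ _ _ comult_one_linear[OF \<alpha>] tensor_map_linear_left w])
      (use mods \<sigma> in auto)
  have e2: "tassoc ?C ?A ?B (tmap (?C \<boxtimes> ?A) ?B (tmap ?C ?A ?\<sigma> (\<lambda>x. x)) (\<lambda>x. x)
        (tmap (?U \<boxtimes> ?A) ?B (comult H \<one>\<^bsub>G\<^esub> \<alpha>) (\<lambda>x. x) (comult H \<alpha> \<beta> h))) = tmap ?C (?A \<boxtimes> ?B) ?\<sigma> (\<lambda>x. x)
      (tassoc ?U ?A ?B (tmap (?U \<boxtimes> ?A) ?B (comult H \<one>\<^bsub>G\<^esub> \<alpha>) (\<lambda>x. x) (comult H \<alpha> \<beta> h)))"
    by (rule tensor_assoc_natural_left[OF mods(2,3,4,1) \<sigma>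
          linear_maps_closed[OF tensor_map_linear_left[OF mods(3,4) _ comult_one_linear[OF \<alpha>]] w]])
      (use mods in auto)
  have e3: "tassoc ?U ?A ?B (tmap (?U \<boxtimes> ?A) ?B (comult H \<one>\<^bsub>G\<^esub> \<alpha>) (\<lambda>x. x) (comult H \<alpha> \<beta> h)) =
      tmap ?U (?A \<boxtimes> ?B) (\<lambda>x. x) (comult H \<alpha> \<beta>) (comult H \<one>\<^bsub>G\<^esub> (\<alpha> \<otimes>\<^bsub>G\<^esub> \<beta>) h)"
    by (rule Q.H.coassoc[OF index_one \<alpha> \<beta>, unfolded Q.H.G.l_one[OF \<alpha>], OF h])
  have e4: "tmap ?C (?A \<boxtimes> ?B) ?\<sigma> (\<lambda>x. x)
      (tmap ?U (?A \<boxtimes> ?B) (\<lambda>x. x) (comult H \<alpha> \<beta>) (comult H \<one>\<^bsub>G\<^esub> (\<alpha> \<otimes>\<^bsub>G\<^esub> \<beta>) h)) = tmap ?C (?A \<boxtimes> ?B) (\<lambda>x. x) (comult H \<alpha> \<beta>)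
      (ind_L K G H C \<sigma> (\<alpha> \<otimes>\<^bsub>G\<^esub> \<beta>) h)"
    unfolding ind_L_def
    by (rule tensor_map_exchange[symmetric, OF mods(2,5,1) _ \<sigma> \<Delta>
          linear_maps_closed[OF comult_one_linear[OF ab] h]])
      (use mods in auto)
  show ?thesis by (simp only: e1 e2 e3 e4)
qed

section \<open>The comodule induced by a fixed V\<close>

context
  fixes V :: "('p, 'k, 'v, 'c) pi_comodule"
  assumes V: "precomodule G C V"
begin

abbreviation V1 where "V1 \<equiv> fibre V \<one>\<^bsub>G\<^esub>"
abbreviation C1 where "C1 \<equiv> component C \<one>\<^bsub>G\<^esub>"
abbreviation ind_space where "ind_space \<equiv> ind_fibre K G H C \<sigma> V"

lemma fibre_one: "module K V1"
  using V by (simp add: precomodule_def)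

lemma coaction_one: "coaction V \<one>\<^bsub>G\<^esub> \<one>\<^bsub>G\<^esub> \<in> lin V1 (V1 \<boxtimes> C1)"
proof -
  have "coaction V \<one>\<^bsub>G\<^esub> \<one>\<^bsub>G\<^esub> \<in> lin (fibre V (\<one>\<^bsub>G\<^esub> \<otimes>\<^bsub>G\<^esub> \<one>\<^bsub>G\<^esub>)) (V1 \<boxtimes> C1)"
    using V index_one by (auto simp only: precomodule_def)
  then show ?thesis by simp
qed

text \<open>Turns the equation that cuts out the induced fibre into the kernel of a single linear
  map, the form to which \<open>tensor_map_kernel\<close> applies.\<close>

definition ind_defect :: "'p \<Rightarrow> ('k, 'v, 'h) tensor \<Rightarrow> ('k, 'v, ('k, 'c, 'h) tensor) tensor"
  where "ind_defect \<alpha> x =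
    tmap V1 (C1 \<boxtimes> component H \<alpha>) (\<lambda>v. v) (ind_L K G H C \<sigma> \<alpha>) x
    \<ominus>\<^bsub>V1 \<boxtimes> (C1 \<boxtimes> component H \<alpha>)\<^esub>
    tassoc V1 C1 (component H \<alpha>)
      (tmap (V1 \<boxtimes> C1) (component H \<alpha>) (coaction V \<one>\<^bsub>G\<^esub> \<one>\<^bsub>G\<^esub>) (\<lambda>h. h) x)"

lemma ind_left_linear:
  assumes "\<alpha> \<in> carrier G"
  shows "tmap V1 (C1 \<boxtimes> component H \<alpha>) (\<lambda>v. v) (ind_L K G H C \<sigma> \<alpha>)
    \<in> lin (V1 \<boxtimes> component H \<alpha>) (V1 \<boxtimes> (C1 \<boxtimes> component H \<alpha>))"
  by (rule tensor_map_linear_right[OF _ _ _ ind_L_linear]) (use assms fibre_one component_H component_C in auto)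

lemma ind_right_linear:
  assumes "\<alpha> \<in> carrier G"
  shows "(\<lambda>x. tassoc V1 C1 (component H \<alpha>)
      (tmap (V1 \<boxtimes> C1) (component H \<alpha>) (coaction V \<one>\<^bsub>G\<^esub> \<one>\<^bsub>G\<^esub>) (\<lambda>h. h) x))
    \<in> lin (V1 \<boxtimes> component H \<alpha>) (V1 \<boxtimes> (C1 \<boxtimes> component H \<alpha>))"
  by (rule linear_maps_compose[OF tensor_map_linear_left[OF _ _ _ coaction_one] tensor_assoc_linear])
    (use assms fibre_one component_H component_C in auto)

lemma ind_defect_linear:
  assumes "\<alpha> \<in> carrier G"
  shows "ind_defect \<alpha> \<in> lin (V1 \<boxtimes> component H \<alpha>)
    (V1 \<boxtimes> (C1 \<boxtimes> component H \<alpha>))"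
  unfolding ind_defect_def[abs_def]
  by (rule linear_maps_diff_maps[OF _ _ ind_left_linear ind_right_linear])
    (use assms fibre_one component_H component_C in auto)

lemma carrier_ind_fibre:
  assumes "\<alpha> \<in> carrier G"
  shows "x \<in> carrier (ind_space \<alpha>) \<longleftrightarrow> x \<in> carrier (V1 \<boxtimes> component H \<alpha>) \<and>
    tmap V1 (C1 \<boxtimes> component H \<alpha>) (\<lambda>v. v) (ind_L K G H C \<sigma> \<alpha>) x =
    tassoc V1 C1 (component H \<alpha>)
      (tmap (V1 \<boxtimes> C1) (component H \<alpha>) (coaction V \<one>\<^bsub>G\<^esub> \<one>\<^bsub>G\<^esub>) (\<lambda>h. h) x)"
  by (simp add: ind_fibre_def Let_def)

lemma ind_fibre_kernel:
  assumes \<alpha>: "\<alpha> \<in> carrier G"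
  shows "ind_space \<alpha> = (V1 \<boxtimes> component H \<alpha>)\<lparr>carrier :=
    {x \<in> carrier (V1 \<boxtimes> component H \<alpha>).
      ind_defect \<alpha> x = \<zero>\<^bsub>V1 \<boxtimes> (C1 \<boxtimes> component H \<alpha>)\<^esub>}\<rparr>"
proof -
  have m: "module K (V1 \<boxtimes> (C1 \<boxtimes> component H \<alpha>))"
    using \<alpha> fibre_one component_H component_C by simp
  have "ind_defect \<alpha> x = \<zero>\<^bsub>V1 \<boxtimes> (C1 \<boxtimes> component H \<alpha>)\<^esub> \<longleftrightarrow>
      tmap V1 (C1 \<boxtimes> component H \<alpha>) (\<lambda>v. v) (ind_L K G H C \<sigma> \<alpha>) x =
      tassoc V1 C1 (component H \<alpha>)
        (tmap (V1 \<boxtimes> C1) (component H \<alpha>) (coaction V \<one>\<^bsub>G\<^esub> \<one>\<^bsub>G\<^esub>) (\<lambda>h. h) x)"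
    if "x \<in> carrier (V1 \<boxtimes> component H \<alpha>)" for x
    unfolding ind_defect_def
    by (rule module_diff_eq_zero_iff[OF m linear_maps_closed[OF ind_left_linear[OF \<alpha>] that]
          linear_maps_closed[OF ind_right_linear[OF \<alpha>] that]])
  then show ?thesis
    by (simp add: ind_fibre_def Let_def cong: conj_cong)
qed

lemmas ind_fibre_submodule = kernel_submodule[OF _ _ ind_defect_linear]

lemma module_ind_fibre:
  assumes "\<alpha> \<in> carrier G"
  shows "module K (ind_space \<alpha>)"
  unfolding ind_fibre_kernel[OF assms]
  by (rule module_restrict[OF _ ind_fibre_submodule]) (use assms fibre_one component_H component_C in auto)

lemma ind_inclusion:
  assumes "\<alpha> \<in> carrier G"
  shows "(\<lambda>x. x) \<in> lin (ind_space \<alpha>) (V1 \<boxtimes> component H \<alpha>)"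
  unfolding ind_fibre_kernel[OF assms]
  by (rule submodule_inclusion[OF _ ind_fibre_submodule]) (use assms fibre_one component_H component_C in auto)

text \<open>The inverse associator in \<open>cofree\<close> cancels. This puts the cofree coaction
  in the form in which \<open>Ind\<close> prescribes its own coaction.\<close>

lemma cofree_coaction:
  assumes "\<alpha> \<in> carrier G" "\<beta> \<in> carrier G" "x \<in> carrier (V1 \<boxtimes> component H (\<alpha> \<otimes>\<^bsub>G\<^esub> \<beta>))"
  shows "coaction (cofree V1 H) \<alpha> \<beta> x \<in>
      carrier ((V1 \<boxtimes> component H \<alpha>) \<boxtimes> component H \<beta>)"
    and "tassoc V1 (component H \<alpha>) (component H \<beta>) (coaction (cofree V1 H) \<alpha> \<beta> x) =
      tmap V1 (component H \<alpha> \<boxtimes> component H \<beta>) (\<lambda>v. v) (comult H \<alpha> \<beta>) x"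
proof -
  have m: "module K V1" "module K (component H \<alpha>)" "module K (component H \<beta>)"
    "module K (component H (\<alpha> \<otimes>\<^bsub>G\<^esub> \<beta>))"
    using assms fibre_one component_H by simp_all
  have "tmap V1 (component H \<alpha> \<boxtimes> component H \<beta>) (\<lambda>v. v) (comult H \<alpha> \<beta>) x \<in>
      carrier (V1 \<boxtimes> (component H \<alpha> \<boxtimes> component H \<beta>))"
    using m by (intro linear_maps_closed[OF tensor_map_linear_right[OF _ _ _ Q.H.comult_linear[OF assms(1,2)]] assms(3)]) auto
  then show "coaction (cofree V1 H) \<alpha> \<beta> x \<in>
      carrier ((V1 \<boxtimes> component H \<alpha>) \<boxtimes> component H \<beta>)"
    "tassoc V1 (component H \<alpha>) (component H \<beta>) (coaction (cofree V1 H) \<alpha> \<beta> x) =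
      tmap V1 (component H \<alpha> \<boxtimes> component H \<beta>) (\<lambda>v. v) (comult H \<alpha> \<beta>) x"
    using m by (simp_all add: cofree_def tensor_assoc_inv_closed tensor_assoc_inv_right)
qed

text \<open>
  The two components of the defect are compared in \<open>V\<^sub>1 \<otimes> (C\<^sub>1 \<otimes> (H\<^sub>\<alpha> \<otimes> H\<^sub>\<beta>))\<close>, where both become
  \<open>I \<otimes> (I \<otimes> \<Delta>\<^sub>\<alpha>\<^sub>,\<^sub>\<beta>)\<close> applied to the two sides of the equation that defines \<open>Ind(\<rho>)\<^sub>\<alpha>\<^sub>\<beta>\<close>.
\<close>

lemma ind_defect_coaction:
  assumes \<alpha>: "\<alpha> \<in> carrier G" and \<beta>: "\<beta> \<in> carrier G"
    and x: "x \<in> carrier (ind_space (\<alpha> \<otimes>\<^bsub>G\<^esub> \<beta>))"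
  shows "tmap (V1 \<boxtimes> (C1 \<boxtimes> component H \<alpha>)) (component H \<beta>) (ind_defect \<alpha>) (\<lambda>h. h)
      (coaction (cofree V1 H) \<alpha> \<beta> x) =
    \<zero>\<^bsub>(V1 \<boxtimes> (C1 \<boxtimes> component H \<alpha>)) \<boxtimes> component H \<beta>\<^esub>"
proof -
  let ?V = V1 and ?C = C1 and ?A = "component H \<alpha>" and ?B = "component H \<beta>"
    and ?AB = "component H (\<alpha> \<otimes>\<^bsub>G\<^esub> \<beta>)" and ?\<rho> = "coaction V \<one>\<^bsub>G\<^esub> \<one>\<^bsub>G\<^esub>"
  let ?L = "\<lambda>\<alpha>. tmap ?V (?C \<boxtimes> component H \<alpha>) (\<lambda>v. v) (ind_L K G H C \<sigma> \<alpha>)"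
  let ?R = "\<lambda>\<alpha> x. tassoc ?V ?C (component H \<alpha>) (tmap (?V \<boxtimes> ?C) (component H \<alpha>) ?\<rho> (\<lambda>h. h) x)"
  note ab = Q.H.G.m_closed[OF \<alpha> \<beta>]
  note m = fibre_one component_C[OF index_one] component_H[OF \<alpha>] component_H[OF \<beta>] component_H[OF ab]
  note \<Delta> = Q.H.comult_linear[OF \<alpha> \<beta>]
  define z where "z = coaction (cofree ?V H) \<alpha> \<beta> x"
  have xV: "x \<in> carrier (?V \<boxtimes> ?AB)" and LR: "?L (\<alpha> \<otimes>\<^bsub>G\<^esub> \<beta>) x = ?R (\<alpha> \<otimes>\<^bsub>G\<^esub> \<beta>) x"
    using x by (simp_all add: carrier_ind_fibre[OF ab])
  have z: "z \<in> carrier ((?V \<boxtimes> ?A) \<boxtimes> ?B)"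
    and az: "tassoc ?V ?A ?B z = tmap ?V (?A \<boxtimes> ?B) (\<lambda>v. v) (comult H \<alpha> \<beta>) x"
    unfolding z_def by (rule cofree_coaction[OF \<alpha> \<beta> xV])+
  have P: "module K (?V \<boxtimes> (?C \<boxtimes> ?A))" using m by simp
  \<comment> \<open>The rebracketing that leads to the space of comparison. Undoing its two
    associators in the opposite order shows it injective, which brings the equation back.\<close>
  let ?\<Theta> = "\<lambda>t. tmap ?V (?C \<boxtimes> (?A \<boxtimes> ?B)) (\<lambda>v. v) (tassoc ?C ?A ?B) (tassoc ?V (?C \<boxtimes> ?A) ?B t)"
  have inj: "inj_on ?\<Theta> (carrier ((?V \<boxtimes> (?C \<boxtimes> ?A)) \<boxtimes> ?B))"
  proof (rule inj_on_inverseI)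
    fix t assume t: "t \<in> carrier ((?V \<boxtimes> (?C \<boxtimes> ?A)) \<boxtimes> ?B)"
    have t': "tassoc ?V (?C \<boxtimes> ?A) ?B t \<in> carrier (?V \<boxtimes> ((?C \<boxtimes> ?A) \<boxtimes> ?B))"
      using t m by (simp add: tensor_assoc_closed)
    have "tmap ?V ((?C \<boxtimes> ?A) \<boxtimes> ?B) (\<lambda>v. v) (tensor_assoc_inv ?C ?A ?B) (?\<Theta> t) =
        tmap ?V ((?C \<boxtimes> ?A) \<boxtimes> ?B) (\<lambda>v. v) (\<lambda>s. tensor_assoc_inv ?C ?A ?B (tassoc ?C ?A ?B s))
          (tassoc ?V (?C \<boxtimes> ?A) ?B t)"
      by (rule tensor_map_compose_right[OF _ _ _ _ tensor_assoc_linear tensor_assoc_inv_linear t']) (use m in auto)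
    also have "\<dots> = tmap ?V ((?C \<boxtimes> ?A) \<boxtimes> ?B) (\<lambda>v. v) (\<lambda>s. s) (tassoc ?V (?C \<boxtimes> ?A) ?B t)"
      by (rule tensor_map_cong[OF _ _ _ _ linear_maps_id linear_maps_id _ _ t'])
        (use m in \<open>simp_all add: tensor_assoc_inv_left\<close>)
    also have "\<dots> = tassoc ?V (?C \<boxtimes> ?A) ?B t"
      using m t' by (simp add: tensor_map_id)
    finally show "tensor_assoc_inv ?V (?C \<boxtimes> ?A) ?B
        (tmap ?V ((?C \<boxtimes> ?A) \<boxtimes> ?B) (\<lambda>v. v) (tensor_assoc_inv ?C ?A ?B) (?\<Theta> t)) = t"
      using m t by (simp add: tensor_assoc_inv_left)
  qed
  have L: "?\<Theta> (tmap (?V \<boxtimes> (?C \<boxtimes> ?A)) ?B (?L \<alpha>) (\<lambda>h. h) z) =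
      tmap ?V (?C \<boxtimes> (?A \<boxtimes> ?B)) (\<lambda>v. v) (tmap ?C (?A \<boxtimes> ?B) (\<lambda>c. c) (comult H \<alpha> \<beta>)) (?L (\<alpha> \<otimes>\<^bsub>G\<^esub> \<beta>) x)"
  proof -
    have "tassoc ?V (?C \<boxtimes> ?A) ?B (tmap (?V \<boxtimes> (?C \<boxtimes> ?A)) ?B (?L \<alpha>) (\<lambda>h. h) z) =
        tmap ?V ((?C \<boxtimes> ?A) \<boxtimes> ?B) (\<lambda>v. v) (tmap (?C \<boxtimes> ?A) ?B (ind_L K G H C \<sigma> \<alpha>) (\<lambda>h. h)) (tassoc ?V ?A ?B z)"
      by (rule tensor_assoc_natural_mid[OF _ _ _ _ ind_L_linear[OF \<alpha>] z]) (use m in auto)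
    also have "\<dots> = tmap ?V ((?C \<boxtimes> ?A) \<boxtimes> ?B) (\<lambda>v. v)
        (\<lambda>h. tmap (?C \<boxtimes> ?A) ?B (ind_L K G H C \<sigma> \<alpha>) (\<lambda>h. h) (comult H \<alpha> \<beta> h)) x"
      unfolding az
      by (rule tensor_map_compose_right[OF _ _ _ _ \<Delta> tensor_map_linear_left[OF _ _ _ ind_L_linear[OF \<alpha>]] xV])
        (use m in auto)
    finally have e1: "?\<Theta> (tmap (?V \<boxtimes> (?C \<boxtimes> ?A)) ?B (?L \<alpha>) (\<lambda>h. h) z) =
        tmap ?V (?C \<boxtimes> (?A \<boxtimes> ?B)) (\<lambda>v. v) (tassoc ?C ?A ?B)
          (tmap ?V ((?C \<boxtimes> ?A) \<boxtimes> ?B) (\<lambda>v. v) (\<lambda>h. tmap (?C \<boxtimes> ?A) ?B (ind_L K G H C \<sigma> \<alpha>) (\<lambda>h. h) (comult H \<alpha> \<beta> h)) x)"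
      by simp
    have e2: "tmap ?V (?C \<boxtimes> (?A \<boxtimes> ?B)) (\<lambda>v. v) (tassoc ?C ?A ?B)
          (tmap ?V ((?C \<boxtimes> ?A) \<boxtimes> ?B) (\<lambda>v. v) (\<lambda>h. tmap (?C \<boxtimes> ?A) ?B (ind_L K G H C \<sigma> \<alpha>) (\<lambda>h. h) (comult H \<alpha> \<beta> h)) x) =
        tmap ?V (?C \<boxtimes> (?A \<boxtimes> ?B)) (\<lambda>v. v) (\<lambda>h. tassoc ?C ?A ?B
          (tmap (?C \<boxtimes> ?A) ?B (ind_L K G H C \<sigma> \<alpha>) (\<lambda>h. h) (comult H \<alpha> \<beta> h))) x"
      by (rule tensor_map_compose_right[OF _ _ _ _
            linear_maps_compose[OF \<Delta> tensor_map_linear_left[OF _ _ _ ind_L_linear[OF \<alpha>]]] tensor_assoc_linear xV])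
        (use m in auto)
    \<comment> \<open>Inside the second factor, \<open>ind_L_coassoc\<close> replaces L applied
      after \<Delta> by \<Delta> applied after L.\<close>
    have e3: "tmap ?V (?C \<boxtimes> (?A \<boxtimes> ?B)) (\<lambda>v. v) (\<lambda>h. tassoc ?C ?A ?B
          (tmap (?C \<boxtimes> ?A) ?B (ind_L K G H C \<sigma> \<alpha>) (\<lambda>h. h) (comult H \<alpha> \<beta> h))) x =
        tmap ?V (?C \<boxtimes> (?A \<boxtimes> ?B)) (\<lambda>v. v) (\<lambda>h. tmap ?C (?A \<boxtimes> ?B) (\<lambda>c. c) (comult H \<alpha> \<beta>)
        (ind_L K G H C \<sigma> (\<alpha> \<otimes>\<^bsub>G\<^esub> \<beta>) h)) x"
      by (rule tensor_map_cong[OF _ _ _ _ linear_maps_id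
            linear_maps_compose[OF ind_L_linear[OF ab] tensor_map_linear_right[OF _ _ _ \<Delta>]] _ _ xV])
        (use m ind_L_coassoc[OF \<alpha> \<beta>] in auto)
    have e4: "tmap ?V (?C \<boxtimes> (?A \<boxtimes> ?B)) (\<lambda>v. v) (\<lambda>h. tmap ?C (?A \<boxtimes> ?B) (\<lambda>c. c) (comult H \<alpha> \<beta>)
        (ind_L K G H C \<sigma> (\<alpha> \<otimes>\<^bsub>G\<^esub> \<beta>) h)) x =
        tmap ?V (?C \<boxtimes> (?A \<boxtimes> ?B)) (\<lambda>v. v) (tmap ?C (?A \<boxtimes> ?B) (\<lambda>c. c) (comult H \<alpha> \<beta>))
        (?L (\<alpha> \<otimes>\<^bsub>G\<^esub> \<beta>) x)"
      by (rule tensor_map_compose_right[symmetric, OF _ _ _ _ ind_L_linear[OF ab]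
            tensor_map_linear_right[OF _ _ _ \<Delta>] xV])
        (use m in auto)
    show ?thesis unfolding e1 e2 e3 e4 ..
  qed
  have R: "?\<Theta> (tmap (?V \<boxtimes> (?C \<boxtimes> ?A)) ?B (?R \<alpha>) (\<lambda>h. h) z) =
      tmap ?V (?C \<boxtimes> (?A \<boxtimes> ?B)) (\<lambda>v. v) (tmap ?C (?A \<boxtimes> ?B) (\<lambda>c. c) (comult H \<alpha> \<beta>)) (?R (\<alpha> \<otimes>\<^bsub>G\<^esub> \<beta>) x)"
  proof -
    note \<rho>A = tensor_map_linear_left[OF m(1,3) _ coaction_one]
    define u where "u = tmap ((?V \<boxtimes> ?C) \<boxtimes> ?A) ?B (tmap (?V \<boxtimes> ?C) ?A ?\<rho> (\<lambda>h. h)) (\<lambda>h. h) z"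
    have u: "u \<in> carrier (((?V \<boxtimes> ?C) \<boxtimes> ?A) \<boxtimes> ?B)"
      unfolding u_def by (rule linear_maps_closed[OF tensor_map_linear_left[OF _ _ _ \<rho>A] z]) (use m in auto)
    have "tmap (?V \<boxtimes> (?C \<boxtimes> ?A)) ?B (?R \<alpha>) (\<lambda>h. h) z =
        tmap (?V \<boxtimes> (?C \<boxtimes> ?A)) ?B (tassoc ?V ?C ?A) (\<lambda>h. h) u"
      unfolding u_def
      by (rule tensor_map_compose_left[symmetric, OF _ _ _ _ \<rho>A tensor_assoc_linear z]) (use m in auto)
    \<comment> \<open>The pentagon read from right to left: three associators shrink to two, after
      which \<rho> acts on the first factor alone and commutes with I \<otimes> \<Delta>.\<close>
    then have e1: "?\<Theta> (tmap (?V \<boxtimes> (?C \<boxtimes> ?A)) ?B (?R \<alpha>) (\<lambda>h. h) z) =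
        tassoc ?V ?C (?A \<boxtimes> ?B) (tassoc (?V \<boxtimes> ?C) ?A ?B u)"
      using tensor_assoc_pentagon[OF m(1-4) u] by simp
    have "tassoc (?V \<boxtimes> ?C) ?A ?B u = tmap (?V \<boxtimes> ?C) (?A \<boxtimes> ?B) ?\<rho> (\<lambda>s. s) (tassoc ?V ?A ?B z)"
      unfolding u_def by (rule tensor_assoc_natural_left[OF _ _ _ _ coaction_one z]) (use m in auto)
    also have "\<dots> = tmap (?V \<boxtimes> ?C) (?A \<boxtimes> ?B) (\<lambda>v. v) (comult H \<alpha> \<beta>) (tmap (?V \<boxtimes> ?C) ?AB ?\<rho> (\<lambda>h. h) x)"
      unfolding az
      by (rule tensor_map_exchange[symmetric, OF _ _ _ _ coaction_one \<Delta> xV]) (use m in auto)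
    finally have e2: "tassoc (?V \<boxtimes> ?C) ?A ?B u = tmap (?V \<boxtimes> ?C) (?A \<boxtimes> ?B) (\<lambda>v. v) (comult H \<alpha> \<beta>) (tmap (?V \<boxtimes> ?C) ?AB ?\<rho> (\<lambda>h. h) x)" .
    have e3: "tassoc ?V ?C (?A \<boxtimes> ?B) (tmap (?V \<boxtimes> ?C) (?A \<boxtimes> ?B) (\<lambda>v. v) (comult H \<alpha> \<beta>) (tmap (?V \<boxtimes> ?C) ?AB ?\<rho> (\<lambda>h. h) x)) =
        tmap ?V (?C \<boxtimes> (?A \<boxtimes> ?B)) (\<lambda>v. v) (tmap ?C (?A \<boxtimes> ?B) (\<lambda>c. c) (comult H \<alpha> \<beta>)) (?R (\<alpha> \<otimes>\<^bsub>G\<^esub> \<beta>) x)"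
      by (rule tensor_assoc_natural_right[OF _ _ _ _ \<Delta>
            linear_maps_closed[OF tensor_map_linear_left[OF _ _ _ coaction_one] xV]]) (use m in auto)
    show ?thesis unfolding e1 e2 by (rule e3)
  qed
  note Lz = linear_maps_closed[OF tensor_map_linear_left[OF _ m(4) P ind_left_linear[OF \<alpha>]] z]
  note Rz = linear_maps_closed[OF tensor_map_linear_left[OF _ m(4) P ind_right_linear[OF \<alpha>]] z]
  have eq: "tmap (?V \<boxtimes> (?C \<boxtimes> ?A)) ?B (?L \<alpha>) (\<lambda>h. h) z = tmap (?V \<boxtimes> (?C \<boxtimes> ?A)) ?B (?R \<alpha>) (\<lambda>h. h) z"
    by (rule inj_onD[OF inj]) (use L R LR Lz Rz m in auto)
  have "tmap (?V \<boxtimes> (?C \<boxtimes> ?A)) ?B (ind_defect \<alpha>) (\<lambda>h. h) z =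
      tmap (?V \<boxtimes> (?C \<boxtimes> ?A)) ?B (?L \<alpha>) (\<lambda>h. h) z \<ominus>\<^bsub>(?V \<boxtimes> (?C \<boxtimes> ?A)) \<boxtimes> ?B\<^esub>
      tmap (?V \<boxtimes> (?C \<boxtimes> ?A)) ?B (?R \<alpha>) (\<lambda>h. h) z"
    unfolding ind_defect_def[abs_def]
    by (rule tensor_map_diff_left[OF _ _ _ _ ind_left_linear[OF \<alpha>] ind_right_linear[OF \<alpha>] linear_maps_id z])
      (use m in auto)
  also have "\<dots> = \<zero>\<^bsub>(?V \<boxtimes> (?C \<boxtimes> ?A)) \<boxtimes> ?B\<^esub>"
    unfolding eq using Rz m by (subst module_diff_eq_zero_iff) auto
  finally show ?thesis by (simp add: z_def)
qed

text \<open>An injective associator after the inclusion of the fibre tensored with the identity. It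
  gives the uniqueness behind \<open>THE\<close> in \<open>Ind\<close> and is the test by which
  linearity and naturality of the coaction are verified.\<close>

lemma ind_embedding_inj:
  assumes "\<alpha> \<in> carrier G" "\<beta> \<in> carrier G"
  shows "inj_on (\<lambda>y. tassoc V1 (component H \<alpha>) (component H \<beta>)
      (tmap (V1 \<boxtimes> component H \<alpha>) (component H \<beta>) (\<lambda>z. z) (\<lambda>h. h) y))
    (carrier (ind_space \<alpha> \<boxtimes> component H \<beta>))"
proof (rule inj_onI)
  let ?V = V1 and ?A = "component H \<alpha>" and ?B = "component H \<beta>"
  fix y y' assume y: "y \<in> carrier (ind_space \<alpha> \<boxtimes> ?B)"
    and y': "y' \<in> carrier (ind_space \<alpha> \<boxtimes> ?B)"
    and eq: "tassoc ?V ?A ?B (tmap (?V \<boxtimes> ?A) ?B (\<lambda>z. z) (\<lambda>h. h) y) =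
      tassoc ?V ?A ?B (tmap (?V \<boxtimes> ?A) ?B (\<lambda>z. z) (\<lambda>h. h) y')"
  note m = fibre_one component_C[OF index_one] component_H[OF assms(1)] component_H[OF assms(2)]
  have VA: "module K (?V \<boxtimes> ?A)" using m by simp
  note incl = tensor_map_linear_left[OF module_ind_fibre[OF assms(1)] m(4) VA ind_inclusion[OF assms(1)]]
  have "tmap (?V \<boxtimes> ?A) ?B (\<lambda>z. z) (\<lambda>h. h) y = tmap (?V \<boxtimes> ?A) ?B (\<lambda>z. z) (\<lambda>h. h) y'"
    using inj_onD[OF tensor_assoc_inj[OF m(1,3,4)] eq] linear_maps_closed[OF incl y] linear_maps_closed[OF incl y']
    by simp
  then show "y = y'"
    using inj_onD[OF tensor_map_inclusion_inj[OF VA m(4) ind_fibre_submodule[OF VA _ assms(1)]]]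
      y y' m unfolding ind_fibre_kernel[OF assms(1)] by simp
qed

lemma Ind_simps:
  "fibre (Ind K G H C \<sigma> V) = ind_space"
  "coaction (Ind K G H C \<sigma> V) \<alpha> \<beta> x =
    (THE y. y \<in> carrier (ind_space \<alpha> \<boxtimes> component H \<beta>) \<and>
      tassoc V1 (component H \<alpha>) (component H \<beta>)
        (tmap (V1 \<boxtimes> component H \<alpha>) (component H \<beta>) (\<lambda>z. z) (\<lambda>h. h) y) =
      tmap V1 (component H \<alpha> \<boxtimes> component H \<beta>) (\<lambda>v. v) (comult H \<alpha> \<beta>) x)"
  by (simp_all add: Ind_def Let_def)

text \<open>By \<open>ind_defect_coaction\<close> the cofree coaction of \<open>x\<close> is
  annihilated by the defect tensored with I, so \<open>tensor_map_kernel\<close> supplies a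
  preimage; \<open>ind_embedding_inj\<close> makes it unique. These two facts replace the
  description operator from here on.\<close>

lemma Ind_coaction:
  assumes \<alpha>: "\<alpha> \<in> carrier G" and \<beta>: "\<beta> \<in> carrier G"
    and x: "x \<in> carrier (ind_space (\<alpha> \<otimes>\<^bsub>G\<^esub> \<beta>))"
  shows "coaction (Ind K G H C \<sigma> V) \<alpha> \<beta> x \<in> carrier (ind_space \<alpha> \<boxtimes> component H \<beta>)"
    and "tassoc V1 (component H \<alpha>) (component H \<beta>)
        (tmap (V1 \<boxtimes> component H \<alpha>) (component H \<beta>) (\<lambda>z. z) (\<lambda>h. h)
          (coaction (Ind K G H C \<sigma> V) \<alpha> \<beta> x)) =
      tmap V1 (component H \<alpha> \<boxtimes> component H \<beta>) (\<lambda>v. v) (comult H \<alpha> \<beta>) x"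
proof -
  let ?V = V1 and ?A = "component H \<alpha>" and ?B = "component H \<beta>"
  let ?P = "\<lambda>y. y \<in> carrier (ind_space \<alpha> \<boxtimes> component H \<beta>) \<and>
    tassoc ?V ?A ?B (tmap (?V \<boxtimes> ?A) ?B (\<lambda>z. z) (\<lambda>h. h) y) =
    tmap ?V (?A \<boxtimes> ?B) (\<lambda>v. v) (comult H \<alpha> \<beta>) x"
  note m = fibre_one component_C[OF index_one] component_H[OF \<alpha>] component_H[OF \<beta>]
  have xV: "x \<in> carrier (?V \<boxtimes> component H (\<alpha> \<otimes>\<^bsub>G\<^esub> \<beta>))"
    using x \<alpha> \<beta> by (simp add: carrier_ind_fibre)
  obtain y where y: "y \<in> carrier (ind_space \<alpha> \<boxtimes> ?B)"
    "tmap (?V \<boxtimes> ?A) ?B (\<lambda>x. x) (\<lambda>x. x) y = coaction (cofree ?V H) \<alpha> \<beta> x"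
    using tensor_map_kernel[OF _ m(4) _ ind_defect_linear[OF \<alpha>] cofree_coaction(1)[OF \<alpha> \<beta> xV]
        ind_defect_coaction[OF \<alpha> \<beta> x]] m
    unfolding ind_fibre_kernel[OF \<alpha>] by auto
  have "?P y" using y cofree_coaction(2)[OF \<alpha> \<beta> xV] by simp
  moreover have "y' = y" if "?P y'" for y'
    using inj_onD[OF ind_embedding_inj[OF \<alpha> \<beta>], of y' y] that \<open>?P y\<close> by simp
  ultimately have "?P (THE y. ?P y)" by (rule theI)
  then show "coaction (Ind K G H C \<sigma> V) \<alpha> \<beta> x \<in> carrier (ind_space \<alpha> \<boxtimes> ?B)"
    "tassoc ?V ?A ?B (tmap (?V \<boxtimes> ?A) ?B (\<lambda>z. z) (\<lambda>h. h) (coaction (Ind K G H C \<sigma> V) \<alpha> \<beta> x)) =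
      tmap ?V (?A \<boxtimes> ?B) (\<lambda>v. v) (comult H \<alpha> \<beta>) x"
    unfolding Ind_simps by blast+
qed

text \<open>The coaction \<theta> satisfies E \<theta> = D with \<open>?E\<close> and
  \<open>?D\<close> linear and \<open>?E\<close> injective, so \<theta> inherits linearity.\<close>

lemma precomodule_Ind: "precomodule G H (Ind K G H C \<sigma> V)"
proof -
  have "coaction (Ind K G H C \<sigma> V) \<alpha> \<beta> \<in> lin (ind_space (\<alpha> \<otimes>\<^bsub>G\<^esub> \<beta>))
      (ind_space \<alpha> \<boxtimes> component H \<beta>)"
    if \<alpha>: "\<alpha> \<in> carrier G" and \<beta>: "\<beta> \<in> carrier G" for \<alpha> \<beta>
  proof -
    let ?V = V1 and ?A = "component H \<alpha>" and ?B = "component H \<beta>"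
      and ?I = "ind_space \<alpha>"
    let ?E = "\<lambda>y. tassoc ?V ?A ?B (tmap (?V \<boxtimes> ?A) ?B (\<lambda>z. z) (\<lambda>h. h) y)"
    let ?D = "tmap ?V (?A \<boxtimes> ?B) (\<lambda>v. v) (comult H \<alpha> \<beta>)"
    let ?\<theta> = "coaction (Ind K G H C \<sigma> V) \<alpha> \<beta>"
    note ab = Q.H.G.m_closed[OF \<alpha> \<beta>]
    note m = fibre_one component_H[OF \<alpha>] component_H[OF \<beta>] component_H[OF ab]
    interpret I: module K "ind_space (\<alpha> \<otimes>\<^bsub>G\<^esub> \<beta>)" by (rule module_ind_fibre[OF ab])
    interpret T: module K "?I \<boxtimes> ?B" using module_ind_fibre[OF \<alpha>] m by simp
    have E: "?E \<in> lin (?I \<boxtimes> ?B) (?V \<boxtimes> (?A \<boxtimes> ?B))"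
      by (rule linear_maps_compose[OF tensor_map_linear_left[OF _ _ _ ind_inclusion[OF \<alpha>]] tensor_assoc_linear])
        (use m module_ind_fibre[OF \<alpha>] in auto)
    have D: "?D \<in> lin (ind_space (\<alpha> \<otimes>\<^bsub>G\<^esub> \<beta>)) (?V \<boxtimes> (?A \<boxtimes> ?B))"
      by (rule linear_maps_compose[OF ind_inclusion[OF ab] tensor_map_linear_right[OF _ _ _ Q.H.comult_linear[OF \<alpha> \<beta>]]])
        (use m in auto)
    note inj = inj_onD[OF ind_embedding_inj[OF \<alpha> \<beta>]]
    note co = Ind_coaction[OF \<alpha> \<beta>]
    show ?thesis
    proof (rule linear_mapsI)
      fix x y assume "x \<in> carrier (ind_space (\<alpha> \<otimes>\<^bsub>G\<^esub> \<beta>))" "y \<in> carrier (ind_space (\<alpha> \<otimes>\<^bsub>G\<^esub> \<beta>))"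
      then show "?\<theta> (x \<oplus>\<^bsub>ind_space (\<alpha> \<otimes>\<^bsub>G\<^esub> \<beta>)\<^esub> y) = ?\<theta> x \<oplus>\<^bsub>?I \<boxtimes> ?B\<^esub> ?\<theta> y"
        by (intro inj) (simp_all add: co linear_maps_add[OF E] linear_maps_add[OF D])
    next
      fix a x assume "a \<in> carrier K" "x \<in> carrier (ind_space (\<alpha> \<otimes>\<^bsub>G\<^esub> \<beta>))"
      then show "?\<theta> (a \<odot>\<^bsub>ind_space (\<alpha> \<otimes>\<^bsub>G\<^esub> \<beta>)\<^esub> x) = a \<odot>\<^bsub>?I \<boxtimes> ?B\<^esub> ?\<theta> x"
        by (intro inj) (simp_all add: co linear_maps_smult[OF E] linear_maps_smult[OF D])
    qed (rule co)
  qed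
  then show ?thesis
    using module_ind_fibre by (simp add: precomodule_def Ind_simps)
qed

lemma right_pi_comodule_Ind: "right_pi_comodule K G H (Ind K G H C \<sigma> V)"
proof (rule subcomodule[OF coalgebra_H right_pi_comodule_cofree[OF coalgebra_H fibre_one] precomodule_Ind])
  let ?V = V1
  show "fibre (Ind K G H C \<sigma> V) \<alpha> = fibre (cofree ?V H) \<alpha>\<lparr>carrier :=
      {x \<in> carrier (?V \<boxtimes> component H \<alpha>).
        ind_defect \<alpha> x = \<zero>\<^bsub>?V \<boxtimes> (C1 \<boxtimes> component H \<alpha>)\<^esub>}\<rparr>"
    if "\<alpha> \<in> carrier G" for \<alpha>
    by (simp add: Ind_simps ind_fibre_kernel[OF that] cofree_def)
  show "submodule {x \<in> carrier (?V \<boxtimes> component H \<alpha>).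
        ind_defect \<alpha> x = \<zero>\<^bsub>?V \<boxtimes> (C1 \<boxtimes> component H \<alpha>)\<^esub>} K (fibre (cofree ?V H) \<alpha>)"
    if "\<alpha> \<in> carrier G" for \<alpha>
    using ind_fibre_submodule[OF _ _ that] fibre_one component_H[OF that] component_C[OF index_one] by (simp add: cofree_def)
  show "comodule_morphism G H (Ind K G H C \<sigma> V) (cofree ?V H) (\<lambda>\<alpha> x. x)"
    unfolding comodule_morphism_def Ind_simps(1)
  proof (intro conjI ballI)
    fix \<alpha> assume "\<alpha> \<in> carrier G"
    then show "(\<lambda>x. x) \<in> lin (ind_space \<alpha>) (fibre (cofree ?V H) \<alpha>)"
      using ind_inclusion by (simp add: cofree_def)
  next
    fix \<alpha> \<beta> x assume G: "\<alpha> \<in> carrier G" "\<beta> \<in> carrier G"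
      and x: "x \<in> carrier (ind_space (\<alpha> \<otimes>\<^bsub>G\<^esub> \<beta>))"
    let ?A = "component H \<alpha>" and ?B = "component H \<beta>"
    note m = fibre_one component_H[OF G(1)] component_H[OF G(2)]
    have VA: "module K (?V \<boxtimes> ?A)" using m by simp
    have xV: "x \<in> carrier (?V \<boxtimes> component H (\<alpha> \<otimes>\<^bsub>G\<^esub> \<beta>))"
      using x G by (simp add: carrier_ind_fibre)
    note incl = tensor_map_linear_left[OF module_ind_fibre[OF G(1)] m(3) VA ind_inclusion[OF G(1)]]
    \<comment> \<open>Both coactions are characterised by what the associator makes of them, so they
      are compared after it.\<close>
    have "coaction (cofree ?V H) \<alpha> \<beta> x =
        tmap (?V \<boxtimes> ?A) ?B (\<lambda>x. x) (\<lambda>c. c) (coaction (Ind K G H C \<sigma> V) \<alpha> \<beta> x)"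
      by (rule inj_onD[OF tensor_assoc_inj[OF m]])
        (simp_all add: cofree_coaction[OF G xV] Ind_coaction[OF G x]
          linear_maps_closed[OF incl Ind_coaction(1)[OF G x]])
    then show "coaction (cofree ?V H) \<alpha> \<beta> x =
        tmap (fibre (cofree ?V H) \<alpha>) ?B (\<lambda>x. x) (\<lambda>c. c) (coaction (Ind K G H C \<sigma> V) \<alpha> \<beta> x)"
      by (simp add: cofree_def)
  qed
qed

end

end

text \<open>All fibres of \<open>Ind\<close> are built from the fibre at 1, so the component \<phi>
  of \<open>F\<close> at 1 serves for every \<alpha>. The defining equation is preserved: \<phi>
  commutes with I \<otimes> L since they act on different factors, and it is compatible with the
  coactions since \<open>F\<close> is a morphism.\<close>

lemma Ind_morphism:
  fixes G :: "'p monoid" and H :: "('p, 'k, 'h) hopf_pi_coalgebra"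
    and C :: "('p, 'k, 'c) pi_coalgebra"
    and V :: "('p, 'k, 'v, 'c) pi_comodule" and W :: "('p, 'k, 'w, 'c) pi_comodule"
  assumes sub: "left_pi_coisotropic_subgroup K G H C act \<sigma>"
    and V: "precomodule G C V" and W: "precomodule G C W" and F: "comodule_morphism G C V W F"
  shows "comodule_morphism G H (Ind K G H C \<sigma> V) (Ind K G H C \<sigma> W)
    (\<lambda>\<alpha>. tmap (fibre W \<one>\<^bsub>G\<^esub>) (component H \<alpha>) (F \<one>\<^bsub>G\<^esub>) (\<lambda>h. h))"
proof -
  interpret Q: left_pi_coisotropic_subgroup K G H C act \<sigma> by (rule sub)
  let ?V = "fibre V \<one>\<^bsub>G\<^esub>" and ?W = "fibre W \<one>\<^bsub>G\<^esub>" and ?C = "component C \<one>\<^bsub>G\<^esub>"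
    and ?H = "component H" and ?\<phi> = "F \<one>\<^bsub>G\<^esub>"
    and ?\<rho> = "coaction V \<one>\<^bsub>G\<^esub> \<one>\<^bsub>G\<^esub>" and ?\<psi> = "coaction W \<one>\<^bsub>G\<^esub> \<one>\<^bsub>G\<^esub>"
  let ?\<Phi> = "\<lambda>\<alpha>. tmap ?W (?H \<alpha>) ?\<phi> (\<lambda>h. h)"
  note one = Q.H.G.one_closed
  note mods = fibre_one[OF sub V] fibre_one[OF sub W] Q.C.component_space[OF one]
  note compH = Q.H.component_space
  note \<phi> = morphism_linear[OF Q.C.pi_coalgebra_axioms V W F one]
  have \<phi>_co: "?\<psi> (?\<phi> v) = tmap ?W ?C ?\<phi> (\<lambda>c. c) (?\<rho> v)" if "v \<in> carrier ?V" for v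
    using morphism_coaction[OF Q.C.pi_coalgebra_axioms V W F one one, of v] that by simp
  note \<rho> = coaction_one[OF sub V] and \<psi> = coaction_one[OF sub W]
  have \<Phi>: "?\<Phi> \<alpha> \<in> lin (?V \<boxtimes> ?H \<alpha>) (?W \<boxtimes> ?H \<alpha>)" if "\<alpha> \<in> carrier G" for \<alpha>
    by (rule tensor_map_linear_left[OF mods(1) compH[OF that] mods(2) \<phi>])
  have mem: "?\<Phi> \<alpha> x \<in> carrier (ind_fibre K G H C \<sigma> W \<alpha>)"
    if \<alpha>: "\<alpha> \<in> carrier G" and x: "x \<in> carrier (ind_fibre K G H C \<sigma> V \<alpha>)" for \<alpha> x
  proof -
    note A = compH[OF \<alpha>]
    have xV: "x \<in> carrier (?V \<boxtimes> ?H \<alpha>)"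
      and eq: "tmap ?V (?C \<boxtimes> ?H \<alpha>) (\<lambda>v. v) (ind_L K G H C \<sigma> \<alpha>) x =
        tassoc ?V ?C (?H \<alpha>) (tmap (?V \<boxtimes> ?C) (?H \<alpha>) ?\<rho> (\<lambda>h. h) x)"
      using x carrier_ind_fibre[OF sub V \<alpha>] by simp_all
    have "tmap ?W (?C \<boxtimes> ?H \<alpha>) (\<lambda>v. v) (ind_L K G H C \<sigma> \<alpha>) (?\<Phi> \<alpha> x) =
        tmap ?W (?C \<boxtimes> ?H \<alpha>) ?\<phi> (\<lambda>s. s) (tmap ?V (?C \<boxtimes> ?H \<alpha>) (\<lambda>v. v) (ind_L K G H C \<sigma> \<alpha>) x)"
      by (rule tensor_map_exchange[OF mods(1) A mods(2) _ \<phi> ind_L_linear[OF sub \<alpha>] xV])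
        (use mods A in auto)
    also have "\<dots> = tassoc ?W ?C (?H \<alpha>) (tmap (?W \<boxtimes> ?C) (?H \<alpha>) (tmap ?W ?C ?\<phi> (\<lambda>c. c)) (\<lambda>h. h)
        (tmap (?V \<boxtimes> ?C) (?H \<alpha>) ?\<rho> (\<lambda>h. h) x))"
      unfolding eq
      by (rule tensor_assoc_natural_left[symmetric, OF mods(1,3) A mods(2) \<phi>
            linear_maps_closed[OF tensor_map_linear_left[OF _ _ _ \<rho>] xV]])
        (use mods A in auto)
    also have "tmap (?W \<boxtimes> ?C) (?H \<alpha>) (tmap ?W ?C ?\<phi> (\<lambda>c. c)) (\<lambda>h. h) (tmap (?V \<boxtimes> ?C) (?H \<alpha>) ?\<rho> (\<lambda>h. h) x) =
        tmap (?W \<boxtimes> ?C) (?H \<alpha>) (\<lambda>v. tmap ?W ?C ?\<phi> (\<lambda>c. c) (?\<rho> v)) (\<lambda>h. h) x"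
      by (rule tensor_map_compose_left[OF _ _ _ _ \<rho> tensor_map_linear_left[OF _ _ _ \<phi>] xV])
        (use mods A in auto)
    also have "\<dots> = tmap (?W \<boxtimes> ?C) (?H \<alpha>) (\<lambda>v. ?\<psi> (?\<phi> v)) (\<lambda>h. h) x"
      by (rule tensor_map_cong[OF _ _ _ _ linear_maps_compose[OF \<phi> \<psi>] linear_maps_id _ _ xV])
        (use mods A \<phi>_co in auto)
    also have "\<dots> = tmap (?W \<boxtimes> ?C) (?H \<alpha>) ?\<psi> (\<lambda>h. h) (?\<Phi> \<alpha> x)"
      by (rule tensor_map_compose_left[symmetric, OF _ _ _ _ \<phi> \<psi> xV]) (use mods A in auto)
    finally show ?thesis
      using linear_maps_closed[OF \<Phi>[OF \<alpha>] xV] by (simp add: carrier_ind_fibre[OF sub W \<alpha>])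
  qed
  have \<Phi>I: "?\<Phi> \<alpha> \<in> lin (ind_fibre K G H C \<sigma> V \<alpha>) (ind_fibre K G H C \<sigma> W \<alpha>)" if \<alpha>: "\<alpha> \<in> carrier G" for \<alpha>
  proof -
    have "?\<Phi> \<alpha> \<in> lin (ind_fibre K G H C \<sigma> V \<alpha>) (?W \<boxtimes> ?H \<alpha>)"
      by (rule linear_maps_compose[OF ind_inclusion[OF sub V \<alpha>] \<Phi>[OF \<alpha>]])
    then show ?thesis
      using mem[OF \<alpha>] by (simp add: linear_maps_def ind_fibre_def Let_def Pi_iff)
  qed
  show ?thesis
    unfolding comodule_morphism_def Ind_simps(1)[OF sub V] Ind_simps(1)[OF sub W]
  proof (intro conjI ballI \<Phi>I)
    fix \<alpha> \<beta> x assume \<alpha>: "\<alpha> \<in> carrier G" and \<beta>: "\<beta> \<in> carrier G"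
      and x: "x \<in> carrier (ind_fibre K G H C \<sigma> V (\<alpha> \<otimes>\<^bsub>G\<^esub> \<beta>))"
    let ?A = "?H \<alpha>" and ?B = "?H \<beta>"
    note ab = Q.H.G.m_closed[OF \<alpha> \<beta>]
    note m = mods compH[OF \<alpha>] compH[OF \<beta>] compH[OF ab] module_ind_fibre[OF sub V \<alpha>] module_ind_fibre[OF sub W \<alpha>]
    note xW = mem[OF ab x]
    have xV: "x \<in> carrier (?V \<boxtimes> ?H (\<alpha> \<otimes>\<^bsub>G\<^esub> \<beta>))" using x carrier_ind_fibre[OF sub V ab] by simp
    define y where "y = coaction (Ind K G H C \<sigma> V) \<alpha> \<beta> x"
    note y = Ind_coaction[OF sub V \<alpha> \<beta> x, folded y_def]
    have yI: "tmap (?V \<boxtimes> ?A) ?B (\<lambda>z. z) (\<lambda>h. h) y \<in> carrier ((?V \<boxtimes> ?A) \<boxtimes> ?B)"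
      by (rule linear_maps_closed[OF tensor_map_linear_left[OF _ _ _ ind_inclusion[OF sub V \<alpha>]] y(1)])
        (use m in auto)
    have yW: "tmap (ind_fibre K G H C \<sigma> W \<alpha>) ?B (?\<Phi> \<alpha>) (\<lambda>h. h) y \<in> carrier (ind_fibre K G H C \<sigma> W \<alpha> \<boxtimes> ?B)"
      by (rule linear_maps_closed[OF tensor_map_linear_left[OF _ _ _ \<Phi>I[OF \<alpha>]] y(1)]) (use m in auto)
    have "tmap (?W \<boxtimes> ?A) ?B (\<lambda>z. z) (\<lambda>h. h) (tmap (ind_fibre K G H C \<sigma> W \<alpha>) ?B (?\<Phi> \<alpha>) (\<lambda>h. h) y) =
        tmap (?W \<boxtimes> ?A) ?B (?\<Phi> \<alpha>) (\<lambda>h. h) y"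
      by (rule tensor_map_compose_left[OF _ _ _ _ \<Phi>I[OF \<alpha>] ind_inclusion[OF sub W \<alpha>] y(1)]) (use m in auto)
    also have "\<dots> = tmap (?W \<boxtimes> ?A) ?B (?\<Phi> \<alpha>) (\<lambda>h. h) (tmap (?V \<boxtimes> ?A) ?B (\<lambda>z. z) (\<lambda>h. h) y)"
      by (rule tensor_map_compose_left[symmetric, OF _ _ _ _ ind_inclusion[OF sub V \<alpha>] \<Phi>[OF \<alpha>] y(1)])
        (use m in auto)
    finally have e1: "tmap (?W \<boxtimes> ?A) ?B (\<lambda>z. z) (\<lambda>h. h) (tmap (ind_fibre K G H C \<sigma> W \<alpha>) ?B (?\<Phi> \<alpha>) (\<lambda>h. h) y) =
        tmap (?W \<boxtimes> ?A) ?B (?\<Phi> \<alpha>) (\<lambda>h. h) (tmap (?V \<boxtimes> ?A) ?B (\<lambda>z. z) (\<lambda>h. h) y)" .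
    have e2: "tassoc ?W ?A ?B (tmap (?W \<boxtimes> ?A) ?B (?\<Phi> \<alpha>) (\<lambda>h. h) (tmap (?V \<boxtimes> ?A) ?B (\<lambda>z. z) (\<lambda>h. h) y)) =
        tmap ?W (?A \<boxtimes> ?B) ?\<phi> (\<lambda>s. s) (tmap ?V (?A \<boxtimes> ?B) (\<lambda>v. v) (comult H \<alpha> \<beta>) x)"
      unfolding y(2)[symmetric] by (rule tensor_assoc_natural_left[OF m(1,4,5,2) \<phi> yI])
    have e3: "tmap ?W (?A \<boxtimes> ?B) (\<lambda>w. w) (comult H \<alpha> \<beta>) (?\<Phi> (\<alpha> \<otimes>\<^bsub>G\<^esub> \<beta>) x) =
        tmap ?W (?A \<boxtimes> ?B) ?\<phi> (\<lambda>s. s) (tmap ?V (?A \<boxtimes> ?B) (\<lambda>v. v) (comult H \<alpha> \<beta>) x)"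
      by (rule tensor_map_exchange[OF m(1,6,2) _ \<phi> Q.H.comult_linear[OF \<alpha> \<beta>] xV]) (use m in auto)
    \<comment> \<open>Both sides have the same image under the embedding: \<open>e3\<close>
      evaluates the left one, \<open>e1\<close> and \<open>e2\<close> the right one.\<close>
    have "coaction (Ind K G H C \<sigma> W) \<alpha> \<beta> (?\<Phi> (\<alpha> \<otimes>\<^bsub>G\<^esub> \<beta>) x) =
        tmap (ind_fibre K G H C \<sigma> W \<alpha>) ?B (?\<Phi> \<alpha>) (\<lambda>h. h) y"
      by (rule inj_onD[OF ind_embedding_inj[OF sub W \<alpha> \<beta>] _ Ind_coaction(1)[OF sub W \<alpha> \<beta> xW] yW])
        (simp only: Ind_coaction(2)[OF sub W \<alpha> \<beta> xW] e1 e2 e3)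
    then show "coaction (Ind K G H C \<sigma> W) \<alpha> \<beta> (?\<Phi> (\<alpha> \<otimes>\<^bsub>G\<^esub> \<beta>) x) =
        tmap (ind_fibre K G H C \<sigma> W \<alpha>) ?B (?\<Phi> \<alpha>) (\<lambda>c. c) (coaction (Ind K G H C \<sigma> V) \<alpha> \<beta> x)"
      by (simp only: y_def)
  qed
qed

end

theorem theorem5p4:
  fixes K :: "'k ring" and G :: "'p monoid"
    and H :: "('p, 'k, 'h) hopf_pi_coalgebra"
    and C :: "('p, 'k, 'c) pi_coalgebra"
    and act :: "'p \<Rightarrow> 'h \<Rightarrow> 'c \<Rightarrow> 'c" and \<sigma> :: "'p \<Rightarrow> 'h \<Rightarrow> 'c"
    and V :: "('p, 'k, 'v, 'c) pi_comodule"
    and W :: "('p, 'k, 'w, 'c) pi_comodule"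
  assumes "hopf_pi_coalgebra K G H"
    and "left_pi_coisotropic_subgroup K G H C act \<sigma>"
    and "right_pi_comodule K G C V"
    and "right_pi_comodule K G C W"
  shows "comodule_equivalent K G H
    (Ind K G H C \<sigma> (comodule_sum K C V W))
    (comodule_sum K H (Ind K G H C \<sigma> V) (Ind K G H C \<sigma> W))"
proof -
  interpret Q: left_pi_coisotropic_subgroup K G H C act \<sigma> by fact
  interpret base_field K by (rule base_field.intro) (rule Q.H.K.field_axioms)
  note sub = assms(2) and C = Q.C.pi_coalgebra_axioms and H = Q.H.pi_coalgebra_axioms
  have V: "precomodule G C V" and W: "precomodule G C W"
    using assms(3,4) by (simp_all add: right_pi_comodule_iff[OF C])
  note S = precomodule_sum[OF C V W]
  let ?S = "comodule_sum K C V W" and ?S1 = "fibre (comodule_sum K C V W) \<one>\<^bsub>G\<^esub>"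
    and ?V = "fibre V \<one>\<^bsub>G\<^esub>" and ?W = "fibre W \<one>\<^bsub>G\<^esub>"
  let ?l = "\<lambda>x. (x, \<zero>\<^bsub>?W\<^esub>)" and ?r = "\<lambda>y. (\<zero>\<^bsub>?V\<^esub>, y)"
  note inl = comodule_sum_inl[OF C V W] and inr = comodule_sum_inr[OF C V W]
    and fst = comodule_sum_fst[OF C V W] and snd = comodule_sum_snd[OF C V W]
  note one = Q.H.G.one_closed
  note m = fibre_one[OF sub V] fibre_one[OF sub W] fibre_one[OF sub S]
  note l = morphism_linear[OF C V S inl one] and r = morphism_linear[OF C W S inr one]
    and p = morphism_linear[OF C S V fst one] and q = morphism_linear[OF C S W snd one]
  show ?thesis
  \<comment> \<open>The maps are the images under \<open>Ind\<close> of the projections and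
    inclusions of the sum. The first two goals are functoriality, the third is additivity.\<close>
  proof (rule comodule_equivalent_biproduct[OF H right_pi_comodule_Ind[OF sub S]
        right_pi_comodule_Ind[OF sub V] right_pi_comodule_Ind[OF sub W]
        Ind_morphism[OF sub S V fst] Ind_morphism[OF sub S W snd]
        Ind_morphism[OF sub V S inl] Ind_morphism[OF sub W S inr]])
    fix \<alpha> a assume \<alpha>: "\<alpha> \<in> carrier G" and "a \<in> carrier (fibre (Ind K G H C \<sigma> V) \<alpha>)"
    then have a: "a \<in> carrier (?V \<boxtimes> component H \<alpha>)"
      by (simp add: Ind_simps[OF sub V] carrier_ind_fibre[OF sub V])
    note A = Q.H.component_space[OF \<alpha>]
    show "tmap ?V (component H \<alpha>) fst (\<lambda>h. h) (tmap ?S1 (component H \<alpha>) ?l (\<lambda>h. h) a) = a"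
      by (simp add: tensor_map_compose_left[OF m(1) A m(3,1) l p a] tensor_map_id[OF m(1) A a])
  next
    fix \<alpha> b assume \<alpha>: "\<alpha> \<in> carrier G" and "b \<in> carrier (fibre (Ind K G H C \<sigma> W) \<alpha>)"
    then have b: "b \<in> carrier (?W \<boxtimes> component H \<alpha>)"
      by (simp add: Ind_simps[OF sub W] carrier_ind_fibre[OF sub W])
    note A = Q.H.component_space[OF \<alpha>]
    show "tmap ?W (component H \<alpha>) snd (\<lambda>h. h) (tmap ?S1 (component H \<alpha>) ?r (\<lambda>h. h) b) = b"
      by (simp add: tensor_map_compose_left[OF m(2) A m(3,2) r q b] tensor_map_id[OF m(2) A b])
  next
    fix \<alpha> x assume \<alpha>: "\<alpha> \<in> carrier G" and "x \<in> carrier (fibre (Ind K G H C \<sigma> ?S) \<alpha>)"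
    then have x: "x \<in> carrier (?S1 \<boxtimes> component H \<alpha>)"
      by (simp add: Ind_simps[OF sub S] carrier_ind_fibre[OF sub S])
    note A = Q.H.component_space[OF \<alpha>]
    note lp = linear_maps_compose[OF p l] and rq = linear_maps_compose[OF q r]
    interpret V: module K ?V by (rule m)
    interpret W: module K ?W by (rule m)
    \<comment> \<open>The identity of the fibre of the sum at 1 is l fst + r snd; additivity in the
      left factor carries this decomposition through the tensor product with H_\<alpha>.\<close>
    have "tmap ?S1 (component H \<alpha>) ?l (\<lambda>h. h) (tmap ?V (component H \<alpha>) fst (\<lambda>h. h) x)
        \<oplus>\<^bsub>?S1 \<boxtimes> component H \<alpha>\<^esub>
        tmap ?S1 (component H \<alpha>) ?r (\<lambda>h. h) (tmap ?W (component H \<alpha>) snd (\<lambda>h. h) x) =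
        tmap ?S1 (component H \<alpha>) (\<lambda>z. ?l (fst z) \<oplus>\<^bsub>?S1\<^esub> ?r (snd z)) (\<lambda>h. h) x"
      unfolding tensor_map_compose_left[OF m(3) A m(1,3) p l x] tensor_map_compose_left[OF m(3) A m(2,3) q r x]
      by (rule tensor_map_add_left[symmetric, OF m(3) A m(3) A lp rq linear_maps_id x])
    also have "\<dots> = tmap ?S1 (component H \<alpha>) (\<lambda>z. z) (\<lambda>h. h) x"
      by (rule tensor_map_cong[OF m(3) A m(3) A linear_maps_id linear_maps_id _ _ x])
        (auto simp: comodule_sum_def)
    also have "\<dots> = x" by (rule tensor_map_id[OF m(3) A x])
    \<comment> \<open>\<open>ind_fibre\<close> changes only the carrier, so addition in the induced
      fibre is that of the ambient tensor product.\<close>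
    finally show "tmap ?S1 (component H \<alpha>) ?l (\<lambda>h. h) (tmap ?V (component H \<alpha>) fst (\<lambda>h. h) x)
        \<oplus>\<^bsub>fibre (Ind K G H C \<sigma> ?S) \<alpha>\<^esub>
        tmap ?S1 (component H \<alpha>) ?r (\<lambda>h. h) (tmap ?W (component H \<alpha>) snd (\<lambda>h. h) x) = x"
      by (simp add: Ind_simps[OF sub S] ind_fibre_def Let_def)
  qed
qed

end
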